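(* For every integer $n>0$, \[ T_{\tilde S_n}(s,q) = \sum_{k=0}^{\lfloor n/2\rfloor} \left( s^k \, q^{k^2} \, \frac{[n]_q}{[2n-2k]_q} \, \binom{n-k}{k}_q \, (-q^{k+1};q)_{n-2k}\right). \]
   Context: Coxeter notions. For a Coxeter system $(W,S)$ with $S$ finite and length function $\ell$, the Poincaré series is $P_W(q)=\sum_{w\in W}q^{\ell(w)}$. For $J\subset S$, $W_J=\langle J\rangle$ and $W^J=\{w\in W:\ell(ws)>\ell(w)\ \forall s\in J\}$. For an automorphism $\diamond$ of $W$ with $\diamond^2=\mathrm{id}$ and $S^\diamond=S$, put $\mathbf I_\diamond(W)=\{w\in W: w^{-1}=w^\diamond\}$ and let $\ell'_\diamond:\mathbf I_\diamond(W)\to\mathbb N$ be the unique function with (a) $\ell'_\diamond(1)=0$; (b) $\ell'_\diamond(sws^\diamond)=\ell'_\diamond(w)$ for $s\in S$, $w\in \mathbf I_\diamond(W)$; (c) $\ell'_\diamond(ws)-\ell'_\diamond(w)=\ell(ws)-\ell(w)$ whenever $s\in S$, $w\in\mathbf I_\diamond(W)$ and $ws\in \mathbf I_\diamond(W)$. Set $L_{W,\diamond}(q)=\sum_{w\in \mathbf I_\diamond(W)}q^{\ell(w)}\left(\frac{q-1}{q+1}\right)^{\ell'_\diamond(w)}$. For $\diamond=\mathrm{id}$ write $\mathbf I(W)$ (the involutions), $\ell'$ and $L_W$. For $J\subset S$ define \[L^J_W(s,q)=\sum_{w\in \mathbf I(W)\cap W^J} q^{\ell(w)}\left(s\frac{1-q}{1+q}\right)^{\ell'(w)}\frac{P_{W_J}(q^2)}{P_{W_K}(q^2)}L_{W_K,\diamond}(q),\]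 where, for each $w$, $\diamond$ is the automorphism $x\mapsto wxw$ of $W$, $K=J\cap wJw$, and $L_{W_K,\diamond}$ is computed for the Coxeter system $(W_K,K)$ with $\diamond$ restricted to $W_K$. Affine symmetric group. For $n\ge2$, $\tilde S_n$ is the group of bijections $w:\mathbb Z\to\mathbb Z$ with $w(i+n)=w(i)+n$ for all $i$ and $\sum_{i=1}^n w(i)=\sum_{i=1}^n i$; it is a Coxeter group with simple generators $s_0,\dots,s_{n-1}$, where $s_i$ maps $j\mapsto j+1$ if $j\equiv i$, $j\mapsto j-1$ if $j\equiv i+1 \pmod n$, and fixes $j$ otherwise (for $n=2$ this is the infinite dihedral group). $\tilde S_1$ is the trivial group with empty generating set. Let $J=\{s_1,\dots,s_{n-1}\}$. Define \[T_{\tilde S_n}(s,q)=L^J_{\tilde S_n}(s,q)/L_{\tilde S_n}(q).\] $q$-notation: $[n]_q=\frac{1-q^n}{1-q}$, $[n]_q!=\prod_{k=1}^n[k]_q$, $\binom{n}{k}_q=\frac{[n]_q!}{[k]_q![n-k]_q!}$, $(a;q)_n=\prod_{i=0}^{n-1}(1-aq^i)$ with $(a;q)_0=1$. *)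

theory Defs
  imports
    "HOL-Algebra.Generated_Groups"
    "HOL-Analysis.Infinite_Sum"
    "HOL-Computational_Algebra.Formal_Power_Series"
    "HOL-Computational_Algebra.Fraction_Field"
    "HOL-Computational_Algebra.Polynomial"
    "HOL-Library.FuncSet"
begin

text \<open>
  A Coxeter system $(W,S)$ is passed as a group \<open>G\<close> together with the set \<open>S\<close> of simple generators.
  The parabolic subgroup $(W_J, J)$ is the pair \<open>(subgroup_generated G J, J)\<close>.

  All series are formal power series in the indeterminate $q$, which is \<^term>\<open>fps_X\<close>, and
  \<^const>\<open>infsum\<close> is taken in the $q$-adic topology that the library puts on \<^typ>\<open>'k fps\<close>
  (lemma \<open>infsum_fps_nth\<close> below: for locally finite families this is the coefficientwise sum).
  The variable $s$ ranges over the coefficient field \<open>'k\<close>; the case of an indeterminate $s$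
  over the rationals is \<open>'k = rat poly fract\<close>, which the instance declaration below makes available.
\<close>

instance fract :: ("{idom, ring_char_0}") field_char_0
proof
  have of_nat_fract: "of_nat k = Fract (of_nat k) (1 :: 'a)" for k
    by (induction k) (simp_all add: Zero_fract_def One_fract_def)
  show "inj (of_nat :: nat \<Rightarrow> 'a fract)"
    by (rule injI) (simp add: of_nat_fract eq_fract)
qed

lemma infsum_fps_nth:
  fixes f :: "'b \<Rightarrow> 'k::field fps"
  assumes fin: "\<And>m. finite {w \<in> A. fps_nth (f w) m \<noteq> 0}"
  shows "f summable_on A"
    and "fps_nth (infsum f A) m = (\<Sum>w | w \<in> A \<and> fps_nth (f w) m \<noteq> 0. fps_nth (f w) m)"
proof -
  define g where "g = Abs_fps (\<lambda>m. \<Sum>w | w \<in> A \<and> fps_nth (f w) m \<noteq> 0. fps_nth (f w) m)"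
  have hs: "(f has_sum g) A"
    unfolding has_sum_def
  proof (rule tendsto_fpsI)
    fix k
    show "\<forall>\<^sub>F F in finite_subsets_at_top A. fps_nth (sum f F) k = fps_nth g k"
      unfolding eventually_finite_subsets_at_top
    proof (intro exI[of _ "{w \<in> A. fps_nth (f w) k \<noteq> 0}"] conjI allI impI)
      fix F assume F: "finite F \<and> {w \<in> A. fps_nth (f w) k \<noteq> 0} \<subseteq> F \<and> F \<subseteq> A"
      have "fps_nth (sum f F) k = (\<Sum>w\<in>F. fps_nth (f w) k)"
        by (simp add: fps_sum_nth)
      also have "\<dots> = fps_nth g k"
        unfolding g_def using F by (auto intro!: sum.mono_neutral_right)
      finally show "fps_nth (sum f F) k = fps_nth g k" .
    qed (use fin in auto)
  qed
  show "f summable_on A" using hs unfolding summable_on_def by blast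
  show "fps_nth (infsum f A) m = (\<Sum>w | w \<in> A \<and> fps_nth (f w) m \<noteq> 0. fps_nth (f w) m)"
    using infsumI[OF hs] by (simp add: g_def)
qed

text \<open>Simple generators are involutions, so words need no inverse letters.\<close>

definition word_length :: "('a, 'b) monoid_scheme \<Rightarrow> 'a set \<Rightarrow> 'a \<Rightarrow> nat" where
  "word_length G S w =
     (LEAST k. \<exists>xs. set xs \<subseteq> S \<and> length xs = k \<and> foldr (monoid.mult G) xs \<one>\<^bsub>G\<^esub> = w)"

definition poincare_series :: "('a, 'b) monoid_scheme \<Rightarrow> 'a set \<Rightarrow> 'k::field fps" where
  "poincare_series G S = (\<Sum>\<^sub>\<infinity>w\<in>carrier G. fps_X ^ word_length G S w)"

definition min_coset_reps :: "('a, 'b) monoid_scheme \<Rightarrow> 'a set \<Rightarrow> 'a set \<Rightarrow> 'a set" where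
  "min_coset_reps G S J =
     {w \<in> carrier G. \<forall>s\<in>J. word_length G S (w \<otimes>\<^bsub>G\<^esub> s) > word_length G S w}"

definition twisted_involutions :: "('a, 'b) monoid_scheme \<Rightarrow> ('a \<Rightarrow> 'a) \<Rightarrow> 'a set" where
  "twisted_involutions G d = {w \<in> carrier G. inv\<^bsub>G\<^esub> w = d w}"

text \<open>
  The function $\ell'_\diamond$ lives on the twisted involutions only; \<^const>\<open>extensional\<close> fixes the
  irrelevant values elsewhere, so that the description by \<open>THE\<close> can be unique.
\<close>

definition is_twisted_abs_length ::
  "('a, 'b) monoid_scheme \<Rightarrow> 'a set \<Rightarrow> ('a \<Rightarrow> 'a) \<Rightarrow> ('a \<Rightarrow> nat) \<Rightarrow> bool" where
  "is_twisted_abs_length G S d f \<longleftrightarrow>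
     f \<in> extensional (twisted_involutions G d) \<and>
     f \<one>\<^bsub>G\<^esub> = 0 \<and>
     (\<forall>s\<in>S. \<forall>w\<in>twisted_involutions G d. f (s \<otimes>\<^bsub>G\<^esub> w \<otimes>\<^bsub>G\<^esub> d s) = f w) \<and>
     (\<forall>s\<in>S. \<forall>w\<in>twisted_involutions G d. w \<otimes>\<^bsub>G\<^esub> s \<in> twisted_involutions G d \<longrightarrow>
        int (f (w \<otimes>\<^bsub>G\<^esub> s)) - int (f w) =
        int (word_length G S (w \<otimes>\<^bsub>G\<^esub> s)) - int (word_length G S w))"

definition twisted_abs_length ::
  "('a, 'b) monoid_scheme \<Rightarrow> 'a set \<Rightarrow> ('a \<Rightarrow> 'a) \<Rightarrow> 'a \<Rightarrow> nat" where
  "twisted_abs_length G S d = (THE f. is_twisted_abs_length G S d f)"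

definition L_series :: "('a, 'b) monoid_scheme \<Rightarrow> 'a set \<Rightarrow> ('a \<Rightarrow> 'a) \<Rightarrow> 'k::field fps" where
  "L_series G S d =
     (\<Sum>\<^sub>\<infinity>w\<in>twisted_involutions G d.
        fps_X ^ word_length G S w * ((fps_X - 1) / (fps_X + 1)) ^ twisted_abs_length G S d w)"

definition L_parabolic ::
  "('a, 'b) monoid_scheme \<Rightarrow> 'a set \<Rightarrow> 'a set \<Rightarrow> 'k::field \<Rightarrow> 'k fps" where
  "L_parabolic G S J s =
     (\<Sum>\<^sub>\<infinity>w\<in>twisted_involutions G (\<lambda>x. x) \<inter> min_coset_reps G S J.
        let d = (\<lambda>x. w \<otimes>\<^bsub>G\<^esub> x \<otimes>\<^bsub>G\<^esub> w);
            K = J \<inter> d ` J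
        in fps_X ^ word_length G S w
           * (fps_const s * ((1 - fps_X) / (1 + fps_X))) ^ twisted_abs_length G S (\<lambda>x. x) w
           * (fps_compose (poincare_series (subgroup_generated G J) J) (fps_X ^ 2)
              / fps_compose (poincare_series (subgroup_generated G K) K) (fps_X ^ 2))
           * L_series (subgroup_generated G K) K d)"


definition affine_sym :: "nat \<Rightarrow> (int \<Rightarrow> int) monoid" where
  "affine_sym n =
     \<lparr>carrier = {w. bij w \<and> (\<forall>i. w (i + int n) = w i + int n) \<and>
                    (\<Sum>i = 1..int n. w i) = (\<Sum>i = 1..int n. i)},
      monoid.mult = (\<circ>), one = id\<rparr>"

definition affine_gen :: "nat \<Rightarrow> nat \<Rightarrow> int \<Rightarrow> int" where
  "affine_gen n i = (\<lambda>j. if j mod int n = int i mod int n then j + 1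
                         else if j mod int n = (int i + 1) mod int n then j - 1
                         else j)"

text \<open>For \<open>n = 1\<close> the group is trivial, but \<open>affine_gen 1 0\<close> is a shift that lies outside it.\<close>

definition affine_gens :: "nat \<Rightarrow> (int \<Rightarrow> int) set" where
  "affine_gens n = (if n \<ge> 2 then affine_gen n ` {0..<n} else {})"

definition affine_J :: "nat \<Rightarrow> (int \<Rightarrow> int) set" where
  "affine_J n = affine_gen n ` {1..<n}"

definition T_affine :: "nat \<Rightarrow> 'k::field \<Rightarrow> 'k fps" where
  "T_affine n s =
     L_parabolic (affine_sym n) (affine_gens n) (affine_J n) s
     / L_series (affine_sym n) (affine_gens n) (\<lambda>x. x)"

definition q_int :: "nat \<Rightarrow> 'k::field fps" where
  "q_int n = (1 - fps_X ^ n) / (1 - fps_X)"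

definition q_fact :: "nat \<Rightarrow> 'k::field fps" where
  "q_fact n = (\<Prod>k = 1..n. q_int k)"

definition q_binomial :: "nat \<Rightarrow> nat \<Rightarrow> 'k::field fps" where
  "q_binomial n k = q_fact n / (q_fact k * q_fact (n - k))"

definition q_pochhammer :: "'k::field fps \<Rightarrow> nat \<Rightarrow> 'k fps" where
  "q_pochhammer a n = (\<Prod>i<n. 1 - a * fps_X ^ i)"

end

theory Submission
  imports Defs "HOL-Computational_Algebra.Formal_Laurent_Series"
begin

text \<open>
  Write an affine permutation as \<open>w i = \<sigma> i + n * a i\<close> on the window \<open>{1..n}\<close>. For an involution, \<open>\<sigma>\<close> is an
  involution with \<open>a (\<sigma> i) = - a i\<close>, and Shi's length formula splits as
  \<open>\<ell> = D(a) + 2 inv(a) + E(\<sigma>)\<close>, where \<open>D(a)\<close> depends only on the multiset of values of \<open>a\<close> and \<open>E\<close> counts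
  the inversions of \<open>\<sigma>\<close> inside the level sets of \<open>a\<close>; \<open>\<ell>'\<close> is the number of 2-cycles modulo \<open>n\<close>.
  The minimal involutions in \<open>W\<^sup>J\<close> are those with \<open>a\<close> sorted and \<open>E = 0\<close>, and \<open>W\<^sub>K\<close> is then the stabilizer of \<open>a\<close>, so
  both \<open>L\<^sup>J(s, q)\<close> and \<open>L(q)\<close> become the same sum over value multisets, with \<open>s = -1\<close> for the latter.
  If \<open>\<kappa>\<^sub>u\<close> is the number of values above \<open>u\<close>, that sum runs over chains \<open>\<kappa>\<^sub>0 \<ge> \<kappa>\<^sub>1 \<ge> \<dots>\<close>, and the weight of all chains starting
  at \<open>k\<close> is the fixed point of a recursion solved by the \<open>q\<close>-binomial theorem. The factor common to all \<open>k\<close>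
  cancels in the quotient because the coefficients satisfy the \<open>q\<close>-Chebyshev recurrence
  \<open>T\<^sub>n = (1 + q\<^sup>n\<^sup>-\<^sup>1) T\<^sub>n\<^sub>-\<^sub>1 + s q\<^sup>n\<^sup>-\<^sup>1 T\<^sub>n\<^sub>-\<^sub>2\<close>, whose solution at \<open>s = -1\<close> is constantly 1.
\<close>

subsection \<open>Generating functions of inversions\<close>

text \<open>The two series meet multiset by multiset. If \<open>w\<close> is the minimal involution
  with vector \<open>a\<close>, then \<open>u \<mapsto> u \<circ> w\<close> carries the twisted
  involutions of \<open>W\<^sub>K\<close> onto all involutions with the same \<open>a\<close>;
  lengths add, and the twisted \<open>\<ell>'\<close> of \<open>u\<close> is the number of 2-cycles
  that \<open>u \<circ> w\<close> has beyond those of \<open>w\<close>. The quotient of Poincare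
  series in q^2 is a multinomial coefficient in q^2, that is, the sum of q^(2 inv) over the
  rearrangements of \<open>a\<close>. So a multiset contributes the same to both series, except that
  in the parabolic one each 2-cycle between nonzero levels carries s (1 - q) / (1 + q) instead of (q
  - 1) / (q + 1). The 2-cycles inside level 0 keep the latter weight and add up to the series of a
  symmetric group. Three obstacles shape the proof. \<open>\<ell>'\<close> is a definite
  description, so a function with its properties has to be exhibited and shown unique. The sums are
  infinite, so they are compared modulo q^B on the involutions with all values of \<open>a\<close>
  at most B in absolute value. Power series do not form a field, so the rational identities are
  checked among Laurent series.\<close>

definition q_sum :: "'r::comm_ring_1 \<Rightarrow> nat \<Rightarrow> 'r" where
  "q_sum x m = (\<Sum>i<m. x ^ i)"

text \<open>Free of quotients over any commutative ring, so that one identity serves at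
  \<open>fps_X\<close>, at \<open>fps_X\<^sup>2\<close>, at \<open>fls_X\<close> and at the integer
  0.\<close>

definition q_factorial :: "'r::comm_ring_1 \<Rightarrow> nat \<Rightarrow> 'r" where
  "q_factorial x m = (\<Prod>k = 1..m. q_sum x k)"

lemma q_sum_0 [simp]: "q_sum x 0 = 0"
  by (simp add: q_sum_def)

lemma q_sum_Suc: "q_sum x (Suc m) = q_sum x m + x ^ m"
  by (simp add: q_sum_def)

lemma q_sum_add: "q_sum x (a + b) = q_sum x a + x ^ a * q_sum x b"
  by (induction b) (simp_all add: q_sum_Suc algebra_simps power_add)

lemma q_factorial_0 [simp]: "q_factorial x 0 = 1"
  by (simp add: q_factorial_def)

lemma q_factorial_Suc: "q_factorial x (Suc m) = q_factorial x m * q_sum x (Suc m)"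
  by (simp add: q_factorial_def)

lemma q_factorial_pred: "m > 0 \<Longrightarrow> q_factorial x m = q_factorial x (m - 1) * q_sum x m"
  by (cases m) (simp_all add: q_factorial_Suc)

text \<open>The number of larger elements takes each value below \<open>card B\<close> exactly once.
  This is the factor produced by choosing the image of the largest position.\<close>

lemma sum_power_card_above:
  fixes B :: "'i::linorder set"
  assumes "finite B"
  shows "(\<Sum>y\<in>B. p ^ card {z \<in> B. z > y}) = q_sum p (card B)"
  using assms
proof (induction B rule: finite_linorder_min_induct)
  case empty
  then show ?case by simp
next
  case (insert b A)
  have b: "b \<notin> A" using insert by auto
  have 1: "{z \<in> insert b A. z > b} = A" using insert by auto
  have 2: "{z \<in> insert b A. z > y} = {z \<in> A. z > y}" if "y \<in> A" for y
    using insert that by auto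
  have "(\<Sum>y\<in>insert b A. p ^ card {z \<in> insert b A. z > y})
      = p ^ card A + (\<Sum>y\<in>A. p ^ card {z \<in> A. z > y})"
    using insert(1) b by (simp only: sum.insert[OF insert(1) b] 1 2 cong: sum.cong)
  then show ?case using insert b by (simp add: q_sum_Suc)
qed

text \<open>Blocks of sizes \<open>m v\<close> are stacked from the largest letter downwards: block
  \<open>v\<close> is shifted by the mass above it, and \<open>q_sum_add\<close> glues the blocks.
  It performs the sum over the last letter of a word.\<close>

lemma sum_power_mass_above:
  fixes V :: "'i::linorder set"
  assumes "finite V"
  shows "(\<Sum>v\<in>V. p ^ (\<Sum>u\<in>{u \<in> V. u > v}. m u) * q_sum p (m v)) = q_sum p (sum m V)"
  using assms
proof (induction V rule: finite_linorder_min_induct)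
  case empty
  then show ?case by simp
next
  case (insert b A)
  have b: "b \<notin> A" using insert by auto
  have 1: "{z \<in> insert b A. z > b} = A" using insert by auto
  have 2: "{z \<in> insert b A. z > y} = {z \<in> A. z > y}" if "y \<in> A" for y
    using insert that by auto
  have "(\<Sum>y\<in>insert b A. p ^ (\<Sum>u\<in>{u \<in> insert b A. u > y}. m u) * q_sum p (m y))
      = p ^ (sum m A) * q_sum p (m b) + (\<Sum>y\<in>A. p ^ (\<Sum>u\<in>{u \<in> A. u > y}. m u) * q_sum p (m y))"
    using insert(1) b by (simp only: sum.insert[OF insert(1) b] 1 2 cong: sum.cong)
  also have "\<dots> = q_sum p (sum m A + m b)" using insert by (simp add: q_sum_add)
  finally show ?case using insert b by (simp add: add.commute)
qed

definition fiber_card :: "'i set \<Rightarrow> ('i \<Rightarrow> 'v) \<Rightarrow> 'v \<Rightarrow> nat" where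
  "fiber_card A f v = card {i \<in> A. f i = v}"

lemma fiber_card_insert:
  assumes "finite A" "x \<notin> A"
  shows "fiber_card (insert x A) f v = fiber_card A f v + (if f x = v then 1 else 0)"
proof -
  have "{i \<in> insert x A. f i = v} = (if f x = v then insert x {i \<in> A. f i = v} else {i \<in> A. f i = v})"
    by auto
  then show ?thesis using assms by (simp add: fiber_card_def)
qed

lemma fiber_card_cong: "(\<And>i. i \<in> A \<Longrightarrow> f i = g i) \<Longrightarrow> fiber_card A f v = fiber_card A g v"
  by (auto simp: fiber_card_def intro!: arg_cong[of _ _ card])

lemma sum_fiber_card:
  assumes "finite A" "finite V" "f ` A \<subseteq> V"
  shows "(\<Sum>v\<in>V. fiber_card A f v) = card A"
  using assms
proof (induction A rule: finite_induct)
  case empty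
  then show ?case by (simp add: fiber_card_def)
next
  case (insert x A)
  then show ?case by (simp add: fiber_card_insert sum.distrib)
qed

section \<open>Bijections between level sets\<close>

definition level_maps :: "'i set \<Rightarrow> ('i \<Rightarrow> 'v) \<Rightarrow> 'j set \<Rightarrow> ('j \<Rightarrow> 'v) \<Rightarrow> ('i \<Rightarrow> 'j) set" where
  "level_maps A f B g = {\<sigma> \<in> extensional A. bij_betw \<sigma> A B \<and> (\<forall>i\<in>A. g (\<sigma> i) = f i)}"

definition level_invs :: "'i::linorder set \<Rightarrow> ('i \<Rightarrow> 'v) \<Rightarrow> ('i \<Rightarrow> 'j::linorder) \<Rightarrow> nat" where
  "level_invs A f \<sigma> = card {(i, j). i \<in> A \<and> j \<in> A \<and> i < j \<and> f i = f j \<and> \<sigma> j < \<sigma> i}"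

lemma finite_level_maps: "finite A \<Longrightarrow> finite B \<Longrightarrow> finite (level_maps A f B g)"
proof (rule finite_subset)
  show "level_maps A f B g \<subseteq> A \<rightarrow>\<^sub>E B"
    by (auto simp: level_maps_def bij_betw_def PiE_def)
qed (simp add: finite_PiE)

lemma bij_betw_fiber:
  assumes "bij_betw \<sigma> A B" "\<forall>i\<in>A. g (\<sigma> i) = f i"
  shows "bij_betw \<sigma> {i \<in> A. f i = v \<and> P (\<sigma> i)} {j \<in> B. g j = v \<and> P j}"
proof (rule bij_betw_subset[OF assms(1)])
  show "\<sigma> ` {i \<in> A. f i = v \<and> P (\<sigma> i)} = {j \<in> B. g j = v \<and> P j}" (is "?L = ?R")
  proof
    show "?L \<subseteq> ?R" using assms by (auto simp: bij_betw_def)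
    show "?R \<subseteq> ?L"
    proof
      fix j assume j: "j \<in> ?R"
      then obtain i where "i \<in> A" "\<sigma> i = j" using assms(1) by (auto simp: bij_betw_def)
      then show "j \<in> ?L" using j assms(2) by auto
    qed
  qed
qed auto

text \<open>Besides the inversions of \<open>\<sigma>\<close>, only pairs \<open>(i, x)\<close> with
  \<open>\<sigma> i > y\<close> in the level of \<open>x\<close> arise, and \<open>\<sigma>\<close>
  itself carries these \<open>i\<close> to the elements of \<open>B\<close> above \<open>y\<close>
  in that level.\<close>

lemma level_invs_insert_max:
  fixes x :: "'i::linorder" and y :: "'j::linorder"
  assumes "finite A" and x: "\<forall>a\<in>A. a < x" and \<sigma>: "bij_betw \<sigma> A (B - {y})" "\<forall>i\<in>A. g (\<sigma> i) = f i"
  shows "level_invs (insert x A) f (\<sigma>(x := y)) = level_invs A f \<sigma> + card {z \<in> B. g z = f x \<and> z > y}"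
proof -
  have "{(i, j). i \<in> insert x A \<and> j \<in> insert x A \<and> i < j \<and> f i = f j \<and> (\<sigma>(x := y)) j < (\<sigma>(x := y)) i}
    = {(i, j). i \<in> A \<and> j \<in> A \<and> i < j \<and> f i = f j \<and> \<sigma> j < \<sigma> i} \<union>
      (\<lambda>i. (i, x)) ` {i \<in> A. f i = f x \<and> \<sigma> i > y}" (is "?L = ?P \<union> ?R")
    using x by (auto simp: fun_upd_def split: if_splits)
  moreover have "finite ?P" by (rule finite_subset[of _ "A \<times> A"]) (use assms in auto)
  moreover have "finite ?R" using assms by simp
  moreover have "?P \<inter> ?R = {}" using x by auto
  ultimately have "card ?L = card ?P + card ?R" by (simp add: card_Un_disjoint)
  also have "card ?R = card {i \<in> A. f i = f x \<and> \<sigma> i > y}"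
    by (rule card_image) (auto simp: inj_on_def)
  also have "\<dots> = card {j \<in> B - {y}. g j = f x \<and> j > y}"
    by (rule bij_betw_same_card, rule bij_betw_fiber[OF \<sigma>])
  also have "{j \<in> B - {y}. g j = f x \<and> j > y} = {z \<in> B. g z = f x \<and> z > y}" by auto
  finally show ?thesis by (simp add: level_invs_def)
qed

lemma sum_level_maps_insert:
  assumes x: "x \<notin> A" "finite A" "finite B"
  shows "sum F (level_maps (insert x A) f B g)
       = (\<Sum>y\<in>{y \<in> B. g y = f x}. \<Sum>\<sigma>\<in>level_maps A f (B - {y}) g. F (\<sigma>(x := y)))"
proof -
  have "sum F (level_maps (insert x A) f B g)
      = (\<Sum>(y, \<sigma>)\<in>Sigma {y \<in> B. g y = f x} (\<lambda>y. level_maps A f (B - {y}) g). F (\<sigma>(x := y)))"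
  proof (rule sum.reindex_bij_witness[where i = "\<lambda>(y, \<sigma>). \<sigma>(x := y)" and j = "\<lambda>\<tau>. (\<tau> x, restrict \<tau> A)"])
    fix \<tau> assume \<tau>: "\<tau> \<in> level_maps (insert x A) f B g"
    then have e: "\<tau> \<in> extensional (insert x A)" and b: "bij_betw \<tau> (insert x A) B"
      and l: "\<forall>i\<in>insert x A. g (\<tau> i) = f i" by (auto simp: level_maps_def)
    show 1: "(case (\<tau> x, restrict \<tau> A) of (y, \<sigma>) \<Rightarrow> \<sigma>(x := y)) = \<tau>"
      using e by (auto simp: fun_eq_iff extensional_def restrict_def)
    then show "(case (\<tau> x, restrict \<tau> A) of (y, \<sigma>) \<Rightarrow> F (\<sigma>(x := y))) = F \<tau>" by simp
    have "bij_betw \<tau> (insert x A - {x}) (B - {\<tau> x})"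
      using b by (intro bij_betw_DiffI) (auto simp: bij_betw_def)
    then have "bij_betw (restrict \<tau> A) A (B - {\<tau> x})"
      using x by simp
    then show "(\<tau> x, restrict \<tau> A) \<in> Sigma {y \<in> B. g y = f x} (\<lambda>y. level_maps A f (B - {y}) g)"
      using l b by (auto simp: level_maps_def bij_betw_def)
  next
    fix c assume "c \<in> Sigma {y \<in> B. g y = f x} (\<lambda>y. level_maps A f (B - {y}) g)"
    then obtain y \<sigma> where c: "c = (y, \<sigma>)" and y: "y \<in> B" "g y = f x"
      and \<sigma>: "\<sigma> \<in> extensional A" "bij_betw \<sigma> A (B - {y})" "\<forall>i\<in>A. g (\<sigma> i) = f i"
      by (auto simp: level_maps_def)
    have r: "restrict (\<sigma>(x := y)) A = \<sigma>" using \<sigma>(1) x(1) by (auto simp: fun_eq_iff extensional_def)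
    have "bij_betw (\<sigma>(x := y)) A (B - {y})"
      using \<sigma>(2) x(1) by (metis bij_betw_cong fun_upd_other)
    then have "bij_betw (\<sigma>(x := y)) (A \<union> {x}) ((B - {y}) \<union> {y})"
      by (intro bij_betw_combine) auto
    moreover have "(B - {y}) \<union> {y} = B" using y by auto
    ultimately have "bij_betw (\<sigma>(x := y)) (insert x A) B" by simp
    then show "(case c of (y, \<sigma>) \<Rightarrow> \<sigma>(x := y)) \<in> level_maps (insert x A) f B g"
      using \<sigma> y x by (auto simp: level_maps_def c extensional_def)
    show "(\<lambda>\<tau>. (\<tau> x, restrict \<tau> A)) (case c of (y, \<sigma>) \<Rightarrow> \<sigma>(x := y)) = c"
      using r by (simp add: c)
  qed
  also have "\<dots> = (\<Sum>y\<in>{y \<in> B. g y = f x}. \<Sum>\<sigma>\<in>level_maps A f (B - {y}) g. F (\<sigma>(x := y)))"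
    by (rule sum.Sigma[symmetric]) (use x in \<open>auto intro: finite_level_maps\<close>)
  finally show ?thesis .
qed

text \<open>The largest position \<open>x\<close> can go to any \<open>y\<close> of its level and
  gains one inversion for each element of the level above \<open>y\<close>; these choices add up to
  a \<open>q\<close>-integer by \<open>sum_power_card_above\<close>. Two labellings \<open>f\<close>
  and \<open>g\<close> are kept because \<open>A\<close> and \<open>B\<close> lose different
  elements in the induction, and because the target carries \<open>- a\<close> in
  \<open>unique_level_map\<close>.\<close>

theorem sum_level_maps:
  fixes A :: "'i::linorder set" and B :: "'j::linorder set"
  assumes "finite A" "finite B" "finite V" "f ` A \<subseteq> V" "\<And>v. fiber_card A f v = fiber_card B g v"
    "card A = card B"
  shows "(\<Sum>\<sigma>\<in>level_maps A f B g. p ^ level_invs A f \<sigma>) = (\<Prod>v\<in>V. q_factorial p (fiber_card A f v))"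
  using assms
proof (induction A arbitrary: B rule: finite_linorder_max_induct)
  case empty
  then have "B = {}" by simp
  then have "level_maps {} f B g = {\<lambda>x. undefined}" by (auto simp: level_maps_def bij_betw_def)
  then show ?case by (simp add: level_invs_def fiber_card_def)
next
  case (insert x A)
  have xA: "x \<notin> A" using insert by auto
  let ?Y = "{y \<in> B. g y = f x}"
  have "(\<Sum>\<sigma>\<in>level_maps (insert x A) f B g. p ^ level_invs (insert x A) f \<sigma>)
    = (\<Sum>y\<in>?Y. \<Sum>\<sigma>\<in>level_maps A f (B - {y}) g. p ^ level_invs (insert x A) f (\<sigma>(x := y)))"
    by (rule sum_level_maps_insert) (use insert xA in auto)
  also have "\<dots> = (\<Sum>y\<in>?Y. p ^ card {z \<in> ?Y. z > y} * (\<Prod>v\<in>V. q_factorial p (fiber_card A f v)))"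
  proof (rule sum.cong[OF refl])
    fix y assume y: "y \<in> ?Y"
    have B: "B = insert y (B - {y})" using y by auto
    have fc: "fiber_card A f v = fiber_card (B - {y}) g v" for v
      using insert.prems(4)[of v] y insert.prems(1)
        fiber_card_insert[of A x f v] fiber_card_insert[of "B - {y}" y g v] insert.hyps(1) xA B
      by (auto split: if_splits)
    have "(\<Sum>\<sigma>\<in>level_maps A f (B - {y}) g. p ^ level_invs (insert x A) f (\<sigma>(x := y)))
      = (\<Sum>\<sigma>\<in>level_maps A f (B - {y}) g. p ^ level_invs A f \<sigma> * p ^ card {z \<in> ?Y. z > y})"
      by (rule sum.cong[OF refl], subst level_invs_insert_max)
        (use insert in \<open>auto simp: level_maps_def power_add conj_assoc\<close>)
    also have "\<dots> = (\<Prod>v\<in>V. q_factorial p (fiber_card A f v)) * p ^ card {z \<in> ?Y. z > y}"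
      unfolding sum_distrib_right[symmetric]
      using insert.IH[of "B - {y}"] insert.prems insert.hyps fc y xA by simp
    finally show "(\<Sum>\<sigma>\<in>level_maps A f (B - {y}) g. p ^ level_invs (insert x A) f (\<sigma>(x := y)))
       = p ^ card {z \<in> ?Y. z > y} * (\<Prod>v\<in>V. q_factorial p (fiber_card A f v))"
      by (simp add: mult.commute)
  qed
  also have "\<dots> = q_sum p (card ?Y) * (\<Prod>v\<in>V. q_factorial p (fiber_card A f v))"
    unfolding sum_distrib_right[symmetric] using insert.prems by (subst sum_power_card_above) auto
  also have "card ?Y = Suc (fiber_card A f (f x))"
    using insert.prems(4)[of "f x"] insert.hyps xA by (simp add: fiber_card_def[of B] fiber_card_insert)
  also have "(\<Prod>v\<in>V. q_factorial p (fiber_card A f v))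
      = q_factorial p (fiber_card A f (f x)) * (\<Prod>v\<in>V-{f x}. q_factorial p (fiber_card A f v))"
    using insert.prems by (intro prod.remove) auto
  also have "q_sum p (Suc (fiber_card A f (f x))) * \<dots>
      = q_factorial p (fiber_card (insert x A) f (f x)) * (\<Prod>v\<in>V-{f x}. q_factorial p (fiber_card (insert x A) f v))"
  proof -
    have "(\<Prod>v\<in>V-{f x}. q_factorial p (fiber_card (insert x A) f v)) = (\<Prod>v\<in>V-{f x}. q_factorial p (fiber_card A f v))"
      by (rule prod.cong[OF refl]) (use insert.hyps xA in \<open>auto simp: fiber_card_insert\<close>)
    then show ?thesis using insert.hyps xA by (simp add: fiber_card_insert q_factorial_Suc algebra_simps)
  qed
  also have "\<dots> = (\<Prod>v\<in>V. q_factorial p (fiber_card (insert x A) f v))"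
    using insert.prems by (intro prod.remove[symmetric]) auto
  finally show ?case .
qed

section \<open>Words with prescribed multiplicities\<close>

definition words :: "'i set \<Rightarrow> ('v \<Rightarrow> nat) \<Rightarrow> ('i \<Rightarrow> 'v) set" where
  "words A m = {a \<in> extensional A. \<forall>v. fiber_card A a v = m v}"

definition word_invs :: "'i::linorder set \<Rightarrow> ('i \<Rightarrow> 'v::linorder) \<Rightarrow> nat" where
  "word_invs A a = card {(i, j). i \<in> A \<and> j \<in> A \<and> i < j \<and> a j < a i}"

lemma words_range:
  assumes "finite A" "a \<in> words A m" "i \<in> A"
  shows "m (a i) > 0"
proof -
  have "i \<in> {j \<in> A. a j = a i}" "finite {j \<in> A. a j = a i}" using assms by auto
  then have "card {j \<in> A. a j = a i} > 0" by (metis card_gt_0_iff empty_iff)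
  then show ?thesis using assms by (auto simp: words_def fiber_card_def)
qed

lemma finite_words:
  assumes "finite A" "finite V" "\<And>v. v \<notin> V \<Longrightarrow> m v = 0"
  shows "finite (words A m)"
proof (rule finite_subset)
  show "words A m \<subseteq> A \<rightarrow>\<^sub>E V"
  proof
    fix a assume a: "a \<in> words A m"
    then have "a i \<in> V" if "i \<in> A" for i
      using words_range[OF assms(1) a that] assms(3)[of "a i"] by auto
    then show "a \<in> A \<rightarrow>\<^sub>E V" using a by (auto simp: words_def PiE_def)
  qed
qed (use assms in \<open>simp add: finite_PiE\<close>)

text \<open>MacMahon's theorem that inversions of words are counted by the
  \<open>q\<close>-multinomial coefficient, with the denominator multiplied out. The last letter
  \<open>v\<close> is inverted with every larger letter, whence the weight \<open>p ^ up v\<close>,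
  and dropping it removes the factor \<open>q_sum p (m v)\<close> from the product of
  factorials.\<close>

theorem sum_words:
  fixes A :: "'i::linorder set" and V :: "'v::linorder set"
  assumes "finite A" "finite V" "\<And>v. v \<notin> V \<Longrightarrow> m v = 0" "sum m V = card A"
  shows "(\<Sum>a\<in>words A m. p ^ word_invs A a) * (\<Prod>v\<in>V. q_factorial p (m v)) = q_factorial p (card A)"
  using assms
proof (induction A arbitrary: m rule: finite_linorder_max_induct)
  case empty
  then have m: "m v = 0" for v by (cases "v \<in> V") auto
  then have w: "words {} m = {\<lambda>x. undefined}" by (auto simp: words_def fiber_card_def)
  show ?case unfolding w using m by (simp add: word_invs_def)
next
  case (insert x A)
  have xA: "x \<notin> A" using insert by auto
  \<comment> \<open>Only letters of positive multiplicity can end a word, and on them the truncated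
    subtraction in \<open>dm\<close> is exact. The other letters are added back at the end, where
    they carry the factor \<open>q_sum p 0 = 0\<close>.\<close>
  define V' where "V' = {v \<in> V. m v > 0}"
  define dm where "dm v = m(v := m v - 1)" for v
  define up where "up v = (\<Sum>u\<in>{u \<in> V. u > v}. m u)" for v
  have "(\<Sum>a\<in>words (insert x A) m. p ^ word_invs (insert x A) a)
      = (\<Sum>(v, b)\<in>Sigma V' (\<lambda>v. words A (dm v)). p ^ word_invs A b * p ^ up v)"
  proof (rule sum.reindex_bij_witness[where i = "\<lambda>(v, b). b(x := v)" and j = "\<lambda>a. (a x, restrict a A)"])
    fix a assume a: "a \<in> words (insert x A) m"
    then have e: "a \<in> extensional (insert x A)" and c: "\<And>v. fiber_card (insert x A) a v = m v"
      by (auto simp: words_def)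
    show "(case (a x, restrict a A) of (v, b) \<Rightarrow> b(x := v)) = a"
      using e by (auto simp: fun_eq_iff extensional_def restrict_def)
    have m0: "m (a x) > 0" using words_range[OF _ a, of x] insert.hyps by simp
    then have "a x \<in> V'" using insert.prems(2) by (force simp: V'_def)
    moreover have "fiber_card A (restrict a A) v = dm (a x) v" for v
      using c[of v] insert.hyps xA fiber_card_cong[of A "restrict a A" a v]
      by (auto simp: fiber_card_insert dm_def split: if_splits)
    ultimately show "(a x, restrict a A) \<in> Sigma V' (\<lambda>v. words A (dm v))"
      by (auto simp: words_def)
    have "{(i, j). i \<in> insert x A \<and> j \<in> insert x A \<and> i < j \<and> a j < a i}
      = {(i, j). i \<in> A \<and> j \<in> A \<and> i < j \<and> restrict a A j < restrict a A i} \<union>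
        (\<lambda>i. (i, x)) ` {i \<in> A. a i > a x}" (is "?L = ?P \<union> ?R")
      using insert.hyps(2) by auto
    moreover have "finite ?P" by (rule finite_subset[of _ "A \<times> A"]) (use insert in auto)
    moreover have "finite ?R" using insert by simp
    moreover have "?P \<inter> ?R = {}" using xA by auto
    ultimately have "card ?L = card ?P + card ?R" by (simp add: card_Un_disjoint)
    also have "card ?R = card {i \<in> A. a i > a x}" by (rule card_image) (auto simp: inj_on_def)
    also have "{i \<in> A. a i > a x} = (\<Union>u\<in>{u \<in> V. u > a x}. {i \<in> insert x A. a i = u})"
      using words_range[OF _ a] insert.hyps insert.prems(2) by fastforce
    also have "card \<dots> = (\<Sum>u\<in>{u \<in> V. u > a x}. card {i \<in> insert x A. a i = u})"
      by (rule card_UN_disjoint) (use insert in auto)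
    also have "\<dots> = up (a x)" using c by (simp add: up_def fiber_card_def)
    finally show "(case (a x, restrict a A) of (v, b) \<Rightarrow> p ^ word_invs A b * p ^ up v) = p ^ word_invs (insert x A) a"
      by (simp add: word_invs_def power_add)
  next
    fix c assume "c \<in> Sigma V' (\<lambda>v. words A (dm v))"
    then obtain v b where c: "c = (v, b)" "v \<in> V'" "b \<in> extensional A" "\<And>u. fiber_card A b u = dm v u"
      by (auto simp: words_def)
    have r: "restrict (b(x := v)) A = b" using c xA by (auto simp: fun_eq_iff extensional_def)
    have "fiber_card A (b(x := v)) u = fiber_card A b u" for u
      by (rule fiber_card_cong) (use xA in auto)
    then have "fiber_card (insert x A) (b(x := v)) u = m u" for u
      using c insert.hyps xA by (auto simp: fiber_card_insert dm_def V'_def)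
    then show "(case c of (v, b) \<Rightarrow> b(x := v)) \<in> words (insert x A) m"
      using c by (auto simp: words_def extensional_def)
    show "(\<lambda>a. (a x, restrict a A)) (case c of (v, b) \<Rightarrow> b(x := v)) = c"
      using r by (simp add: c)
  qed
  also have "\<dots> = (\<Sum>v\<in>V'. \<Sum>b\<in>words A (dm v). p ^ word_invs A b * p ^ up v)"
  proof (rule sum.Sigma[symmetric])
    show "\<forall>v\<in>V'. finite (words A (dm v))"
    proof
      fix v assume "v \<in> V'"
      then show "finite (words A (dm v))"
        using insert.prems(2) by (intro finite_words[OF insert.hyps(1) insert.prems(1)]) (auto simp: dm_def V'_def)
    qed
  qed (use insert in \<open>auto simp: V'_def\<close>)
  finally have "(\<Sum>a\<in>words (insert x A) m. p ^ word_invs (insert x A) a) * (\<Prod>v\<in>V. q_factorial p (m v))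
     = (\<Sum>v\<in>V'. (\<Sum>b\<in>words A (dm v). p ^ word_invs A b) * p ^ up v * (\<Prod>v\<in>V. q_factorial p (m v)))"
    by (simp add: sum_distrib_right)
  also have "\<dots> = (\<Sum>v\<in>V'. p ^ up v * q_sum p (m v) * q_factorial p (card A))"
  proof (rule sum.cong[OF refl])
    fix v assume v: "v \<in> V'"
    then have vV: "v \<in> V" "m v > 0" by (auto simp: V'_def)
    have "(\<Prod>u\<in>V. q_factorial p (m u)) = q_factorial p (m v) * (\<Prod>u\<in>V-{v}. q_factorial p (dm v u))"
      using prod.remove[OF insert.prems(1) vV(1), of "\<lambda>u. q_factorial p (m u)"] by (simp add: dm_def)
    also have "\<dots> = q_sum p (m v) * (q_factorial p (dm v v) * (\<Prod>u\<in>V-{v}. q_factorial p (dm v u)))"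
      using vV by (simp add: dm_def q_factorial_pred[of "m v"] algebra_simps)
    also have "q_factorial p (dm v v) * (\<Prod>u\<in>V-{v}. q_factorial p (dm v u)) = (\<Prod>u\<in>V. q_factorial p (dm v u))"
      using prod.remove[OF insert.prems(1) vV(1), of "\<lambda>u. q_factorial p (dm v u)"] by simp
    finally have 1: "(\<Prod>u\<in>V. q_factorial p (m u)) = q_sum p (m v) * (\<Prod>u\<in>V. q_factorial p (dm v u))" .
    have "sum m V = m v + sum (dm v) (V - {v})"
      using sum.remove[OF insert.prems(1) vV(1), of m] by (simp add: dm_def)
    moreover have "sum (dm v) V = dm v v + sum (dm v) (V - {v})"
      using sum.remove[OF insert.prems(1) vV(1), of "dm v"] by simp
    ultimately have "sum (dm v) V = card A"
      using vV insert.prems(3) insert.hyps xA by (simp add: dm_def)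
    then have 2: "(\<Sum>b\<in>words A (dm v). p ^ word_invs A b) * (\<Prod>u\<in>V. q_factorial p (dm v u)) = q_factorial p (card A)"
      using insert.prems vV by (intro insert.IH) (auto simp: dm_def)
    show "(\<Sum>b\<in>words A (dm v). p ^ word_invs A b) * p ^ up v * (\<Prod>v\<in>V. q_factorial p (m v))
      = p ^ up v * q_sum p (m v) * q_factorial p (card A)"
      unfolding 1 2[symmetric] by (simp only: mult_ac)
  qed
  also have "\<dots> = (\<Sum>v\<in>V. p ^ up v * q_sum p (m v) * q_factorial p (card A))"
    by (rule sum.mono_neutral_left) (use insert in \<open>auto simp: V'_def\<close>)
  also have "\<dots> = q_sum p (card (insert x A)) * q_factorial p (card A)"
    unfolding sum_distrib_right[symmetric] up_def using insert.prems by (simp add: sum_power_mass_above)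
  also have "\<dots> = q_factorial p (card (insert x A))"
    using insert.hyps xA by (simp add: q_factorial_Suc mult.commute)
  finally show ?case .
qed

section \<open>Involutions that negate levels\<close>

definition invol_maps :: "int set \<Rightarrow> (int \<Rightarrow> int) \<Rightarrow> (int \<Rightarrow> int) set" where
  "invol_maps A a = {\<sigma> \<in> extensional A. \<forall>i\<in>A. \<sigma> i \<in> A \<and> \<sigma> (\<sigma> i) = i \<and> a (\<sigma> i) = - a i}"

text \<open>As \<open>\<sigma>\<close> negates \<open>a\<close>, a 2-cycle either joins two opposite
  nonzero levels, and is counted at its positive end, or lies in level 0, and is counted at its
  smaller element.\<close>

definition two_cycles :: "int set \<Rightarrow> (int \<Rightarrow> int) \<Rightarrow> (int \<Rightarrow> int) \<Rightarrow> nat" where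
  "two_cycles A a \<sigma> = card {i \<in> A. a i > 0 \<or> a i = 0 \<and> \<sigma> i > i}"

lemma invol_maps_bij: "\<sigma> \<in> invol_maps A a \<Longrightarrow> bij_betw \<sigma> A A"
  by (rule bij_betw_byWitness[where f' = \<sigma>]) (auto simp: invol_maps_def)

lemma finite_invol_maps: "finite A \<Longrightarrow> finite (invol_maps A a)"
proof (rule finite_subset)
  show "invol_maps A a \<subseteq> A \<rightarrow>\<^sub>E A" by (auto simp: invol_maps_def PiE_def)
qed (simp add: finite_PiE)

lemma invol_maps_restrict:
  assumes "\<sigma> \<in> invol_maps A a" "x \<in> A"
  shows "restrict \<sigma> (A - {x, \<sigma> x}) \<in> invol_maps (A - {x, \<sigma> x}) a"
  using assms by (auto simp: invol_maps_def; metis)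

lemma level_invs_eq_card:
  assumes "{(i, j). i \<in> A \<and> j \<in> A \<and> i < j \<and> f i = f j \<and> \<sigma> j < \<sigma> i}
      = {(i, j). i \<in> A' \<and> j \<in> A' \<and> i < j \<and> f i = f j \<and> \<sigma> j < \<sigma> i} \<union> R"
    and "finite R" "finite A'" "R \<inter> A' \<times> A' = {}"
  shows "level_invs A f (\<sigma> :: int \<Rightarrow> int) = level_invs A' f (restrict \<sigma> A') + card R"
proof -
  have "{(i, j). i \<in> A' \<and> j \<in> A' \<and> i < j \<and> f i = f j \<and> restrict \<sigma> A' j < restrict \<sigma> A' i}
      = {(i, j). i \<in> A' \<and> j \<in> A' \<and> i < j \<and> f i = f j \<and> \<sigma> j < \<sigma> i}" (is "?L = ?R") by auto
  moreover have "finite ?R" by (rule finite_subset[of _ "A' \<times> A'"]) (use assms in auto)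
  moreover have "?R \<inter> R = {}" using assms(4) by auto
  ultimately show ?thesis unfolding level_invs_def assms(1) using assms(2) by (simp add: card_Un_disjoint)
qed

lemma invol_maps_max_fixed:
  assumes \<sigma>: "\<sigma> \<in> invol_maps A a" and A: "finite A" "x \<in> A" "\<forall>i\<in>A. i \<le> x" and fix_x: "\<sigma> x = x" "a x = 0"
  shows "level_invs A a \<sigma> = level_invs (A - {x}) a (restrict \<sigma> (A - {x}))"
    and "two_cycles A a \<sigma> = two_cycles (A - {x}) a (restrict \<sigma> (A - {x}))"
proof -
  have "level_invs A a \<sigma> = level_invs (A - {x}) a (restrict \<sigma> (A - {x})) + card ({} :: (int \<times> int) set)"
  proof (rule level_invs_eq_card)
    have "False" if "i \<in> A" "\<sigma> x < \<sigma> i" for i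
      using that A(3) \<sigma> fix_x by (force simp: invol_maps_def)
    then show "{(i, j). i \<in> A \<and> j \<in> A \<and> i < j \<and> a i = a j \<and> \<sigma> j < \<sigma> i}
      = {(i, j). i \<in> A - {x} \<and> j \<in> A - {x} \<and> i < j \<and> a i = a j \<and> \<sigma> j < \<sigma> i} \<union> {}"
      using A(3) by fastforce
  qed (use A in auto)
  then show "level_invs A a \<sigma> = level_invs (A - {x}) a (restrict \<sigma> (A - {x}))" by simp
  show "two_cycles A a \<sigma> = two_cycles (A - {x}) a (restrict \<sigma> (A - {x}))"
    unfolding two_cycles_def using fix_x by (intro arg_cong[of _ _ card]) auto
qed

text \<open>Removing the 2-cycle of the maximum \<open>x\<close> with \<open>y\<close> destroys,
  inside the levels, the pairs \<open>(i, x)\<close> with \<open>\<sigma> i > y\<close> and the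
  pairs \<open>(y, j)\<close> with \<open>j > y\<close>. Applying \<open>\<sigma>\<close> to the
  first kind turns it into the second, whence the factor 2; in level 0 the pair
  \<open>(y, x)\<close> is left over and gives the extra 1.\<close>

lemma invol_maps_max_moved:
  assumes \<sigma>: "\<sigma> \<in> invol_maps A a" and A: "finite A" "x \<in> A" "\<forall>i\<in>A. i \<le> x" and y: "\<sigma> x = y" "y \<noteq> x"
  shows "level_invs A a \<sigma> = level_invs (A - {x, y}) a (restrict \<sigma> (A - {x, y}))
      + (2 * card {z \<in> A - {x}. a z = - a x \<and> z > y} + (if a x = 0 then 1 else 0))"
    and "two_cycles A a \<sigma> = Suc (two_cycles (A - {x, y}) a (restrict \<sigma> (A - {x, y})))"
proof -
  have yA: "y \<in> A" "\<sigma> y = x" "a y = - a x" using \<sigma> A y by (auto simp: invol_maps_def)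
  have yx: "y < x" using A yA y by fastforce
  define R1 where "R1 = (\<lambda>i. (i, x)) ` {i \<in> A. a i = a x \<and> \<sigma> i > y}"
  define R2 where "R2 = (\<lambda>j. (y, j)) ` {j \<in> A - {x}. a j = - a x \<and> j > y}"
  have lex: "\<sigma> i < x" if "i \<in> A" "i \<noteq> y" for i
  proof -
    have "\<sigma> i \<in> A" "\<sigma> (\<sigma> i) = i" using \<sigma> that by (auto simp: invol_maps_def)
    then show ?thesis using A(3) that yA y by (metis order_le_imp_less_or_eq)
  qed
  have ltx: "i < x" if "i \<in> A" "i \<noteq> x" for i using that A(3) by force
  have 1: "level_invs A a \<sigma> = level_invs (A - {x, y}) a (restrict \<sigma> (A - {x, y})) + card (R1 \<union> R2)"
  proof (rule level_invs_eq_card)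
    show "{(i, j). i \<in> A \<and> j \<in> A \<and> i < j \<and> a i = a j \<and> \<sigma> j < \<sigma> i}
      = {(i, j). i \<in> A - {x, y} \<and> j \<in> A - {x, y} \<and> i < j \<and> a i = a j \<and> \<sigma> j < \<sigma> i} \<union> (R1 \<union> R2)"
      (is "?L = ?P \<union> _")
    proof
      show "?L \<subseteq> ?P \<union> (R1 \<union> R2)"
      proof (rule subsetI, rule UnCI)
        fix c assume c: "c \<in> ?L" "c \<notin> R1 \<union> R2"
        obtain i j where ij: "c = (i, j)" "i \<in> A" "j \<in> A" "i < j" "a i = a j" "\<sigma> j < \<sigma> i" "(i, j) \<notin> R1 \<union> R2"
          using c by auto
        then have "i \<noteq> x" using A(3) by force
        moreover have "j \<noteq> x" using ij y by (auto simp: R1_def)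
        moreover have "j \<noteq> y" using ij lex[of i] yA by force
        moreover have "i \<noteq> y" using ij \<open>j \<noteq> x\<close> yA by (auto simp: R2_def)
        ultimately show "c \<in> ?P" using ij by auto
      qed
      show "?P \<union> (R1 \<union> R2) \<subseteq> ?L"
      proof -
        have "R1 \<subseteq> ?L" unfolding R1_def using y yA A ltx by auto
        moreover have "R2 \<subseteq> ?L" unfolding R2_def using y yA A lex by auto
        ultimately show ?thesis by auto
      qed
    qed
    show "finite (R1 \<union> R2)" using A by (auto simp: R1_def R2_def)
    show "(R1 \<union> R2) \<inter> (A - {x, y}) \<times> (A - {x, y}) = {}" by (auto simp: R1_def R2_def)
  qed (use A in auto)
  have "R1 \<inter> R2 = {}" by (auto simp: R1_def R2_def)
  then have "card (R1 \<union> R2) = card R1 + card R2"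
    using A by (intro card_Un_disjoint) (auto simp: R1_def R2_def)
  also have "card R2 = card {z \<in> A - {x}. a z = - a x \<and> z > y}"
    unfolding R2_def by (rule card_image) (auto simp: inj_on_def)
  also have "card R1 = card {i \<in> A. a i = a x \<and> \<sigma> i > y}"
    unfolding R1_def by (rule card_image) (auto simp: inj_on_def)
  also have "\<dots> = card {i \<in> A. - a i = a x \<and> i > y}"
  proof (rule bij_betw_same_card[of \<sigma>], rule bij_betw_fiber)
    show "bij_betw \<sigma> A A" by (rule invol_maps_bij[OF \<sigma>])
    show "\<forall>i\<in>A. - a (\<sigma> i) = a i" using \<sigma> by (auto simp: invol_maps_def)
  qed
  \<comment> \<open>Under \<open>\<sigma>\<close> the pair \<open>(y, x)\<close> shows up as the
    element \<open>x = \<sigma> y\<close>, which meets the level condition only in level 0.\<close>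
  also have "{i \<in> A. - a i = a x \<and> i > y} =
      (if a x = 0 then insert x {z \<in> A - {x}. a z = - a x \<and> z > y} else {z \<in> A - {x}. a z = - a x \<and> z > y})"
    using yx A by auto
  also have "card \<dots> = card {z \<in> A - {x}. a z = - a x \<and> z > y} + (if a x = 0 then 1 else 0)"
    using A by simp
  finally show "level_invs A a \<sigma> = level_invs (A - {x, y}) a (restrict \<sigma> (A - {x, y}))
      + (2 * card {z \<in> A - {x}. a z = - a x \<and> z > y} + (if a x = 0 then 1 else 0))"
    using 1 by simp
  \<comment> \<open>The end at which \<open>two_cycles\<close> counts the removed cycle: the
    positive one, or in level 0 the smaller one, which is \<open>y\<close>.\<close>
  define c where "c = (if a x > 0 then x else y)"
  define X where "X = {i \<in> A - {x, y}. a i > 0 \<or> a i = 0 \<and> restrict \<sigma> (A - {x, y}) i > i}"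
  have "{i \<in> A. a i > 0 \<or> a i = 0 \<and> \<sigma> i > i} = insert c X"
    using y yA yx A by (auto simp: c_def X_def)
  moreover have "c \<notin> X" "finite X" using A by (auto simp: c_def X_def)
  ultimately show "two_cycles A a \<sigma> = Suc (two_cycles (A - {x, y}) a (restrict \<sigma> (A - {x, y})))"
    by (simp add: two_cycles_def X_def)
qed

text \<open>The partner \<open>y\<close> of \<open>x\<close> is singled out. A fixed point is the
  case \<open>y = x\<close>, where \<open>{x, y}\<close> and the double update collapse; the level
  condition admits it only if \<open>a x = 0\<close>.\<close>

lemma sum_invol_maps_split:
  assumes A: "finite A" "x \<in> A"
  shows "sum F (invol_maps A a) = (\<Sum>y\<in>{y \<in> A. a y = - a x}. \<Sum>\<tau>\<in>invol_maps (A - {x, y}) a. F (\<tau>(x := y, y := x)))"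
proof -
  let ?Y = "{y \<in> A. a y = - a x}"
  have "sum F (invol_maps A a) = (\<Sum>(y, \<tau>)\<in>Sigma ?Y (\<lambda>y. invol_maps (A - {x, y}) a). F (\<tau>(x := y, y := x)))"
  proof (rule sum.reindex_bij_witness[where i = "\<lambda>(y, \<tau>). \<tau>(x := y, y := x)"
        and j = "\<lambda>\<sigma>. (\<sigma> x, restrict \<sigma> (A - {x, \<sigma> x}))"])
    fix \<sigma> assume \<sigma>: "\<sigma> \<in> invol_maps A a"
    then have sx: "\<sigma> x \<in> A" "\<sigma> (\<sigma> x) = x" "a (\<sigma> x) = - a x" using A by (auto simp: invol_maps_def)
    show 1: "(case (\<sigma> x, restrict \<sigma> (A - {x, \<sigma> x})) of (y, \<tau>) \<Rightarrow> \<tau>(x := y, y := x)) = \<sigma>"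
      using \<sigma> sx by (auto simp: invol_maps_def fun_eq_iff extensional_def)
    then show "(case (\<sigma> x, restrict \<sigma> (A - {x, \<sigma> x})) of (y, \<tau>) \<Rightarrow> F (\<tau>(x := y, y := x))) = F \<sigma>" by simp
    show "(\<sigma> x, restrict \<sigma> (A - {x, \<sigma> x})) \<in> Sigma ?Y (\<lambda>y. invol_maps (A - {x, y}) a)"
      using invol_maps_restrict[OF \<sigma> A(2)] sx by auto
  next
    fix c assume "c \<in> Sigma ?Y (\<lambda>y. invol_maps (A - {x, y}) a)"
    then obtain y \<tau> where c: "c = (y, \<tau>)" "y \<in> A" "a y = - a x" "\<tau> \<in> invol_maps (A - {x, y}) a" by auto
    have t: "\<tau> i \<in> A" "\<tau> i \<noteq> x" "\<tau> i \<noteq> y" "\<tau> (\<tau> i) = i" "a (\<tau> i) = - a i" if "i \<in> A" "i \<noteq> x" "i \<noteq> y" for i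
      using c(4) that by (auto simp: invol_maps_def)
    have e: "\<tau> i = undefined" if "i \<notin> A - {x, y}" for i using c(4) that by (auto simp: invol_maps_def extensional_def)
    show "(case c of (y, \<tau>) \<Rightarrow> \<tau>(x := y, y := x)) \<in> invol_maps A a"
      using t e c A by (auto simp: invol_maps_def extensional_def)
    show "(\<lambda>\<sigma>. (\<sigma> x, restrict \<sigma> (A - {x, \<sigma> x}))) (case c of (y, \<tau>) \<Rightarrow> \<tau>(x := y, y := x)) = c"
      using t e c A by (auto simp: fun_eq_iff restrict_def)
  qed
  also have "\<dots> = (\<Sum>y\<in>?Y. \<Sum>\<tau>\<in>invol_maps (A - {x, y}) a. F (\<tau>(x := y, y := x)))"
    by (rule sum.Sigma[symmetric]) (use A in \<open>auto intro: finite_invol_maps\<close>)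
  finally show ?thesis .
qed

lemma invol_maps_extend:
  assumes "\<tau> \<in> invol_maps (A - {x, y}) a" "x \<in> A" "y \<in> A" "a y = - a x"
  shows "\<tau>(x := y, y := x) \<in> invol_maps A a"
    and "restrict (\<tau>(x := y, y := x)) (A - {x, y}) = \<tau>"
proof -
  have t: "\<tau> i \<in> A" "\<tau> i \<noteq> x" "\<tau> i \<noteq> y" "\<tau> (\<tau> i) = i" "a (\<tau> i) = - a i" if "i \<in> A" "i \<noteq> x" "i \<noteq> y" for i
    using assms(1) that by (auto simp: invol_maps_def)
  have e: "\<tau> i = undefined" if "i \<notin> A - {x, y}" for i using assms(1) that by (auto simp: invol_maps_def extensional_def)
  show "\<tau>(x := y, y := x) \<in> invol_maps A a"
    using t e assms by (auto simp: invol_maps_def extensional_def)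
  show "restrict (\<tau>(x := y, y := x)) (A - {x, y}) = \<tau>"
    using t e by (auto simp: fun_eq_iff restrict_def)
qed

lemma fiber_card_remove:
  assumes "finite A" "x \<in> A"
  shows "fiber_card (A - {x}) f v = fiber_card A f v - (if f x = v then 1 else 0)"
  using fiber_card_insert[of "A - {x}" x f v] assms by (simp add: insert_absorb)

text \<open>Between the levels \<open>v\<close> and \<open>- v\<close> an involution is an arbitrary
  bijection, whose inversions are seen once in each of the two levels, so it contributes a factorial
  in \<open>q\<^sup>2\<close>. In level 0 the largest element is fixed or joined to some
  \<open>y\<close>, and this is the recursion imposed on \<open>L\<close>; the closed form of
  \<open>L\<close> is supplied later.\<close>

theorem sum_invol_maps:
  fixes q t :: "'r::comm_ring_1"
  assumes "finite A" "finite V" "\<forall>v\<in>V. v > 0" "\<forall>i\<in>A. a i > 0 \<longrightarrow> a i \<in> V"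
    and "\<And>v. fiber_card A a (- v) = fiber_card A a v"
    and L: "L 0 = 1" "L 1 = 1" "\<And>r. L (Suc (Suc r)) = L (Suc r) + t * q * q_sum (q\<^sup>2) (Suc r) * L r"
  shows "(\<Sum>\<sigma>\<in>invol_maps A a. q ^ level_invs A a \<sigma> * t ^ two_cycles A a \<sigma>)
    = (\<Prod>v\<in>V. t ^ fiber_card A a v * q_factorial (q\<^sup>2) (fiber_card A a v)) * L (fiber_card A a 0)"
  using assms(1,4,5)
proof (induction "card A" arbitrary: A rule: less_induct)
  case less
  define I where "I A = (\<Sum>\<sigma>\<in>invol_maps A a. q ^ level_invs A a \<sigma> * t ^ two_cycles A a \<sigma>)" for A
  define P where "P A = (\<Prod>v\<in>V. t ^ fiber_card A a v * q_factorial (q\<^sup>2) (fiber_card A a v))" for A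
  show ?case
  proof (cases "A = {}")
    case True
    have "invol_maps {} a = {\<lambda>x. undefined}" by (auto simp: invol_maps_def)
    then show ?thesis using True L by (simp add: level_invs_def two_cycles_def fiber_card_def)
  next
    case False
    define x where "x = Max A"
    have x: "x \<in> A" "\<forall>i\<in>A. i \<le> x" using False less.prems by (auto simp: x_def)
    let ?Y = "{y \<in> A. a y = - a x}"
    have IH: "I (A - {x, y}) = P (A - {x, y}) * L (fiber_card (A - {x, y}) a 0)" if y: "y \<in> ?Y" "y = x \<longrightarrow> a x = 0" for y
      unfolding I_def P_def
    proof (rule less.hyps)
      show "card (A - {x, y}) < card A" using x less.prems by (intro psubset_card_mono) auto
      show "fiber_card (A - {x, y}) a (- v) = fiber_card (A - {x, y}) a v" for v
      proof (cases "y = x")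
        case True
        then show ?thesis using y less.prems(3)[of v] x less.prems(1)
          by (auto simp: fiber_card_remove)
      next
        case False
        have "A - {x, y} = (A - {x}) - {y}" by auto
        then show ?thesis using y less.prems(3)[of v] x less.prems(1) False
          by (auto simp: fiber_card_remove)
      qed
    qed (use less.prems in auto)
    define g where "g y = card {z \<in> ?Y - {x}. z > y}" for y
    have moved: "(\<Sum>\<tau>\<in>invol_maps (A - {x, y}) a. q ^ level_invs A a (\<tau>(x := y, y := x)) * t ^ two_cycles A a (\<tau>(x := y, y := x)))
       = t * (q\<^sup>2) ^ g y * (if a x = 0 then q else 1) * (P (A - {x, y}) * L (fiber_card (A - {x, y}) a 0))"
      if y: "y \<in> ?Y - {x}" for y
    proof -
      have gy: "{z \<in> A - {x}. a z = - a x \<and> z > y} = {z \<in> ?Y - {x}. z > y}" by auto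
      have "(\<Sum>\<tau>\<in>invol_maps (A - {x, y}) a. q ^ level_invs A a (\<tau>(x := y, y := x)) * t ^ two_cycles A a (\<tau>(x := y, y := x)))
       = (\<Sum>\<tau>\<in>invol_maps (A - {x, y}) a. t * (q\<^sup>2) ^ g y * (if a x = 0 then q else 1) *
            (q ^ level_invs (A - {x, y}) a \<tau> * t ^ two_cycles (A - {x, y}) a \<tau>))"
      proof (rule sum.cong[OF refl])
        fix \<tau> assume \<tau>: "\<tau> \<in> invol_maps (A - {x, y}) a"
        note e = invol_maps_extend[OF \<tau> x(1)]
        have yy: "y \<in> A" "a y = - a x" "y \<noteq> x" using y by auto
        note m = invol_maps_max_moved[OF e(1)[OF yy(1,2)] less.prems(1) x]
        have *: "(\<tau>(x := y, y := x)) x = y" using yy by auto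
        have pw: "(q\<^sup>2) ^ g y = q ^ (2 * g y)" by (rule power_mult[symmetric])
        show "q ^ level_invs A a (\<tau>(x := y, y := x)) * t ^ two_cycles A a (\<tau>(x := y, y := x))
          = t * (q\<^sup>2) ^ g y * (if a x = 0 then q else 1) * (q ^ level_invs (A - {x, y}) a \<tau> * t ^ two_cycles (A - {x, y}) a \<tau>)"
          unfolding m(1)[OF * yy(3)] m(2)[OF * yy(3)] e(2)[OF yy(1,2)] gy g_def[symmetric]
          by (simp add: power_add pw mult_ac)
      qed
      also have "\<dots> = t * (q\<^sup>2) ^ g y * (if a x = 0 then q else 1) * I (A - {x, y})"
        by (simp add: I_def sum_distrib_left)
      finally show ?thesis using IH[of y] y by simp
    qed
    have S: "I A = (\<Sum>y\<in>?Y. \<Sum>\<tau>\<in>invol_maps (A - {x, y}) a. q ^ level_invs A a (\<tau>(x := y, y := x)) * t ^ two_cycles A a (\<tau>(x := y, y := x)))"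
      unfolding I_def by (rule sum_invol_maps_split[OF less.prems(1) x(1)])
    have gsum: "(\<Sum>y\<in>?Y - {x}. (q\<^sup>2) ^ g y) = q_sum (q\<^sup>2) (card (?Y - {x}))"
      unfolding g_def by (rule sum_power_card_above) (use less.prems in auto)
    have "I A = P A * L (fiber_card A a 0)"
    proof (cases "a x = 0")
      case True
      have PA: "P (A - {x}) = P A" unfolding P_def
        using True less.prems x assms(3) by (intro prod.cong) (auto simp: fiber_card_remove)
      have PA2: "P (A - {x, y}) = P A" if "y \<in> ?Y - {x}" for y
      proof -
        have "A - {x, y} = (A - {x}) - {y}" by auto
        then show ?thesis unfolding P_def
          using True less.prems x assms(3) that by (intro prod.cong) (auto simp: fiber_card_remove)
      qed
      define r where "r = fiber_card A a 0"
      have cY: "card (?Y - {x}) = r - 1" "r > 0"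
      proof -
        have "?Y = {y \<in> A. a y = 0}" "x \<in> ?Y" "finite ?Y" using True x less.prems by auto
        then show "card (?Y - {x}) = r - 1" "r > 0"
          by (auto simp: r_def fiber_card_def card_gt_0_iff)
      qed
      have r1: "fiber_card (A - {x}) a 0 = r - 1"
        using True less.prems x by (simp add: fiber_card_remove r_def)
      have r2: "fiber_card (A - {x, y}) a 0 = r - 2" if "y \<in> ?Y - {x}" for y
      proof -
        have "A - {x, y} = (A - {x}) - {y}" by auto
        then show ?thesis
          using True less.prems x that by (simp add: fiber_card_remove r_def)
      qed
      have fixed: "(\<Sum>\<tau>\<in>invol_maps (A - {x, x}) a. q ^ level_invs A a (\<tau>(x := x, x := x)) * t ^ two_cycles A a (\<tau>(x := x, x := x))) = I (A - {x, x})"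
        unfolding I_def
      proof (rule sum.cong[OF refl])
        fix \<tau> assume \<tau>: "\<tau> \<in> invol_maps (A - {x, x}) a"
        note e = invol_maps_extend[OF \<tau> x(1) x(1)]
        have 0: "a x = - a x" using True by simp
        note m = invol_maps_max_fixed[OF e(1)[OF 0] less.prems(1) x]
        show "q ^ level_invs A a (\<tau>(x := x, x := x)) * t ^ two_cycles A a (\<tau>(x := x, x := x))
          = q ^ level_invs (A - {x, x}) a \<tau> * t ^ two_cycles (A - {x, x}) a \<tau>"
          using m e(2)[OF 0] True by simp
      qed
      \<comment> \<open>Either \<open>x\<close> is fixed, at no cost, or it is joined to
        \<open>y\<close> at the cost \<open>t * q * (q\<^sup>2) ^ g y\<close>.\<close>
      have "I A = I (A - {x, x}) + (\<Sum>y\<in>?Y-{x}. t * (q\<^sup>2) ^ g y * q * (P A * L (r - 2)))"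
      proof -
        have Y: "finite ?Y" "x \<in> ?Y" using True x less.prems by auto
        have "(\<Sum>y\<in>?Y-{x}. \<Sum>\<tau>\<in>invol_maps (A - {x, y}) a. q ^ level_invs A a (\<tau>(x := y, y := x)) * t ^ two_cycles A a (\<tau>(x := y, y := x)))
           = (\<Sum>y\<in>?Y-{x}. t * (q\<^sup>2) ^ g y * q * (P A * L (r - 2)))"
          by (rule sum.cong[OF refl]) (simp only: moved PA2 r2 True if_True simp_thms)
        then show ?thesis unfolding S fixed[symmetric] sum.remove[OF Y] by simp
      qed
      also have "I (A - {x, x}) = P A * L (r - 1)"
        using IH[of x] True x PA r1 by simp
      also have "(\<Sum>y\<in>?Y-{x}. t * (q\<^sup>2) ^ g y * q * (P A * L (r - 2))) = t * q * q_sum (q\<^sup>2) (r - 1) * (P A * L (r - 2))"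
        unfolding cY(1)[symmetric] gsum[symmetric] by (simp add: sum_distrib_left sum_distrib_right algebra_simps)
      also have "P A * L (r - 1) + t * q * q_sum (q\<^sup>2) (r - 1) * (P A * L (r - 2)) = P A * L r"
      proof (cases "r = 1")
        \<comment> \<open>Here \<open>r - 2\<close> is truncated, but its coefficient is
          \<open>q_sum (q\<^sup>2) 0 = 0\<close>.\<close>
        case True
        then show ?thesis using L by simp
      next
        case False
        then obtain k where "r = Suc (Suc k)" using cY(2) by (cases r; cases "r - 1"; auto)
        then show ?thesis using L(3)[of k] by (simp add: algebra_simps)
      qed
      finally show ?thesis by (simp add: r_def)
    next
      case False
      \<comment> \<open>Removing \<open>x\<close> and its partner lowers the multiplicities of
        \<open>v\<close> and of \<open>- v\<close> by one each; the product \<open>P\<close> runs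
        over positive levels and sees this once.\<close>
      define v where "v = \<bar>a x\<bar>"
      have v0: "v > 0" using False by (simp add: v_def)
      have xY: "?Y - {x} = ?Y" using False by auto
      have cY: "card ?Y = fiber_card A a v"
        using less.prems(3)[of "a x"] by (auto simp: v_def abs_if fiber_card_def)
      have f: "fiber_card (A - {x, y}) a u = fiber_card A a u - (if u = v then 1 else 0)" if "y \<in> ?Y" "u \<ge> 0" for y u
      proof -
        have "A - {x, y} = (A - {x}) - {y}" by auto
        moreover have "y \<noteq> x" "y \<in> A" "a y = - a x" using that False by auto
        moreover have "a x = u \<or> - a x = u \<longleftrightarrow> u = v" "\<not> (a x = u \<and> - a x = u)" using that(2) False by (auto simp: v_def)
        ultimately show ?thesis
          using less.prems(1) x(1) by (auto simp: fiber_card_remove)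
      qed
      have vpos: "fiber_card A a v > 0"
      proof -
        have "fiber_card A a v = fiber_card A a (a x)"
          using less.prems(3)[of "a x"] by (simp add: v_def abs_if)
        moreover have "{i \<in> A. a i = a x} \<noteq> {}" "finite {i \<in> A. a i = a x}" using x(1) less.prems(1) by auto
        ultimately show ?thesis by (simp add: fiber_card_def card_gt_0_iff)
      qed
      then have "{i \<in> A. a i = v} \<noteq> {}" unfolding fiber_card_def card_gt_0_iff by blast
      then obtain i where "i \<in> A" "a i = v" by blast
      then have vV: "v \<in> V" using less.prems(2) v0 by auto
      define P' where "P' = (\<Prod>u\<in>V-{v}. t ^ fiber_card A a u * q_factorial (q\<^sup>2) (fiber_card A a u))"
      have PA: "P A = t ^ fiber_card A a v * q_factorial (q\<^sup>2) (fiber_card A a v) * P'"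
        unfolding P_def P'_def by (rule prod.remove[OF assms(2) vV])
      have PA2: "P (A - {x, y}) = t ^ (fiber_card A a v - 1) * q_factorial (q\<^sup>2) (fiber_card A a v - 1) * P'"
        if "y \<in> ?Y" for y
      proof -
        have "P (A - {x, y}) = t ^ fiber_card (A - {x, y}) a v * q_factorial (q\<^sup>2) (fiber_card (A - {x, y}) a v)
          * (\<Prod>u\<in>V-{v}. t ^ fiber_card (A - {x, y}) a u * q_factorial (q\<^sup>2) (fiber_card (A - {x, y}) a u))"
          unfolding P_def by (rule prod.remove[OF assms(2) vV])
        also have "(\<Prod>u\<in>V-{v}. t ^ fiber_card (A - {x, y}) a u * q_factorial (q\<^sup>2) (fiber_card (A - {x, y}) a u)) = P'"
          unfolding P'_def
        proof (rule prod.cong[OF refl])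
          fix u assume "u \<in> V - {v}"
          then have "u \<ge> 0" "u \<noteq> v" using assms(3) by auto
          then show "t ^ fiber_card (A - {x, y}) a u * q_factorial (q\<^sup>2) (fiber_card (A - {x, y}) a u)
            = t ^ fiber_card A a u * q_factorial (q\<^sup>2) (fiber_card A a u)"
            using f[OF that, of u] by simp
        qed
        finally show ?thesis using f[OF that, of v] v0 by simp
      qed
      have "I A = (\<Sum>y\<in>?Y. t * (q\<^sup>2) ^ g y * (t ^ (fiber_card A a v - 1) * q_factorial (q\<^sup>2) (fiber_card A a v - 1) * P' * L (fiber_card A a 0)))"
        unfolding S
      proof (rule sum.cong[OF refl])
        fix y assume y: "y \<in> ?Y"
        then have "y \<in> ?Y - {x}" using xY by simp
        from moved[OF this] show "(\<Sum>\<tau>\<in>invol_maps (A - {x, y}) a. q ^ level_invs A a (\<tau>(x := y, y := x)) * t ^ two_cycles A a (\<tau>(x := y, y := x)))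
          = t * (q\<^sup>2) ^ g y * (t ^ (fiber_card A a v - 1) * q_factorial (q\<^sup>2) (fiber_card A a v - 1) * P' * L (fiber_card A a 0))"
          using PA2[OF y] f[OF y, of 0] v0 False by simp
      qed
      also have "\<dots> = t * q_sum (q\<^sup>2) (fiber_card A a v) * (t ^ (fiber_card A a v - 1) * q_factorial (q\<^sup>2) (fiber_card A a v - 1) * P' * L (fiber_card A a 0))"
        unfolding cY[symmetric] gsum[unfolded xY, symmetric] by (simp add: sum_distrib_left sum_distrib_right algebra_simps)
      also have "\<dots> = P A * L (fiber_card A a 0)"
        unfolding PA using vpos
        by (cases "fiber_card A a v") (simp_all add: q_factorial_Suc algebra_simps)
      finally show ?thesis .
    qed
    then show ?thesis by (simp add: I_def P_def)
  qed
qed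

subsection \<open>Affine permutations\<close>

lemma int_between_mult:
  fixes x :: int
  assumes "m > 0" "m * k < x" "x < m * k + m"
  shows "x div m = k"
  by (rule int_div_pos_eq[of x m k "x - m * k"]) (use assms in auto)

lemma div_uminus_nondvd:
  fixes x m :: int
  assumes "m > 0" "\<not> m dvd x"
  shows "(- x) div m = - (x div m) - 1"
  using assms by (simp add: zdiv_zminus1_eq_if dvd_eq_mod_eq_0)

locale affine =
  fixes n :: nat
  assumes n_pos: "n > 0"
begin

definition window :: "int set" where "window = {1..int n}"

definition res :: "int \<Rightarrow> int" where "res i = (i - 1) mod int n + 1"

definition quo :: "int \<Rightarrow> int" where "quo i = (i - 1) div int n"

definition periodic :: "(int \<Rightarrow> int) \<Rightarrow> bool" where
  "periodic w \<longleftrightarrow> (\<forall>i. w (i + int n) = w i + int n)"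

lemma finite_window [simp]: "finite window" by (simp add: window_def)

lemma card_window [simp]: "card window = n" by (simp add: window_def)

lemma res_in [simp]: "res i \<in> window"
  using n_pos by (auto simp: window_def res_def add1_zle_eq)

lemma res_quo: "i = res i + int n * quo i"
  by (simp add: res_def quo_def)

lemma res_unique: "r \<in> window \<Longrightarrow> res (r + int n * k) = r \<and> quo (r + int n * k) = k"
proof -
  assume "r \<in> window"
  then have "0 \<le> r - 1" "r - 1 < int n" by (auto simp: window_def)
  moreover have "r + int n * k - 1 = (r - 1) + int n * k" by simp
  ultimately show ?thesis unfolding res_def quo_def using n_pos
    by (simp only: mod_mult_self2 div_mult_self2 mod_pos_pos_trivial div_pos_pos_trivial) simp
qed

lemma res_window [simp]: "r \<in> window \<Longrightarrow> res r = r"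
  using res_unique[of r 0] by simp

lemma quo_window [simp]: "r \<in> window \<Longrightarrow> quo r = 0"
  using res_unique[of r 0] by simp

lemma res_shift [simp]: "res (i + int n * k) = res i"
  and quo_shift [simp]: "quo (i + int n * k) = quo i + k"
proof -
  have "i + int n * k = res i + int n * (quo i + k)"
    using res_quo[of i] by (simp add: algebra_simps)
  then show "res (i + int n * k) = res i" "quo (i + int n * k) = quo i + k"
    using res_unique[OF res_in, of i "quo i + k"] by simp_all
qed

lemma res_eq_iff: "res i = res j \<longleftrightarrow> i mod int n = j mod int n"
proof
  assume "res i = res j"
  then have "i = j + int n * (quo i - quo j)" using res_quo[of i] res_quo[of j] by (simp add: algebra_simps)
  then show "i mod int n = j mod int n" by (metis mod_mult_self2)
next
  assume "i mod int n = j mod int n"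
  then have "(i - 1) mod int n = (j - 1) mod int n" by (rule mod_diff_cong) simp
  then show "res i = res j" by (simp add: res_def)
qed

lemma res_eq_iff_dvd: "res i = res j \<longleftrightarrow> int n dvd (j - i)"
  by (simp add: res_eq_iff mod_eq_dvd_iff dvd_diff_commute)

lemma periodic_mult: "periodic w \<Longrightarrow> w (i + int n * k) = w i + int n * k"
proof (induction k rule: int_induct[of _ 0])
  case (step1 k)
  have "w (i + int n * k + int n) = w (i + int n * k) + int n"
    using step1(3) by (auto simp: periodic_def)
  then show ?case using step1 by (simp add: algebra_simps)
next
  case (step2 k)
  have "w (i + int n * (k - 1) + int n) = w (i + int n * (k - 1)) + int n"
    using step2(3) by (auto simp: periodic_def)
  then show ?case using step2 by (simp add: algebra_simps)
qed simp

lemma periodic_res: "periodic w \<Longrightarrow> w i = w (res i) + int n * quo i"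
  using periodic_mult[of w "res i" "quo i"] res_quo[of i] by simp

lemma periodic_comp: "periodic v \<Longrightarrow> periodic w \<Longrightarrow> periodic (w \<circ> v)"
  by (simp add: periodic_def)

lemma periodic_eqI: "periodic v \<Longrightarrow> periodic w \<Longrightarrow> (\<And>i. i \<in> window \<Longrightarrow> v i = w i) \<Longrightarrow> v = w"
proof
  fix i assume "periodic v" "periodic w" "\<And>i. i \<in> window \<Longrightarrow> v i = w i"
  then show "v i = w i" using periodic_res[of v i] periodic_res[of w i] by simp
qed

text \<open>One direction is periodicity. The other uses injectivity: if the values are congruent,
  \<open>w j\<close> is also the value of \<open>w\<close> at a translate of
  \<open>i\<close>.\<close>

lemma periodic_dvd_iff:
  assumes "periodic w" "bij w"
  shows "int n dvd (w j - w i) \<longleftrightarrow> int n dvd (j - i)"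
proof
  assume "int n dvd (w j - w i)"
  then obtain k where "w j - w i = int n * k" by (rule dvdE)
  then have "w j = w i + int n * k" by simp
  then have "w j = w (i + int n * k)" using periodic_mult[OF assms(1)] by simp
  then have "j = i + int n * k" using assms(2) by (simp add: bij_def inj_eq)
  then show "int n dvd (j - i)" by simp
next
  assume "int n dvd (j - i)"
  then obtain k where "j - i = int n * k" by (rule dvdE)
  then have "j = i + int n * k" by simp
  then show "int n dvd (w j - w i)" using periodic_mult[OF assms(1)] by simp
qed

lemma res_perm:
  assumes "periodic w" "bij w"
  shows "bij_betw (\<lambda>i. res (w i)) window window"
proof -
  have "inj_on (\<lambda>i. res (w i)) window"
  proof (rule inj_onI)
    fix i j assume ij: "i \<in> window" "j \<in> window" "res (w i) = res (w j)"
    then have "int n dvd (j - i)" using periodic_dvd_iff[OF assms] by (simp add: res_eq_iff_dvd)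
    then have "res i = res j" by (simp add: res_eq_iff_dvd)
    then show "i = j" using ij by simp
  qed
  moreover have "(\<lambda>i. res (w i)) ` window \<subseteq> window" by auto
  ultimately show ?thesis
    unfolding bij_betw_def using endo_inj_surj[OF finite_window] by blast
qed

lemma sum_reindex_res:
  assumes "periodic w" "bij w"
  shows "(\<Sum>i\<in>window. g (res (w i))) = sum g window"
  using sum.reindex_bij_betw[OF res_perm[OF assms], of g] .

lemma sum_res_quo:
  assumes "periodic v" "bij v" "periodic w"
  shows "(\<Sum>i\<in>window. w (v i)) = sum w window + int n * (\<Sum>i\<in>window. quo (v i))"
proof -
  have "(\<Sum>i\<in>window. w (v i)) = (\<Sum>i\<in>window. w (res (v i)) + int n * quo (v i))"
    by (rule sum.cong[OF refl]) (rule periodic_res[OF assms(3)])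
  also have "\<dots> = sum w window + int n * (\<Sum>i\<in>window. quo (v i))"
    using sum_reindex_res[OF assms(1,2), of w] by (simp add: sum.distrib sum_distrib_left)
  finally show ?thesis .
qed

abbreviation AS :: "(int \<Rightarrow> int) set" where "AS \<equiv> carrier (affine_sym n)"

text \<open>The residues of a periodic bijection permute the window, so the normalization of the sum
  only constrains the quotients.\<close>

lemma AS_iff: "w \<in> AS \<longleftrightarrow> bij w \<and> periodic w \<and> (\<Sum>i\<in>window. quo (w i)) = 0"
proof -
  have "sum w window = sum (\<lambda>i. i) window + int n * (\<Sum>i\<in>window. quo (w i))" if "bij w" "periodic w"
    using sum_res_quo[of w "\<lambda>i. i"] that by (simp add: periodic_def)
  then show ?thesis using n_pos
    by (auto simp: affine_sym_def periodic_def[symmetric] window_def)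
qed

lemma AS_bij [simp]: "w \<in> AS \<Longrightarrow> bij w"
  and AS_periodic [simp]: "w \<in> AS \<Longrightarrow> periodic w"
  and AS_quo: "w \<in> AS \<Longrightarrow> (\<Sum>i\<in>window. quo (w i)) = 0"
  using AS_iff by blast+

lemma periodic_ident [simp]: "periodic (\<lambda>i. i)" "periodic id"
  by (simp_all add: periodic_def)

lemma AS_I: 
  assumes "bij w" "periodic w" "sum w window = (\<Sum>i\<in>window. i)"
  shows "w \<in> AS"
proof -
  have "int n * (\<Sum>i\<in>window. quo (w i)) = 0"
    using sum_res_quo[OF assms(2,1) periodic_ident(1)] assms(3) by simp
  then show ?thesis unfolding AS_iff using assms n_pos by simp
qed

lemma AS_sum: "w \<in> AS \<Longrightarrow> sum w window = (\<Sum>i\<in>window. i)"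
  using sum_res_quo[OF AS_periodic AS_bij periodic_ident(1), of w] AS_quo[of w] by simp

lemma id_AS [simp]: "id \<in> AS" by (rule AS_I) (simp_all add: periodic_def)

lemma comp_AS [simp]: 
  assumes "v \<in> AS" "w \<in> AS"
  shows "v \<circ> w \<in> AS"
proof (rule AS_I)
  show "bij (v \<circ> w)" "periodic (v \<circ> w)" using assms by (auto intro: periodic_comp bij_comp)
  have "(\<Sum>i\<in>window. v (w i)) = sum v window"
    using sum_res_quo[of w v] AS_quo[OF assms(2)] assms by simp
  then show "sum (v \<circ> w) window = (\<Sum>i\<in>window. i)" using AS_sum[OF assms(1)] by simp
qed

lemma inv_AS:
  assumes w: "w \<in> AS"
  shows "inv_into UNIV w \<in> AS"
proof -
  let ?v = "inv_into UNIV w"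
  have b: "bij w" using w by simp
  have p: "periodic ?v"
  proof -
    have "?v (i + int n) = ?v i + int n" for i
    proof -
      have "w (?v i + int n) = w (?v i) + int n" using w by (auto simp: periodic_def dest: AS_periodic)
      also have "w (?v i) = i" using b by (simp add: bij_def surj_f_inv_f)
      finally have "?v (w (?v i + int n)) = ?v (i + int n)" by simp
      then show ?thesis using b by (simp add: bij_def inv_f_f)
    qed
    then show ?thesis unfolding periodic_def by simp
  qed
  have "(\<Sum>i\<in>window. w (?v i)) = sum w window + int n * (\<Sum>i\<in>window. quo (?v i))"
    by (rule sum_res_quo[OF p bij_imp_bij_inv[OF b] AS_periodic[OF w]])
  moreover have "w (?v i) = i" for i using b by (simp add: bij_def surj_f_inv_f)
  ultimately have "(\<Sum>i\<in>window. quo (?v i)) = 0" using AS_sum[OF w] n_pos by simp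
  then show ?thesis unfolding AS_iff using p bij_imp_bij_inv[OF b] by blast
qed

lemma mult_eq [simp]: "monoid.mult (affine_sym n) = (\<circ>)" by (simp only: affine_sym_def monoid.select_convs)
lemma one_eq [simp]: "one (affine_sym n) = id" by (simp only: affine_sym_def monoid.select_convs)

lemma group_AS: "group (affine_sym n)"
proof (rule groupI)
  fix w assume w: "w \<in> AS"
  then have "inv_into UNIV w \<circ> w = id" by (metis AS_bij bij_def inv_o_cancel)
  then show "\<exists>v\<in>AS. v \<otimes>\<^bsub>affine_sym n\<^esub> w = \<one>\<^bsub>affine_sym n\<^esub>"
    using inv_AS[OF w] by auto
qed (auto simp: o_assoc)

section \<open>Simple reflections and the length formula\<close>

definition adj_swap :: "int \<Rightarrow> int \<Rightarrow> int" where
  "adj_swap c = (\<lambda>j. if res j = res c then j + 1 else if res j = res (c + 1) then j - 1 else j)"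

text \<open>\<open>adj_swap\<close> accepts every integer as index, so that a conjugate by an
  involution can be indexed by its values without reduction modulo \<open>n\<close>; see
  \<open>conj_adj_swap\<close>.\<close>

lemma affine_gen_eq: "affine_gen n i = adj_swap (int i)"
  by (simp add: affine_gen_def adj_swap_def res_eq_iff fun_eq_iff)

lemma res_cong_add: "res i = res j \<Longrightarrow> res (i + k) = res (j + k)"
  unfolding res_eq_iff by (rule mod_add_cong) simp_all

end

context affine begin

context
  assumes n2: "n \<ge> 2"
begin

text \<open>This is where \<open>n \<ge> 2\<close> enters: for \<open>n = 1\<close> the residues
  coincide and \<open>adj_swap\<close> would be a shift.\<close>

lemma res_Suc_neq: "res (c + 1) \<noteq> res c" "res (c - 1) \<noteq> res c"
proof -
  show "res (c + 1) \<noteq> res c" for c unfolding res_eq_iff_dvd using n2 by (simp add: zdvd_not_zless)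
  from this[of "c - 1"] show "res (c - 1) \<noteq> res c" by (metis diff_add_cancel)
qed

lemma adj_swap_adj_swap [simp]: "adj_swap c (adj_swap c j) = j"
proof -
  consider "res j = res c" | "res j \<noteq> res c" "res j = res (c + 1)" | "res j \<noteq> res c" "res j \<noteq> res (c + 1)" by blast
  then show ?thesis
  proof cases
    case 1
    then have 2: "res (j + 1) = res (c + 1)" by (rule res_cong_add)
    have "adj_swap c j = j + 1" using 1 by (simp add: adj_swap_def)
    moreover have "adj_swap c (j + 1) = j" using 2 res_Suc_neq(1)[of c] by (simp add: adj_swap_def)
    ultimately show ?thesis by simp
  next
    case 2
    then have 3: "res (j - 1) = res c" using res_cong_add[of j "c + 1" "-1"] by simp
    have "adj_swap c j = j - 1" using 2 by (simp add: adj_swap_def)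
    moreover have "adj_swap c (j - 1) = j" using 3 by (simp add: adj_swap_def)
    ultimately show ?thesis by simp
  next
    case 3
    then show ?thesis by (simp add: adj_swap_def)
  qed
qed

lemma adj_swap_comp [simp]: "adj_swap c \<circ> adj_swap c = id"
  by (auto simp: fun_eq_iff)

lemma bij_adj_swap [simp]: "bij (adj_swap c)"
  by (rule o_bij[of "adj_swap c"]) (simp_all add: fun_eq_iff)

lemma periodic_adj_swap [simp]: "periodic (adj_swap c)"
  using res_shift[of _ 1] by (auto simp: periodic_def adj_swap_def)

lemma adj_swap_AS [simp]: "adj_swap c \<in> AS"
proof -
  have "adj_swap c j - j = (if j = res c then 1 else 0) - (if j = res (c + 1) then 1 else 0)" if "j \<in> window" for j
    using that res_Suc_neq[of c] by (auto simp: adj_swap_def)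
  then have "(\<Sum>j\<in>window. adj_swap c j - j) = (\<Sum>j\<in>window. (if j = res c then 1 else 0) - (if j = res (c + 1) then 1 else 0))"
    by (intro sum.cong) auto
  also have "\<dots> = 0" by (simp add: sum_subtractf)
  finally have "sum (adj_swap c) window = (\<Sum>j\<in>window. j)" by (simp add: sum_subtractf)
  then show ?thesis by (intro AS_I) auto
qed

text \<open>Each integer moves by at most 1, so the order can only be reversed on neighbours that
  are being exchanged.\<close>

lemma adj_swap_less:
  assumes "i < j" "\<not> (res i = res c \<and> j = i + 1)"
  shows "adj_swap c i < adj_swap c j"
proof (rule ccontr)
  assume ge: "\<not> adj_swap c i < adj_swap c j"
  have i: "adj_swap c i \<le> i + 1" "adj_swap c i = i + 1 \<longleftrightarrow> res i = res c" by (auto simp: adj_swap_def)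
  have j: "adj_swap c j \<ge> j - 1" by (auto simp: adj_swap_def)
  have "adj_swap c i \<noteq> adj_swap c j" using assms(1) by (metis adj_swap_adj_swap order_less_irrefl)
  then have "adj_swap c j < adj_swap c i" using ge by simp
  then have "j = i + 1" "adj_swap c i = i + 1" using i j assms(1) by auto
  then show False using i assms(2) by simp
qed

end

text \<open>
  Subtracting the second quotient makes the summand of Shi's formula periodic in both arguments, so that
  right multiplication by a generator is handled by reindexing residues.
\<close>
definition shi :: "(int \<Rightarrow> int) \<Rightarrow> int \<Rightarrow> int \<Rightarrow> int" where
  "shi w i j = \<bar>(w j - w i) div int n - (j - i) div int n\<bar>"

text \<open>Off the multiples of \<open>n\<close>, negation sends a floor \<open>d\<close> to
  \<open>- d - 1\<close>; in the difference of the two floors the corrections cancel.\<close>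

lemma shi_sym:
  assumes "periodic w" "bij w" "res i \<noteq> res j"
  shows "shi w i j = shi w j i"
proof -
  have "\<not> int n dvd (j - i)" using assms(3) by (simp add: res_eq_iff_dvd)
  moreover have "\<not> int n dvd (w j - w i)" using periodic_dvd_iff[OF assms(1,2)] calculation by simp
  ultimately have "(i - j) div int n = - ((j - i) div int n) - 1"
    "(w i - w j) div int n = - ((w j - w i) div int n) - 1"
    using div_uminus_nondvd[of "int n" "j - i"] div_uminus_nondvd[of "int n" "w j - w i"] n_pos by simp_all
  then show ?thesis unfolding shi_def by simp
qed

lemma shi_shift1:
  assumes "periodic w"
  shows "shi w (i + int n * k) j = shi w i j"
proof -
  have e: "x - (y + int n * k) = (x - y) + int n * (- k)" for x y by simp
  have d: "(x + int n * k) div int n = k + x div int n" for x k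
    using n_pos by (intro div_mult_self2) simp
  show ?thesis unfolding shi_def periodic_mult[OF assms] e d by simp
qed

lemma shi_shift2:
  assumes "periodic w"
  shows "shi w i (j + int n * k) = shi w i j"
proof -
  have e: "(x + int n * k) - y = (x - y) + int n * k" for x y by simp
  have d: "(x + int n * k) div int n = k + x div int n" for x k
    using n_pos by (intro div_mult_self2) simp
  show ?thesis unfolding shi_def periodic_mult[OF assms] e d by simp
qed

lemma shi_res: "periodic w \<Longrightarrow> shi w i j = shi w (res i) (res j)"
  using shi_shift1[of w "res i" "quo i"] shi_shift2[of w "res i" "res j" "quo j"] res_quo[of i] res_quo[of j] by simp

text \<open>Shi's formula: for \<open>i < j\<close> in the window the second quotient in
  \<open>shi\<close> vanishes.\<close>

definition len :: "(int \<Rightarrow> int) \<Rightarrow> nat" where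
  "len w = nat (\<Sum>(i, j)\<in>{(i, j). i \<in> window \<and> j \<in> window \<and> i < j}. \<bar>(w j - w i) div int n\<bar>)"

lemma finite_pairs [simp]: "finite {(i, j). i \<in> window \<and> j \<in> window \<and> P i j}"
  by (rule finite_subset[of _ "window \<times> window"]) auto

lemma window_div: "i \<in> window \<Longrightarrow> j \<in> window \<Longrightarrow> (j - i) div int n = (if j < i then - 1 else 0)"
proof -
  assume ij: "i \<in> window" "j \<in> window"
  show ?thesis
  proof (cases "j < i")
    case True
    have "(j - i) div int n = - 1"
      by (rule int_div_pos_eq[of _ _ _ "j - i + int n"]) (use ij True in \<open>auto simp: window_def\<close>)
    then show ?thesis using True by simp
  qed (use ij in \<open>auto simp: window_def\<close>)
qed

text \<open>Ordered pairs double the length, but make the index set invariant under every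
  permutation of the residues.\<close>

lemma len_shi:
  assumes "periodic w" "bij w"
  shows "2 * int (len w) = (\<Sum>(i, j)\<in>{(i, j). i \<in> window \<and> j \<in> window \<and> i \<noteq> j}. shi w i j)"
proof -
  let ?L = "{(i, j). i \<in> window \<and> j \<in> window \<and> i < j}" and ?G = "{(i, j). i \<in> window \<and> j \<in> window \<and> j < i}"
  have "{(i, j). i \<in> window \<and> j \<in> window \<and> i \<noteq> j} = ?L \<union> ?G" by auto
  moreover have "?L \<inter> ?G = {}" by auto
  ultimately have "(\<Sum>(i, j)\<in>{(i, j). i \<in> window \<and> j \<in> window \<and> i \<noteq> j}. shi w i j)
      = (\<Sum>(i, j)\<in>?L. shi w i j) + (\<Sum>(i, j)\<in>?G. shi w i j)"
    by (simp add: sum.union_disjoint)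
  also have "(\<Sum>(i, j)\<in>?G. shi w i j) = (\<Sum>(i, j)\<in>?L. shi w i j)"
    by (rule sum.reindex_bij_witness[where i = "\<lambda>(i, j). (j, i)" and j = "\<lambda>(i, j). (j, i)"])
      (use shi_sym[OF assms] in auto)
  also have "(\<Sum>(i, j)\<in>?L. shi w i j) = (\<Sum>(i, j)\<in>?L. \<bar>(w j - w i) div int n\<bar>)"
    by (rule sum.cong[OF refl]) (auto simp: shi_def window_def div_pos_pos_trivial)
  also have "\<dots> = int (len w)"
    unfolding len_def by (simp add: sum_nonneg split_beta)
  finally show ?thesis by simp
qed

text \<open>Reindexing by the reflection matches all summands for the product and for
  \<open>w\<close>, except at the residues of \<open>c\<close> and \<open>c + 1\<close>. Both
  ordered pairs there grow by 1, so the doubled length grows by 2.\<close>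

lemma len_adj_swap:
  assumes n2: "n \<ge> 2" and w: "w \<in> AS" and asc: "w c < w (c + 1)"
  shows "len (w \<circ> adj_swap c) = len w + 1"
proof -
  let ?s = "adj_swap c"
  let ?D = "{(i, j). i \<in> window \<and> j \<in> window \<and> i \<noteq> j}"
  have s: "periodic ?s" "bij ?s" "?s \<in> AS" using n2 by auto
  have p: "periodic (w \<circ> ?s)" "bij (w \<circ> ?s)" using comp_AS[OF w s(3)] by auto
  have ne: "res c \<noteq> res (c + 1)" using res_Suc_neq[OF n2] by metis
  have reidx: "(\<Sum>(i, j)\<in>?D. shi w (?s i) (?s j)) = (\<Sum>(i, j)\<in>?D. shi w i j)"
  proof (rule sum.reindex_bij_witness[where i = "\<lambda>(i, j). (res (?s i), res (?s j))" and j = "\<lambda>(i, j). (res (?s i), res (?s j))"])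
    have 1: "res (?s (res (?s i))) = i" if "i \<in> window" for i
    proof -
      have "?s (?s i) = ?s (res (?s i)) + int n * quo (?s i)" by (rule periodic_res[OF s(1)])
      then have "i = ?s (res (?s i)) + int n * quo (?s i)" using n2 by simp
      then have "res i = res (?s (res (?s i)))" by (metis res_shift)
      then show ?thesis using that by simp
    qed
    fix a assume a: "a \<in> ?D"
    show "(\<lambda>(i, j). (res (?s i), res (?s j))) ((\<lambda>(i, j). (res (?s i), res (?s j))) a) = a" using a 1 by auto
    show "(\<lambda>(i, j). (res (?s i), res (?s j))) a \<in> ?D" using a 1 by auto (metis 1)
    show "(\<lambda>(i, j). shi w i j) ((\<lambda>(i, j). (res (?s i), res (?s j))) a) = (\<lambda>(i, j). shi w (?s i) (?s j)) a"
      using shi_res[OF AS_periodic[OF w], of "?s (fst a)" "?s (snd a)"] by (simp add: split_beta)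
    show "(\<lambda>(i, j). (res (?s i), res (?s j))) ((\<lambda>(i, j). (res (?s i), res (?s j))) a) = a" using a 1 by auto
    show "(\<lambda>(i, j). (res (?s i), res (?s j))) a \<in> ?D" using a 1 by auto (metis 1)
  qed
  \<comment> \<open>For the other residue pairs, \<open>j\<close> lies strictly between two
    consecutive translates of \<open>i\<close>, and the reflection preserves both strict
    inequalities; hence the floor of \<open>(j - i) / n\<close> does not change.\<close>
  have same: "shi (w \<circ> ?s) i j = shi w (?s i) (?s j)"
    if ij: "res i \<noteq> res j" "\<not> (res i = res c \<and> res j = res (c + 1))" "\<not> (res j = res c \<and> res i = res (c + 1))" for i j
  proof -
    define k where "k = (j - i) div int n"
    have ndvd: "\<not> int n dvd (j - i)" using ij(1) by (simp add: res_eq_iff_dvd)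
    have "(j - i) mod int n \<noteq> 0" using ndvd by (simp add: dvd_eq_mod_eq_0)
    moreover have "(j - i) mod int n \<ge> 0" "(j - i) mod int n < int n" using n_pos by auto
    moreover have "j - i = int n * k + (j - i) mod int n" by (simp add: k_def)
    ultimately have lt: "i + int n * k < j" "j < i + int n * (k + 1)" by (auto simp: algebra_simps)
    have "?s (i + int n * k) < ?s j"
      by (rule adj_swap_less[OF n2 lt(1)]) (use ij res_shift res_cong_add in metis)
    moreover have "?s j < ?s (i + int n * (k + 1))"
    proof (rule adj_swap_less[OF n2 lt(2)], rule notI)
      assume a: "res j = res c \<and> i + int n * (k + 1) = j + 1"
      then have "res i = res (j + 1)" by (metis res_shift)
      also have "\<dots> = res (c + 1)" using a by (metis res_cong_add)
      finally show False using ij a by simp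
    qed
    ultimately have "int n * k < ?s j - ?s i" "?s j - ?s i < int n * k + int n"
      unfolding periodic_mult[OF s(1)] by (simp_all add: algebra_simps)
    then have "(?s j - ?s i) div int n = k" using n_pos by (intro int_between_mult) auto
    then show ?thesis by (simp add: shi_def k_def)
  qed
  let ?P = "{(res c, res (c + 1)), (res (c + 1), res c)}"
  have "(\<Sum>(i, j)\<in>?D. shi (w \<circ> ?s) i j - shi w (?s i) (?s j)) = (\<Sum>(i, j)\<in>?P. shi (w \<circ> ?s) i j - shi w (?s i) (?s j))"
  proof (rule sum.mono_neutral_right)
    show "\<forall>x\<in>?D - ?P. (case x of (i, j) \<Rightarrow> shi (w \<circ> ?s) i j - shi w (?s i) (?s j)) = 0"
    proof
      fix x assume x: "x \<in> ?D - ?P"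
      obtain i j where ij: "x = (i, j)" by (cases x)
      have "shi (w \<circ> ?s) i j = shi w (?s i) (?s j)" by (rule same) (use x ij in auto)
      then show "(case x of (i, j) \<Rightarrow> shi (w \<circ> ?s) i j - shi w (?s i) (?s j)) = 0" by (simp add: ij)
    qed
  qed (use ne in auto)
  also have "\<dots> = (shi (w \<circ> ?s) (res c) (res (c + 1)) - shi w (?s (res c)) (?s (res (c + 1))))
     + (shi (w \<circ> ?s) (res (c + 1)) (res c) - shi w (?s (res (c + 1))) (?s (res c)))"
    using ne by simp
  also have "\<dots> = 2 * (shi (w \<circ> ?s) c (c + 1) - shi w (c + 1) c)"
  proof -
    have a: "shi (w \<circ> ?s) (res c) (res (c + 1)) = shi (w \<circ> ?s) c (c + 1)"
      using shi_res[OF p(1), of c "c + 1"] by simp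
    have b: "shi (w \<circ> ?s) (res (c + 1)) (res c) = shi (w \<circ> ?s) (res c) (res (c + 1))"
      by (rule shi_sym[OF p]) (use ne in auto)
    have sr: "res (?s (res i)) = res (?s i)" for i using periodic_res[OF s(1), of i] by simp
    have sc: "?s c = c + 1" "?s (c + 1) = c" using ne by (auto simp: adj_swap_def)
    have c: "shi w (?s (res c)) (?s (res (c + 1))) = shi w (c + 1) c"
      using shi_res[of w "?s (res c)" "?s (res (c + 1))"] shi_res[of w "c + 1" c] w sr[of c] sr[of "c + 1"] sc by simp
    have d: "shi w (?s (res (c + 1))) (?s (res c)) = shi w (?s (res c)) (?s (res (c + 1)))"
      using w sr[of c] sr[of "c + 1"] sc ne by (intro shi_sym) auto
    show ?thesis using a b c d by simp
  qed
  \<comment> \<open>Let \<open>d\<close> be the floor of \<open>(w (c + 1) - w c) / n\<close>,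
    nonnegative because of the ascent. The two terms are \<open>d + 1\<close> and \<open>d\<close>,
    since the reversed difference has floor \<open>- d - 1\<close>.\<close>
  also have "shi (w \<circ> ?s) c (c + 1) - shi w (c + 1) c = 1"
  proof -
    have sc: "?s c = c + 1" "?s (c + 1) = c" using ne by (auto simp: adj_swap_def)
    have ndvd: "\<not> int n dvd (w (c + 1) - w c)"
      using periodic_dvd_iff[of w "c + 1" c] w ne by (simp add: res_eq_iff_dvd)
    have "shi w (c + 1) c = shi w c (c + 1)" by (rule shi_sym) (use w ne in auto)
    moreover have "(w c - w (c + 1)) div int n = - ((w (c + 1) - w c) div int n) - 1"
      using div_uminus_nondvd[OF _ ndvd] n_pos by simp
    moreover have "(w (c + 1) - w c) div int n \<ge> 0" using asc n_pos by (simp add: pos_imp_zdiv_nonneg_iff)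
    moreover have "(1::int) div int n = 0" using n2 by simp
    ultimately show ?thesis unfolding shi_def o_apply sc by simp
  qed
  finally have "(\<Sum>(i, j)\<in>?D. shi (w \<circ> ?s) i j - shi w (?s i) (?s j)) = 2" by (simp only: mult_1_right)
  moreover have "2 * int (len (w \<circ> ?s)) - 2 * int (len w) = (\<Sum>(i, j)\<in>?D. shi (w \<circ> ?s) i j - shi w (?s i) (?s j))"
    unfolding len_shi[OF p] len_shi[OF AS_periodic[OF w] AS_bij[OF w]] reidx[symmetric]
    by (simp add: sum_subtractf split_beta)
  ultimately show ?thesis by simp
qed

lemma AS_inj: "w \<in> AS \<Longrightarrow> w i = w j \<longleftrightarrow> i = j"
  using AS_bij[of w] by (auto simp: bij_def dest: injD)

lemma len_adj_swap_descent:
  assumes n2: "n \<ge> 2" and w: "w \<in> AS" and desc: "w (c + 1) < w c"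
  shows "len w = len (w \<circ> adj_swap c) + 1"
proof -
  have sc: "adj_swap c c = c + 1" "adj_swap c (c + 1) = c" using res_Suc_neq[OF n2] by (auto simp: adj_swap_def)
  have "len ((w \<circ> adj_swap c) \<circ> adj_swap c) = len (w \<circ> adj_swap c) + 1"
    by (rule len_adj_swap[OF n2]) (use w n2 desc sc in auto)
  then show ?thesis using adj_swap_comp[OF n2, of c] by (simp add: o_assoc[symmetric])
qed

lemma len_adj_swap_iff:
  assumes n2: "n \<ge> 2" and w: "w \<in> AS"
  shows "len w < len (w \<circ> adj_swap c) \<longleftrightarrow> w c < w (c + 1)"
proof (cases "w c < w (c + 1)")
  case True
  then show ?thesis using len_adj_swap[OF n2 w] by simp
next
  case False
  moreover have "w c \<noteq> w (c + 1)" using AS_inj[OF w] by simp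
  ultimately have "w (c + 1) < w c" by simp
  then show ?thesis using len_adj_swap_descent[OF n2 w] by simp
qed

lemma len_id [simp]: "len id = 0"
proof -
  have "(\<Sum>(i, j)\<in>{(i, j). i \<in> window \<and> j \<in> window \<and> i < j}. \<bar>(id j - id i) div int n\<bar>) = 0"
    by (rule sum.neutral) (auto simp: window_div)
  then show ?thesis by (simp only: len_def nat_0)
qed

text \<open>Without a descent \<open>w i - i\<close> is weakly increasing from 0 to
  \<open>n\<close>, while its end values agree by periodicity. So it is constant, and the
  normalization of the sum makes the constant 0.\<close>

lemma exists_descent:
  assumes w: "w \<in> AS" "w \<noteq> id"
  shows "n \<ge> 2 \<and> (\<exists>c<n. w (int c + 1) < w (int c))"
proof -
  have "\<exists>c<n. w (int c + 1) < w (int c)"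
  proof (rule ccontr)
    assume "\<not> (\<exists>c<n. w (int c + 1) < w (int c))"
    then have "w (int c) \<le> w (int c + 1)" if "c < n" for c using that by (meson not_less)
    then have asc: "w (int c) < w (int c + 1)" if "c < n" for c
      using that AS_inj[OF w(1), of "int c" "int c + 1"] by (simp add: order_less_le)
    define d where "d i = w i - i" for i
    have step: "d i \<le> d (i + 1)" if "0 \<le> i" "i < int n" for i
      using asc[of "nat i"] that by (simp add: d_def)
    have mono: "d 0 \<le> d i" if "0 \<le> i" "i \<le> int n" for i
      using that
    proof (induction i rule: int_ge_induct)
      case (step i) then show ?case using \<open>\<And>i. 0 \<le> i \<Longrightarrow> i < int n \<Longrightarrow> d i \<le> d (i + 1)\<close>[of i] by simp
    qed simp
    have mono2: "d i \<le> d (int n)" if "0 \<le> i" "i \<le> int n" for i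
      using that(2,1)
    proof (induction i rule: int_le_induct)
      case (step i) then show ?case using \<open>\<And>i. 0 \<le> i \<Longrightarrow> i < int n \<Longrightarrow> d i \<le> d (i + 1)\<close>[of "i - 1"] by simp
    qed simp
    have dn: "d (int n) = d 0" using periodic_mult[of w 0 1] w by (simp add: d_def)
    have deq: "d i = d 0" if "i \<in> window" for i
      using that mono[of i] mono2[of i] dn by (auto simp: window_def)
    have "sum d window = 0" using AS_sum[OF w(1)] by (simp add: d_def sum_subtractf)
    moreover have "sum d window = int n * d 0" using deq by simp
    ultimately have "d 0 = 0" using n_pos by simp
    then have "w i = i" if "i \<in> window" for i using deq[OF that] by (simp add: d_def)
    then have "w = id" using w by (intro periodic_eqI) auto
    then show False using w by simp
  qed
  moreover have "n \<noteq> 1"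
  proof
    assume "n = 1"
    obtain c where c: "c < n" "w (int c + 1) < w (int c)" using calculation by blast
    have "w (int c + int n) = w (int c) + int n" using AS_periodic[OF w(1)] unfolding periodic_def by blast
    then show False using c \<open>n = 1\<close> by simp
  qed
  ultimately show ?thesis using n_pos by auto
qed

end

subsection \<open>Length and involutions\<close>

text \<open>A function that starts at 0, rises by at most 1 under a generator and can be lowered
  away from the identity is the word length. The set \<open>C\<close>, closed under right
  multiplication by \<open>S\<close>, makes the criterion apply to parabolic subgroups too, and
  identifies the subgroup generated by \<open>S\<close> on the way.\<close>

lemma word_length_eqI:
  fixes G (structure) and N :: "'a \<Rightarrow> nat"
  assumes "group G" and S: "S \<subseteq> carrier G" "\<And>s. s \<in> S \<Longrightarrow> s \<otimes> s = \<one>"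
    and C: "C \<subseteq> carrier G" "\<one> \<in> C" "\<And>w s. w \<in> C \<Longrightarrow> s \<in> S \<Longrightarrow> w \<otimes> s \<in> C"
    and N: "N \<one> = 0" "\<And>w s. w \<in> C \<Longrightarrow> s \<in> S \<Longrightarrow> N (w \<otimes> s) \<le> N w + 1"
      "\<And>w. w \<in> C \<Longrightarrow> w \<noteq> \<one> \<Longrightarrow> \<exists>s\<in>S. N (w \<otimes> s) < N w"
  shows "w \<in> C \<Longrightarrow> word_length G S w = N w"
    and "carrier (subgroup_generated G S) = C"
proof -
  interpret group G by fact
  define word where "word xs = foldr (\<otimes>) xs \<one>" for xs
  have foldr_word: "foldr (\<otimes>) xs a = word xs \<otimes> a \<and> word xs \<in> carrier G" if "set xs \<subseteq> S" "a \<in> carrier G" for xs a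
    using that
  proof (induction xs)
    case Nil
    then show ?case by (simp add: word_def)
  next
    case (Cons x xs)
    then have "x \<in> carrier G" using S(1) by auto
    moreover have "foldr (\<otimes>) xs a = word xs \<otimes> a" "word xs \<in> carrier G" using Cons by simp_all
    moreover have "word (x # xs) = x \<otimes> word xs" by (simp add: word_def)
    ultimately show ?case using Cons.prems by (simp add: m_assoc)
  qed
  have append: "word (xs @ ys) = word xs \<otimes> word ys" if "set xs \<subseteq> S" "set ys \<subseteq> S" for xs ys
  proof -
    have "word (xs @ ys) = foldr (\<otimes>) xs (word ys)" by (simp add: word_def)
    then show ?thesis using foldr_word[OF that(1)] foldr_word[OF that(2) one_closed] by simp
  qed
  have single: "word [s] = s" if "s \<in> S" for s
    using that S(1) by (auto simp: word_def)
  have A: "word xs \<in> C \<and> N (word xs) \<le> length xs" if "set xs \<subseteq> S" for xs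
    using that
  proof (induction xs rule: rev_induct)
    case Nil
    then show ?case using C(2) N(1) by (simp add: word_def)
  next
    case (snoc s xs)
    then have "word (xs @ [s]) = word xs \<otimes> s" using append[of xs "[s]"] single by simp
    then show ?case using snoc C(3)[of "word xs" s] N(2)[of "word xs" s] by simp
  qed
  have B: "\<exists>xs. set xs \<subseteq> S \<and> length xs = N w \<and> word xs = w" if "w \<in> C" for w
    using that
  proof (induction "N w" arbitrary: w rule: less_induct)
    case less
    show ?case
    proof (cases "w = \<one>")
      case True
      then show ?thesis using N(1) by (intro exI[of _ "[]"]) (simp add: word_def)
    next
      case False
      then obtain s where s: "s \<in> S" "N (w \<otimes> s) < N w" using N(3) less.prems by blast
      then obtain xs where xs: "set xs \<subseteq> S" "length xs = N (w \<otimes> s)" "word xs = w \<otimes> s"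
        using less.hyps[of "w \<otimes> s"] C(3) less.prems by blast
      have "word (xs @ [s]) = w \<otimes> s \<otimes> s" using append[of xs "[s]"] single xs s by simp
      also have "\<dots> = w" using s S C(1) less.prems m_assoc[of w s s] by auto
      finally have w: "word (xs @ [s]) = w" .
      have "N w \<le> length (xs @ [s])" using A[of "xs @ [s]"] xs s w by simp
      then have "length (xs @ [s]) = N w" using xs s by simp
      then show ?thesis using w xs s by (intro exI[of _ "xs @ [s]"]) simp
    qed
  qed
  show "word_length G S w = N w" if "w \<in> C"
    unfolding word_length_def
  proof (rule Least_equality)
    show "\<exists>xs. set xs \<subseteq> S \<and> length xs = N w \<and> foldr (\<otimes>) xs \<one> = w"
      using B[OF that] by (simp add: word_def)
    show "N w \<le> y" if "\<exists>xs. set xs \<subseteq> S \<and> length xs = y \<and> foldr (\<otimes>) xs \<one> = w" for y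
      using that A unfolding word_def by blast
  qed
  have "x \<in> C" if "x \<in> generate G S" for x
  proof -
    have "\<exists>xs. set xs \<subseteq> S \<and> word xs = x"
      using that
    proof (induction rule: generate.induct)
      case one
      show ?case by (rule exI[of _ "[]"]) (simp add: word_def)
    next
      case (incl h)
      then show ?case using single by (intro exI[of _ "[h]"]) simp
    next
      case (inv h)
      then have "inv h = h" using S by (intro inv_equality) auto
      then show ?case using single inv by (intro exI[of _ "[h]"]) simp
    next
      case (eng h1 h2)
      then obtain xs ys where "set xs \<subseteq> S" "word xs = h1" "set ys \<subseteq> S" "word ys = h2" by blast
      then show ?case using append[of xs ys] by (intro exI[of _ "xs @ ys"]) simp
    qed
    then show ?thesis using A by blast
  qed
  moreover have "word xs \<in> generate G S" if "set xs \<subseteq> S" for xs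
    using that by (induction xs) (auto simp: word_def intro: generate.intros)
  then have "x \<in> generate G S" if "x \<in> C" for x using B[OF that] by blast
  ultimately have "generate G S = C" by blast
  moreover have "carrier G \<inter> S = S" using S(1) by blast
  ultimately show "carrier (subgroup_generated G S) = C"
    by (simp add: carrier_subgroup_generated)
qed

context affine begin

text \<open>\<open>shi\<close> compares differences before and after the map, so
  \<open>shi v (w i) (w j) = shi w i j\<close>; the pairs are reindexed by the residues of
  \<open>w\<close>.\<close>

lemma len_inverse:
  assumes v: "v \<in> AS" and w: "w \<in> AS" and inv: "v \<circ> w = id"
  shows "len v = len w"
proof -
  let ?D = "{(i, j). i \<in> window \<and> j \<in> window \<and> i \<noteq> j}"
  have vw: "v (w i) = i" for i using inv by (metis comp_apply id_apply)
  have wv: "w (v i) = i" for i using vw[of "v i"] AS_inj[OF v] by simp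
  have r: "res (v (res (w i))) = i" if "i \<in> window" for i
  proof -
    have "v (w i) = v (res (w i)) + int n * quo (w i)" 
      using periodic_mult[OF AS_periodic[OF v], of "res (w i)" "quo (w i)"] res_quo[of "w i"] by simp
    then have "res i = res (v (res (w i)))" using vw by (metis res_shift)
    then show ?thesis using that by simp
  qed
  have r': "res (w (res (v i))) = i" if "i \<in> window" for i
  proof -
    have "w (v i) = w (res (v i)) + int n * quo (v i)" 
      using periodic_mult[OF AS_periodic[OF w], of "res (v i)" "quo (v i)"] res_quo[of "v i"] by simp
    then have "res i = res (w (res (v i)))" using wv by (metis res_shift)
    then show ?thesis using that by simp
  qed
  have "(\<Sum>(i, j)\<in>?D. shi w i j) = (\<Sum>(i, j)\<in>?D. shi v i j)"
  proof (rule sum.reindex_bij_witness[where i = "\<lambda>(i, j). (res (v i), res (v j))" and j = "\<lambda>(i, j). (res (w i), res (w j))"])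
    fix a assume a: "a \<in> ?D"
    obtain i j where ij: "a = (i, j)" "i \<in> window" "j \<in> window" "i \<noteq> j" using a by auto
    show "(\<lambda>(i, j). (res (v i), res (v j))) ((\<lambda>(i, j). (res (w i), res (w j))) a) = a" using r ij by simp
    show "(\<lambda>(i, j). (res (w i), res (w j))) a \<in> ?D" using r[OF ij(2)] r[OF ij(3)] ij by auto
    have "shi v (res (w i)) (res (w j)) = shi v (w i) (w j)" using shi_res[OF AS_periodic[OF v], of "w i" "w j"] by simp
    also have "\<dots> = shi w i j" by (simp add: shi_def vw)
    finally show "(\<lambda>(i, j). shi v i j) ((\<lambda>(i, j). (res (w i), res (w j))) a) = (\<lambda>(i, j). shi w i j) a" by (simp add: ij)
  next
    fix a assume a: "a \<in> ?D"
    obtain i j where ij: "a = (i, j)" "i \<in> window" "j \<in> window" "i \<noteq> j" using a by auto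
    show "(\<lambda>(i, j). (res (w i), res (w j))) ((\<lambda>(i, j). (res (v i), res (v j))) a) = a" using r' ij by simp
    show "(\<lambda>(i, j). (res (v i), res (v j))) a \<in> ?D" using r'[OF ij(2)] r'[OF ij(3)] ij by auto
  qed
  then show ?thesis using len_shi[of v] len_shi[of w] v w by simp
qed

section \<open>Involutions under multiplication and conjugation by reflections\<close>

definition invols :: "(int \<Rightarrow> int) set" where "invols = {z \<in> AS. z \<circ> z = id}"

text \<open>In a 2-cycle of an involution exactly one of the two residue classes moves up, so this
  is the number of 2-cycles modulo \<open>n\<close> and the candidate for
  \<open>\<ell>'\<close>.\<close>

definition exc :: "(int \<Rightarrow> int) \<Rightarrow> nat" where "exc z = card {i \<in> window. i < z i}"

lemma invols_AS [simp]: "z \<in> invols \<Longrightarrow> z \<in> AS" by (simp add: invols_def)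

lemma invols_invol: "z \<in> invols \<Longrightarrow> z (z i) = i"
proof -
  assume "z \<in> invols"
  then have "z \<circ> z = id" unfolding invols_def by blast
  then show ?thesis by (rule pointfree_idE)
qed

lemma involsI: "z \<in> AS \<Longrightarrow> (\<And>i. z (z i) = i) \<Longrightarrow> z \<in> invols"
  unfolding invols_def by (auto simp only: mem_Collect_eq fun_eq_iff comp_apply id_apply)

context
  fixes c :: int
  assumes n2: "n \<ge> 2"
begin

lemma swap_at: "adj_swap c c = c + 1" "adj_swap c (c + 1) = c"
  using res_Suc_neq[OF n2] by (auto simp: adj_swap_def)

lemma swap_pair:
  "res j = res c \<or> res j = res (c + 1) \<Longrightarrow> res (adj_swap c j) = res c \<or> res (adj_swap c j) = res (c + 1)"
  using res_cong_add[of j c 1] res_cong_add[of j "c + 1" "-1"] by (auto simp: adj_swap_def)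

lemma conj_invols: "z \<in> invols \<Longrightarrow> adj_swap c \<circ> z \<circ> adj_swap c \<in> invols"
  by (intro involsI) (auto simp: n2 invols_invol)

lemma swap_comm_iff:
  assumes z: "z \<in> invols"
  shows "z \<circ> adj_swap c \<in> invols \<longleftrightarrow> (\<forall>i. z (adj_swap c i) = adj_swap c (z i))"
proof
  assume zs: "z \<circ> adj_swap c \<in> invols"
  show "\<forall>i. z (adj_swap c i) = adj_swap c (z i)"
  proof
    fix i
    have "z (adj_swap c (z (adj_swap c (adj_swap c i)))) = adj_swap c i" using invols_invol[OF zs] by simp
    then have "z (adj_swap c (z i)) = adj_swap c i" using n2 by simp
    then have "z (z (adj_swap c (z i))) = z (adj_swap c i)" by simp
    then show "z (adj_swap c i) = adj_swap c (z i)" using invols_invol[OF z] by simp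
  qed
next
  assume "\<forall>i. z (adj_swap c i) = adj_swap c (z i)"
  then show "z \<circ> adj_swap c \<in> invols"
    using z n2 by (intro involsI) (auto simp: invols_invol)
qed

text \<open>A translation by \<open>n * k\<close> at \<open>i\<close> would be repeated at
  \<open>z i\<close>, and the involution returns to \<open>i\<close> only for
  \<open>k = 0\<close>.\<close>

lemma fixed_of_shift:
  assumes z: "z \<in> invols" and r: "res (z i) = res i"
  shows "z i = i"
proof -
  have "int n dvd (z i - i)" using r res_eq_iff_dvd[of i "z i"] by simp
  then obtain k where "z i - i = int n * k" by (rule dvdE)
  then have k: "z i = i + int n * k" by simp
  then have "z (z i) = i + int n * k + int n * k" using periodic_mult[of z i k] z by simp
  then have "int n * k = 0" using invols_invol[OF z, of i] by auto
  then show ?thesis using k by simp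
qed

text \<open>If \<open>z\<close> commutes with the reflection, \<open>z (c + 1)\<close> is the
  reflected \<open>z c\<close>. Being larger, it equals \<open>z c + 1\<close> with
  \<open>z c\<close> congruent to \<open>c\<close>, and \<open>fixed_of_shift\<close> applies.
  Otherwise the reflection cannot reverse the two values, so there is an ascent on the left side as
  well.\<close>

lemma invol_asc_cases:
  assumes z: "z \<in> invols" and asc: "z c < z (c + 1)"
  shows "z \<circ> adj_swap c \<in> invols \<longleftrightarrow> z c = c \<and> z (c + 1) = c + 1"
    and "z \<circ> adj_swap c \<notin> invols \<Longrightarrow> adj_swap c (z c) < adj_swap c (z (c + 1))"
proof -
  have 1: "z c = c \<and> z (c + 1) = c + 1" if "res (z c) = res c" "z (c + 1) = z c + 1"
    using fixed_of_shift[OF z that(1)] that(2) by simp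
  show 2: "z \<circ> adj_swap c \<in> invols \<longleftrightarrow> z c = c \<and> z (c + 1) = c + 1"
  proof
    assume "z \<circ> adj_swap c \<in> invols"
    then have "z (c + 1) = adj_swap c (z c)" using swap_comm_iff[OF z] swap_at by metis
    then have "adj_swap c (z c) > z c" using asc by simp
    then have "res (z c) = res c \<and> adj_swap c (z c) = z c + 1" by (auto simp: adj_swap_def split: if_splits)
    then show "z c = c \<and> z (c + 1) = c + 1" using 1 \<open>z (c + 1) = adj_swap c (z c)\<close> by simp
  next
    assume fx: "z c = c \<and> z (c + 1) = c + 1"
    have f1: "z i = i" if r: "res i = res c \<or> res i = res (c + 1)" for i
    proof -
      obtain d where d: "d = c \<or> d = c + 1" "res i = res d" using r by blast
      then have "int n dvd (i - d)" using res_eq_iff_dvd[of d i] by simp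
      then obtain k where "i - d = int n * k" by (rule dvdE)
      then have "i = d + int n * k" by simp
      then show ?thesis using periodic_mult[of z d k] z fx d by auto
    qed
    show "z \<circ> adj_swap c \<in> invols"
      unfolding swap_comm_iff[OF z]
    proof
      fix i
      show "z (adj_swap c i) = adj_swap c (z i)"
      proof (cases "res i = res c \<or> res i = res (c + 1)")
        case True
        then have "res (adj_swap c i) = res c \<or> res (adj_swap c i) = res (c + 1)"
          by (rule swap_pair)
        then show ?thesis using f1 True by simp
      next
        case False
        have "\<not> (res (z i) = res c \<or> res (z i) = res (c + 1))"
        proof
          assume "res (z i) = res c \<or> res (z i) = res (c + 1)"
          then have "z (z i) = z i" by (rule f1)
          then have "z i = i" using invols_invol[OF z] by simp
          then show False using False \<open>res (z i) = res c \<or> res (z i) = res (c + 1)\<close> by simp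
        qed
        then show ?thesis using False by (auto simp: adj_swap_def)
      qed
    qed
  qed
  show "adj_swap c (z c) < adj_swap c (z (c + 1))" if "z \<circ> adj_swap c \<notin> invols"
    by (rule adj_swap_less[OF n2 asc]) (use that 1 2 in blast)
qed

text \<open>Left multiplication is turned into right multiplication by \<open>len_inverse\<close>;
  the second ascent from \<open>invol_asc_cases\<close> gives the second step.\<close>

lemma len_conj:
  assumes z: "z \<in> invols" and asc: "z c < z (c + 1)" and nc: "z \<circ> adj_swap c \<notin> invols"
  shows "len (adj_swap c \<circ> z \<circ> adj_swap c) = len z + 2"
proof -
  have s: "adj_swap c \<in> AS" using n2 by simp
  have "(adj_swap c \<circ> z) \<circ> (z \<circ> adj_swap c) = id" using n2 by (auto simp: fun_eq_iff invols_invol[OF z])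
  then have "len (adj_swap c \<circ> z) = len (z \<circ> adj_swap c)" using s z by (intro len_inverse) auto
  also have "\<dots> = len z + 1" using z asc by (intro len_adj_swap[OF n2]) auto
  finally have "len (adj_swap c \<circ> z) = len z + 1" .
  moreover have "len ((adj_swap c \<circ> z) \<circ> adj_swap c) = len (adj_swap c \<circ> z) + 1"
    using z s invol_asc_cases(2)[OF z asc nc] by (intro len_adj_swap[OF n2]) auto
  ultimately show ?thesis by simp
qed

lemma len_conj_desc:
  assumes z: "z \<in> invols" and desc: "z (c + 1) < z c" and nc: "z \<circ> adj_swap c \<notin> invols"
  shows "len z = len (adj_swap c \<circ> z \<circ> adj_swap c) + 2"
proof -
  let ?z = "adj_swap c \<circ> z \<circ> adj_swap c"
  have zz: "?z \<in> invols" by (rule conj_invols[OF z])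
  have nc': "?z \<circ> adj_swap c \<notin> invols"
  proof
    assume "?z \<circ> adj_swap c \<in> invols"
    then have "adj_swap c (z (adj_swap c (adj_swap c i))) = adj_swap c (adj_swap c (z (adj_swap c i)))" for i
      unfolding swap_comm_iff[OF zz] by simp
    then have "adj_swap c (z i) = z (adj_swap c i)" for i using n2 by simp
    then have "z \<circ> adj_swap c \<in> invols" unfolding swap_comm_iff[OF z] by simp
    then show False using nc by simp
  qed
  have "adj_swap c (z (c + 1)) < adj_swap c (z c)"
  proof (rule adj_swap_less[OF n2 desc], rule notI)
    \<comment> \<open>The only obstruction is that \<open>z\<close> exchanges \<open>c\<close> and
      \<open>c + 1\<close> up to a translation. The translation is 0 because \<open>z\<close> is an
      involution, so \<open>z\<close> agrees with the reflection on these residues and commutes with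
      it, against \<open>nc\<close>.\<close>
    assume a: "res (z (c + 1)) = res c \<and> z c = z (c + 1) + 1"
    then have "int n dvd (z (c + 1) - c)" using res_eq_iff_dvd[of c "z (c + 1)"] by simp
    then obtain k where "z (c + 1) - c = int n * k" by (rule dvdE)
    then have k: "z (c + 1) = c + int n * k" "z c = c + 1 + int n * k" using a by auto
    have "z (z c) = c + int n * k + int n * k" using periodic_mult[of z "c + 1" k] k z by simp
    then have k0: "int n * k = 0" using invols_invol[OF z, of c] by auto
    then have zc: "z c = c + 1" "z (c + 1) = c" using k by auto
    have "z (adj_swap c i) = adj_swap c (z i)" for i
    proof -
      have A: "z i = adj_swap c i" if r: "res i = res c \<or> res i = res (c + 1)" for i
      proof -
        obtain d where d: "d = c \<or> d = c + 1" "res i = res d" using r by blast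
        then have "int n dvd (i - d)" using res_eq_iff_dvd[of d i] by simp
        then obtain k where "i - d = int n * k" by (rule dvdE)
        then have "i = d + int n * k" by simp
        then show ?thesis using periodic_mult[of z d k] periodic_mult[of "adj_swap c" d k] z zc d n2 swap_at by auto
      qed
      show ?thesis
      proof (cases "res i = res c \<or> res i = res (c + 1)")
        case True
        then have "res (adj_swap c i) = res c \<or> res (adj_swap c i) = res (c + 1)"
          by (rule swap_pair)
        then show ?thesis using A True by simp
      next
        case False
        have "\<not> (res (z i) = res c \<or> res (z i) = res (c + 1))"
        proof
          assume r: "res (z i) = res c \<or> res (z i) = res (c + 1)"
          then have "z (z i) = adj_swap c (z i)" by (rule A)
          then have "i = adj_swap c (z i)" using invols_invol[OF z] by simp
          then have "res i = res c \<or> res i = res (c + 1)" using swap_pair[OF r] by simp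
          then show False using False by simp
        qed
        then show ?thesis using False by (auto simp: adj_swap_def)
      qed
    qed
    then have "z \<circ> adj_swap c \<in> invols" unfolding swap_comm_iff[OF z] by simp
    then show False using nc by simp
  qed
  then have asc': "?z c < ?z (c + 1)" using swap_at by simp
  have "adj_swap c \<circ> ?z \<circ> adj_swap c = z" using n2 by (auto simp: fun_eq_iff)
  then show ?thesis using len_conj[OF zz asc' nc'] by simp
qed

lemma card_window_shift:
  assumes "\<And>i k. P (i + int n * k) = P i"
  shows "card {i \<in> window. P (adj_swap c i)} = card {i \<in> window. P i}"
proof (rule bij_betw_same_card[of "\<lambda>i. res (adj_swap c i)"])
  have b: "bij_betw (\<lambda>i. res (adj_swap c i)) window window" using n2 by (intro res_perm) auto
  have "P (res i) = P i" for i using assms[of "res i" "quo i"] res_quo[of i] by simp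
  then have "{i \<in> window. P (adj_swap c i)} = {i \<in> window. True \<and> P (res (adj_swap c i))}" by auto
  moreover have "bij_betw (\<lambda>i. res (adj_swap c i)) {i \<in> window. (\<lambda>_. True) i = True \<and> P (res (adj_swap c i))} {j \<in> window. (\<lambda>_. True) j = True \<and> P j}"
    by (rule bij_betw_fiber[OF b]) auto
  ultimately show "bij_betw (\<lambda>i. res (adj_swap c i)) {i \<in> window. P (adj_swap c i)} {i \<in> window. P i}" by simp
qed

text \<open>Conjugation preserves the comparison \<open>i < z i\<close> unless \<open>z\<close>
  exchanges a pair \<open>j\<close>, \<open>j + 1\<close> that the reflection reverses; but then
  \<open>z\<close> commutes with the reflection and nothing changes.\<close>

lemma exc_conj:
  assumes z: "z \<in> invols"
  shows "exc (adj_swap c \<circ> z \<circ> adj_swap c) = exc z"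
proof (cases "z \<circ> adj_swap c \<in> invols")
  case True
  then have "adj_swap c \<circ> z \<circ> adj_swap c = z"
    using swap_comm_iff[OF z] n2 by (auto simp: fun_eq_iff)
  then show ?thesis by simp
next
  case False
  have nc: "z j \<noteq> j + 1" if "res j = res c" for j
  proof
    assume zj: "z j = j + 1"
    have "int n dvd (c - j)" using that res_eq_iff_dvd[of j c] by simp
    then obtain k where "c - j = int n * k" by (rule dvdE)
    then have c: "c = j + int n * k" by simp
    have zc: "z c = c + 1" using periodic_mult[of z j k] z zj by (simp add: c)
    then have zc1: "z (c + 1) = c" using invols_invol[OF z, of c] by simp
    \<comment> \<open>That \<open>z\<close> would commute is seen from lengths: otherwise
      conjugation shortens \<open>z\<close> by 2, while the one-sided products show that the
      conjugate is as long as \<open>z\<close>.\<close>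
    have "len z = len (adj_swap c \<circ> z \<circ> adj_swap c) + 2"
      by (rule len_conj_desc[OF z _ False]) (simp add: zc zc1)
    moreover have "len z = len (z \<circ> adj_swap c) + 1"
      using z zc zc1 by (intro len_adj_swap_descent[OF n2]) auto
    moreover have "len (adj_swap c \<circ> z \<circ> adj_swap c) = len (z \<circ> adj_swap c) + 1"
    proof -
      have "(z \<circ> adj_swap c) \<circ> (adj_swap c \<circ> z) = id" using n2 by (auto simp: fun_eq_iff invols_invol[OF z])
      then have e: "len (z \<circ> adj_swap c) = len (adj_swap c \<circ> z)" using z n2 by (intro len_inverse) auto
      have "adj_swap c (z c) = c" "adj_swap c (z (c + 1)) = c + 1" using swap_at zc zc1 by auto
      then have "len ((adj_swap c \<circ> z) \<circ> adj_swap c) = len (adj_swap c \<circ> z) + 1"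
        using z n2 by (intro len_adj_swap) auto
      then show ?thesis using e by simp
    qed
    ultimately show False by simp
  qed
  have eq: "adj_swap c j < adj_swap c (z j) \<longleftrightarrow> j < z j" for j
  proof
    assume a: "j < z j"
    show "adj_swap c j < adj_swap c (z j)"
      by (rule adj_swap_less[OF n2 a]) (use nc in auto)
  next
    assume a: "adj_swap c j < adj_swap c (z j)"
    show "j < z j"
    proof (rule ccontr)
      assume "\<not> j < z j"
      moreover have "z j \<noteq> j" using a by auto
      ultimately have lt: "z j < j" by simp
      have "adj_swap c (z j) < adj_swap c j"
        by (rule adj_swap_less[OF n2 lt]) (use nc[of "z j"] invols_invol[OF z, of j] in auto)
      then show False using a by simp
    qed
  qed
  have "{i \<in> window. i < (adj_swap c \<circ> z \<circ> adj_swap c) i} = {i \<in> window. adj_swap c i < z (adj_swap c i)}"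
    using eq[of "adj_swap c i" for i] n2 by (metis (no_types, opaque_lifting) adj_swap_adj_swap comp_apply)
  also have "card \<dots> = card {i \<in> window. i < z i}"
    by (rule card_window_shift[of "\<lambda>i. i < z i"]) (use periodic_mult[of z] z in auto)
  finally show ?thesis by (simp add: exc_def)
qed

text \<open>The involution fixes both residues, so the product has exactly one more 2-cycle, counted
  at \<open>res c\<close>.\<close>

lemma exc_swap_asc:
  assumes z: "z \<in> invols" and zs: "z \<circ> adj_swap c \<in> invols" and asc: "z c < z (c + 1)"
  shows "exc (z \<circ> adj_swap c) = exc z + 1"
proof -
  have fx: "z c = c" "z (c + 1) = c + 1" using invol_asc_cases(1)[OF z asc] zs by auto
  have f1: "z i = i" if r: "res i = res c \<or> res i = res (c + 1)" for i
  proof -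
    obtain d where d: "d = c \<or> d = c + 1" "res i = res d" using r by blast
    then have "int n dvd (i - d)" using res_eq_iff_dvd[of d i] by simp
    then obtain k where "i - d = int n * k" by (rule dvdE)
    then have "i = d + int n * k" by simp
    then show ?thesis using periodic_mult[of z d k] z fx d by auto
  qed
  have "i < z (adj_swap c i) \<longleftrightarrow> i = res c \<or> i < z i" if i: "i \<in> window" for i
  proof -
    consider "res i = res c" | "res i \<noteq> res c" "res i = res (c + 1)" | "res i \<noteq> res c" "res i \<noteq> res (c + 1)" by blast
    then show ?thesis
    proof cases
      case 1
      then have "res (i + 1) = res (c + 1)" by (rule res_cong_add)
      then have "z (adj_swap c i) = i + 1" using 1 f1[of "i + 1"] by (simp add: adj_swap_def)
      then show ?thesis using 1 i by simp
    next
      case 2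
      then have "res (i - 1) = res c" using res_cong_add[of i "c + 1" "-1"] by simp
      then have "z (adj_swap c i) = i - 1" using 2 f1[of "i - 1"] by (simp add: adj_swap_def)
      then show ?thesis using 2 i f1[of i] by auto
    next
      case 3
      then show ?thesis using i by (auto simp: adj_swap_def)
    qed
  qed
  then have "{i \<in> window. i < (z \<circ> adj_swap c) i} = insert (res c) {i \<in> window. i < z i}" by auto
  moreover have "res c \<notin> {i \<in> window. i < z i}" using f1[of "res c"] by simp
  ultimately show ?thesis by (simp add: exc_def)
qed

text \<open>Both differences are 1 or both are -1. This is property (c) in the definition of
  \<open>\<ell>'\<close>.\<close>

lemma exc_swap:
  assumes z: "z \<in> invols" and zs: "z \<circ> adj_swap c \<in> invols"
  shows "int (exc (z \<circ> adj_swap c)) - int (exc z) = int (len (z \<circ> adj_swap c)) - int (len z)"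
proof -
  have "z c \<noteq> z (c + 1)" using AS_inj[of z c "c + 1"] z by simp
  then consider "z c < z (c + 1)" | "z (c + 1) < z c" by linarith
  then show ?thesis
  proof cases
    case 1
    then show ?thesis using exc_swap_asc[OF z zs 1] len_adj_swap[OF n2 invols_AS[OF z] 1] by simp
  next
    case 2
    have e: "(z \<circ> adj_swap c) \<circ> adj_swap c = z" using n2 by (auto simp: fun_eq_iff)
    have a: "(z \<circ> adj_swap c) c < (z \<circ> adj_swap c) (c + 1)" using 2 swap_at by simp
    have "exc ((z \<circ> adj_swap c) \<circ> adj_swap c) = exc (z \<circ> adj_swap c) + 1"
      by (rule exc_swap_asc[OF zs _ a]) (simp only: e z)
    then have "exc z = exc (z \<circ> adj_swap c) + 1" by (simp only: e)
    then show ?thesis using len_adj_swap_descent[OF n2 invols_AS[OF z] 2] by simp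
  qed
qed

end

end

subsection \<open>Absolute length and parabolic subgroups\<close>

context affine begin

text \<open>The common form of two cases: the whole group with \<open>w = id\<close>, and
  \<open>W\<^sub>K\<close> with \<open>w\<close> minimal. Composition with \<open>w\<close> makes a
  twisted conjugate of \<open>u\<close> an ordinary conjugate of the involution
  \<open>u \<circ> w\<close>, so existence comes from \<open>exc_conj\<close> and
  \<open>exc_swap\<close>; subtracting \<open>exc w\<close> gives the value 0 at the
  identity.\<close>

lemma twisted_abs_length_eq:
  fixes H :: "(int \<Rightarrow> int) monoid"
  assumes H: "group H" "monoid.mult H = (\<circ>)" "one H = id" "carrier H \<subseteq> AS"
    and w: "w \<in> invols"
    and R: "\<And>r. r \<in> R \<Longrightarrow> n \<ge> 2" and K: "K = adj_swap ` R" "K \<subseteq> carrier H" "\<And>s. s \<in> K \<Longrightarrow> w \<circ> s \<circ> w \<in> K"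
    and wl: "\<And>u. u \<in> carrier H \<Longrightarrow> word_length H K u = len u"
    and len_add: "\<And>u. u \<in> carrier H \<Longrightarrow> u \<circ> w \<in> invols \<Longrightarrow> len (u \<circ> w) = len u + len w"
    and exc_le: "\<And>u. u \<in> carrier H \<Longrightarrow> u \<circ> w \<in> invols \<Longrightarrow> exc w \<le> exc (u \<circ> w)"
    and desc: "\<And>u. u \<in> carrier H \<Longrightarrow> u \<noteq> id \<Longrightarrow> \<exists>r\<in>R. u (r + 1) < u r"
  shows "twisted_involutions H (\<lambda>x. w \<circ> x \<circ> w) = {u \<in> carrier H. u \<circ> w \<in> invols}" (is "?TI = ?T")
    and "u \<in> carrier H \<Longrightarrow> u \<circ> w \<in> invols \<Longrightarrow>
      twisted_abs_length H K (\<lambda>x. w \<circ> x \<circ> w) u = exc (u \<circ> w) - exc w"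
proof -
  interpret group H by (rule H(1))
  note ww = invols_invol[OF w]
  have inAS: "u \<in> AS" if "u \<in> carrier H" for u using that H(4) by auto
  have mult: "u \<circ> v \<in> carrier H" if "u \<in> carrier H" "v \<in> carrier H" for u v
    using m_closed[OF that] H(2) by simp
  show TI: "?TI = ?T"
  proof (intro Set.set_eqI iffI)
    fix u assume "u \<in> ?TI"
    then have u: "u \<in> carrier H" "inv\<^bsub>H\<^esub> u = w \<circ> u \<circ> w" by (auto simp: twisted_involutions_def)
    have "u \<circ> inv\<^bsub>H\<^esub> u = id" using r_inv[OF u(1)] H by simp
    then have "u (w (u (w i))) = i" for i unfolding u(2) by (metis comp_apply id_apply)
    then have "u \<circ> w \<in> invols" using inAS[OF u(1)] w by (intro involsI) simp_all
    then show "u \<in> ?T" using u by simp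
  next
    fix u assume "u \<in> ?T"
    then have u: "u \<in> carrier H" "u \<circ> w \<in> invols" by auto
    have "u (w (u (w i))) = i" for i using invols_invol[OF u(2), of i] by simp
    moreover have "u ((inv\<^bsub>H\<^esub> u) i) = i" for i
      using r_inv[OF u(1)] H by (metis comp_apply id_apply)
    ultimately have "u ((inv\<^bsub>H\<^esub> u) i) = u (w (u (w i)))" for i by simp
    then have "(inv\<^bsub>H\<^esub> u) i = w (u (w i))" for i using AS_inj[OF inAS[OF u(1)]] by simp
    then have "inv\<^bsub>H\<^esub> u = w \<circ> u \<circ> w" by (simp add: fun_eq_iff)
    then show "u \<in> ?TI" using u by (simp add: twisted_involutions_def)
  qed
  let ?d = "\<lambda>x. w \<circ> x \<circ> w"
  define f0 where "f0 = restrict (\<lambda>u. exc (u \<circ> w) - exc w) ?T"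
  have right: "(u \<circ> s) \<circ> w = (u \<circ> w) \<circ> ?d s" for u s by (simp add: fun_eq_iff ww)
  have conj: "(s \<circ> u \<circ> ?d s) \<circ> w = s \<circ> (u \<circ> w) \<circ> s" for u s by (simp add: fun_eq_iff ww)
  have dd: "?d (?d s) = s" for s by (simp add: fun_eq_iff ww)
  have Ks: "\<exists>r\<in>R. s = adj_swap r" "n \<ge> 2" "s \<in> carrier H" "?d s \<in> carrier H" if "s \<in> K" for s
    using that K R by auto
  have conjT: "s \<circ> u \<circ> ?d s \<in> ?T" if s: "s \<in> K" and u: "u \<in> ?T" for s u
  proof -
    obtain r where r: "s = adj_swap r" using Ks[OF s] by blast
    have "s \<circ> (u \<circ> w) \<circ> s \<in> invols" unfolding r using conj_invols[OF Ks(2)[OF s]] u by simp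
    moreover have "s \<circ> u \<circ> ?d s \<in> carrier H" using mult[OF mult[OF Ks(3)[OF s]] Ks(4)[OF s]] u by simp
    ultimately show ?thesis unfolding mem_Collect_eq conj by blast
  qed
  have f0: "is_twisted_abs_length H K ?d f0"
    unfolding is_twisted_abs_length_def TI H(2,3)
  proof (intro conjI ballI impI)
    show "f0 \<in> extensional ?T" by (simp add: f0_def)
    show "f0 id = 0" using one_closed H(3) w by (simp add: f0_def)
    fix s u assume s: "s \<in> K" and u: "u \<in> ?T"
    obtain r where r: "s = adj_swap r" using Ks[OF s] by blast
    have "f0 (s \<circ> u \<circ> ?d s) = exc (s \<circ> (u \<circ> w) \<circ> s) - exc w"
      using conjT[OF s u] unfolding f0_def restrict_apply conj by (simp only: if_True)
    also have "exc (s \<circ> (u \<circ> w) \<circ> s) = exc (u \<circ> w)"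
      unfolding r using exc_conj[OF Ks(2)[OF s]] u by simp
    also have "exc (u \<circ> w) - exc w = f0 u" using u by (simp add: f0_def)
    finally show "f0 (s \<circ> u \<circ> ?d s) = f0 u" .
    show "int (f0 (u \<circ> s)) - int (f0 u) = int (word_length H K (u \<circ> s)) - int (word_length H K u)" if us: "u \<circ> s \<in> ?T"
    proof -
      obtain r' where r': "?d s = adj_swap r'" using K(3)[OF s] K(1) by blast
      have z: "u \<circ> w \<in> invols" "(u \<circ> w) \<circ> adj_swap r' \<in> invols"
        using u us right[of u s] unfolding r' by auto
      have C: "u \<in> carrier H" "u \<circ> s \<in> carrier H" using u us by auto
      have e: "int (exc ((u \<circ> s) \<circ> w)) - int (exc (u \<circ> w)) = int (len ((u \<circ> s) \<circ> w)) - int (len (u \<circ> w))"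
        unfolding right[of u s] r' by (rule exc_swap[OF Ks(2)[OF s] z])
      have "f0 (u \<circ> s) = exc ((u \<circ> s) \<circ> w) - exc w" "f0 u = exc (u \<circ> w) - exc w"
        using u us unfolding f0_def restrict_apply by (simp_all only: if_True)
      moreover have "exc w \<le> exc (u \<circ> w)" "exc w \<le> exc ((u \<circ> s) \<circ> w)"
        using exc_le[OF C(1) z(1)] exc_le[OF C(2)] us by auto
      moreover have "len (u \<circ> w) = len u + len w" "len ((u \<circ> s) \<circ> w) = len (u \<circ> s) + len w"
        using len_add[OF C(1) z(1)] len_add[OF C(2)] us by auto
      ultimately show ?thesis unfolding wl[OF C(1)] wl[OF C(2)] using e by linarith
    qed
  qed
  \<comment> \<open>Induction on the length. A descent \<open>s\<close> of \<open>u\<close> is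
    removed by rule (c) if \<open>u \<circ> s\<close> is again a twisted involution. If it is not,
    twisted conjugation by \<open>s' = w \<circ> s \<circ> w\<close> keeps the value by rule (b) and
    shortens \<open>u\<close>.\<close>
  have unique: "f u = g u" if f: "is_twisted_abs_length H K ?d f" and g: "is_twisted_abs_length H K ?d g" and u: "u \<in> ?T" for f g u
    using u
  proof (induction "len u" arbitrary: u rule: less_induct)
    case less
    note F = f[unfolded is_twisted_abs_length_def TI H(2,3)] and G = g[unfolded is_twisted_abs_length_def TI H(2,3)]
    show ?case
    proof (cases "u = id")
      case True
      then show ?thesis using F G by simp
    next
      case False
      have uC: "u \<in> carrier H" "u \<circ> w \<in> invols" using less.prems by auto
      obtain r where r: "r \<in> R" "u (r + 1) < u r" using desc[OF uC(1) False] by blast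
      define s where "s = adj_swap r"
      have s: "s \<in> K" using r K(1) by (simp add: s_def)
      note n2 = Ks(2)[OF s]
      have lus: "len u = len (u \<circ> s) + 1"
        unfolding s_def by (rule len_adj_swap_descent[OF n2 inAS[OF uC(1)] r(2)])
      show ?thesis
      proof (cases "u \<circ> s \<in> ?T")
        case True
        have "f (u \<circ> s) = g (u \<circ> s)" by (rule less.hyps) (use lus True in auto)
        moreover have "int (f (u \<circ> s)) - int (f u) = int (word_length H K (u \<circ> s)) - int (word_length H K u)"
          using F s less.prems True by blast
        moreover have "int (g (u \<circ> s)) - int (g u) = int (word_length H K (u \<circ> s)) - int (word_length H K u)"
          using G s less.prems True by blast
        ultimately show ?thesis by linarith
      next
        case nT: False
        define s' where "s' = ?d s"
        have s': "s' \<in> K" using K(3)[OF s] by (simp add: s'_def)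
        obtain r' where r': "s' = adj_swap r'" using s' K(1) by blast
        define z where "z = u \<circ> w"
        have z: "z \<in> invols" using uC by (simp add: z_def)
        have nz: "z \<circ> adj_swap r' \<notin> invols"
        proof
          assume "z \<circ> adj_swap r' \<in> invols"
          then have "(u \<circ> s) \<circ> w \<in> invols" unfolding right[of u s] z_def r'[symmetric] s'_def .
          moreover have "u \<circ> s \<in> carrier H" using uC Ks(3)[OF s] by (intro mult) auto
          ultimately show False using nT by simp
        qed
        define u' where "u' = s' \<circ> u \<circ> ?d s'"
        have u': "u' \<in> ?T" unfolding u'_def by (rule conjT[OF s' less.prems])
        have u'w: "u' \<circ> w = adj_swap r' \<circ> z \<circ> adj_swap r'" unfolding u'_def conj z_def r' ..
        have "len (u' \<circ> w) = len u' + len w" by (rule len_add) (use u' in auto)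
        then have l1: "len (adj_swap r' \<circ> z \<circ> adj_swap r') = len u' + len w" unfolding u'w .
        have l2: "len z = len u + len w" unfolding z_def by (rule len_add[OF uC])
        have u'2: "u' = s' \<circ> (u \<circ> s)" unfolding u'_def s'_def dd by (simp add: o_assoc)
        \<comment> \<open>In \<open>u' = s' \<circ> (u \<circ> s)\<close> the descent takes off 1,
          and the left factor, treated through the inverse \<open>x\<close>, adds at most 1. As
          conjugation changes the length of \<open>z\<close> by exactly 2, the change must be a
          decrease.\<close>
        have le: "len u' \<le> len u"
        proof -
          define x where "x = inv_into UNIV (u \<circ> s)"
          have usA: "u \<circ> s \<in> AS" using inAS[OF uC(1)] inAS[OF Ks(3)[OF s]] by simp
          have xA: "x \<in> AS" unfolding x_def by (rule inv_AS[OF usA])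
          have s'A: "s' \<in> AS" using inAS[OF Ks(3)[OF s']] .
          have x: "(u \<circ> s) (x i) = i" "x ((u \<circ> s) i) = i" for i
            unfolding x_def using AS_bij[OF usA] by (simp_all add: bij_def surj_f_inv_f inv_f_f del: comp_apply)
          have s's': "s' (s' i) = i" for i unfolding r' using n2 by simp
          have "(s' \<circ> (u \<circ> s)) \<circ> (x \<circ> s') = id" using x(1) s's' by (simp add: fun_eq_iff)
          then have "len u' = len (x \<circ> s')" unfolding u'2 using usA xA s'A by (intro len_inverse) auto
          also have "\<dots> \<le> len x + 1"
          proof -
            have "x r' \<noteq> x (r' + 1)" using AS_inj[OF xA, of r' "r' + 1"] by simp
            then consider "x r' < x (r' + 1)" | "x (r' + 1) < x r'" by linarith
            then show ?thesis unfolding r'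
              using len_adj_swap[OF n2 xA] len_adj_swap_descent[OF n2 xA] by cases fastforce+
          qed
          also have "len x = len (u \<circ> s)"
          proof (rule len_inverse[OF xA usA])
            show "x \<circ> (u \<circ> s) = id" using x(2) by (simp add: fun_eq_iff)
          qed
          finally show ?thesis using lus by simp
        qed
        have "len u' < len u"
        proof -
          have "z r' \<noteq> z (r' + 1)" using AS_inj[OF invols_AS[OF z], of r' "r' + 1"] by simp
          then consider "z r' < z (r' + 1)" | "z (r' + 1) < z r'" by linarith
          then show ?thesis
          proof cases
            case 1
            then show ?thesis using len_conj[OF n2 z 1 nz] l1 l2 le by linarith
          next
            case 2
            then show ?thesis using len_conj_desc[OF n2 z 2 nz] l1 l2 by linarith
          qed
        qed
        then have "f u' = g u'" using u' by (rule less.hyps)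
        moreover have "f u' = f u" unfolding u'_def using F s' less.prems by blast
        moreover have "g u' = g u" unfolding u'_def using G s' less.prems by blast
        ultimately show ?thesis by simp
      qed
    qed
  qed
  have "twisted_abs_length H K ?d = f0"
    unfolding twisted_abs_length_def
  proof (rule the_equality)
    show "is_twisted_abs_length H K ?d f0" by (rule f0)
    fix f assume f: "is_twisted_abs_length H K ?d f"
    have "f \<in> extensional ?T" "f0 \<in> extensional ?T"
      using f f0 unfolding is_twisted_abs_length_def TI by blast+
    then show "f = f0" by (rule extensionalityI) (rule unique[OF f f0])
  qed
  then show "u \<in> carrier H \<Longrightarrow> u \<circ> w \<in> invols \<Longrightarrow> twisted_abs_length H K ?d u = exc (u \<circ> w) - exc w"
    by (simp add: f0_def)
qed

section \<open>Parabolic subgroups as stabilizers of levels\<close>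

definition level_group :: "(int \<Rightarrow> int) \<Rightarrow> (int \<Rightarrow> int) set" where
  "level_group a = {u \<in> AS. \<forall>i\<in>window. u i \<in> window \<and> a (u i) = a i}"

definition level_index :: "(int \<Rightarrow> int) \<Rightarrow> int set" where
  "level_index a = {i. 1 \<le> i \<and> i < int n \<and> a i = a (i + 1)}"

lemma level_index_n2: "r \<in> level_index a \<Longrightarrow> n \<ge> 2"
  by (auto simp: level_index_def)

lemma level_index_window: "r \<in> level_index a \<Longrightarrow> r \<in> window \<and> r + 1 \<in> window \<and> a r = a (r + 1)"
  by (auto simp: level_index_def window_def)

lemma adj_swap_window:
  assumes "r \<in> window" "r + 1 \<in> window" "j \<in> window"
  shows "adj_swap r j = (if j = r then r + 1 else if j = r + 1 then r else j)"
  using assms by (auto simp: adj_swap_def)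

lemma level_group_swap:
  assumes "u \<in> level_group a" "r \<in> level_index a"
  shows "u \<circ> adj_swap r \<in> level_group a"
proof -
  have w: "r \<in> window" "r + 1 \<in> window" "a r = a (r + 1)" using level_index_window[OF assms(2)] by auto
  have u: "u i \<in> window" "a (u i) = a i" if "i \<in> window" for i
    using assms(1) that by (auto simp: level_group_def)
  have "u \<in> AS" using assms(1) unfolding level_group_def by blast
  then have "u \<circ> adj_swap r \<in> AS" using level_index_n2[OF assms(2)] by simp
  moreover have "u (adj_swap r j) \<in> window \<and> a (u (adj_swap r j)) = a j" if "j \<in> window" for j
    using adj_swap_window[OF w(1,2) that] u w that by simp
  ultimately show ?thesis unfolding level_group_def by simp
qed

text \<open>The index 0 is no descent, since \<open>u\<close> preserves the window and so
  \<open>u 0 = u n - n \<le> 0 < u 1\<close>. At any other descent, monotonicity of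
  \<open>a\<close>, applied once to the arguments and once to their images, forces the two levels to
  be equal.\<close>

lemma level_group_descent:
  assumes mono: "mono_on window a" and u: "u \<in> level_group a" "u \<noteq> id"
  shows "\<exists>r\<in>level_index a. u (r + 1) < u r"
proof -
  have uA: "u \<in> AS" using u(1) unfolding level_group_def by blast
  have uw: "u i \<in> window" "a (u i) = a i" if "i \<in> window" for i
    using u(1) that by (auto simp: level_group_def)
  obtain c where c: "c < n" "u (int c + 1) < u (int c)" using exists_descent[OF uA u(2)] by blast
  have "c \<noteq> 0"
  proof
    assume "c = 0"
    then have "u 1 < u 0" using c by simp
    moreover have "u (0 + int n * 1) = u 0 + int n * 1" using periodic_mult[of u 0 1] uA by simp
    then have "u (int n) = u 0 + int n" by simp
    moreover have "u (int n) \<le> int n" "u 1 \<ge> 1"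
      using uw(1)[of "int n"] uw(1)[of 1] n_pos by (auto simp: window_def)
    ultimately show False by simp
  qed
  then have w: "int c \<in> window" "int c + 1 \<in> window" using c by (auto simp: window_def)
  have "a (u (int c + 1)) \<le> a (u (int c))"
    using mono_onD[OF mono uw(1)[OF w(2)] uw(1)[OF w(1)]] c by simp
  then have "a (int c + 1) \<le> a (int c)" using uw(2) w by simp
  moreover have "a (int c) \<le> a (int c + 1)" using mono_onD[OF mono w] by simp
  ultimately have "int c \<in> level_index a" using w by (auto simp: level_index_def window_def)
  then show ?thesis using c by blast
qed

lemma id_level_group [simp]: "id \<in> level_group a" by (simp add: level_group_def)

lemma level_group_AS: "level_group a \<subseteq> AS" unfolding level_group_def by blast

lemma len_swap_le:
  assumes "n \<ge> 2" "w \<in> AS"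
  shows "len (w \<circ> adj_swap r) \<le> len w + 1"
proof -
  have "w r \<noteq> w (r + 1)" using AS_inj[OF assms(2), of r "r + 1"] by simp
  then consider "w r < w (r + 1)" | "w (r + 1) < w r" by linarith
  then show ?thesis
    using len_adj_swap[OF assms] len_adj_swap_descent[OF assms] by cases fastforce+
qed

text \<open>For sorted levels every element other than the identity has a descent among the chosen
  generators, so \<open>len\<close> meets the criterion \<open>word_length_eqI\<close> and the
  parabolic length is the ambient one.\<close>

lemma level_subgroup:
  assumes mono: "mono_on window a"
  shows "carrier (subgroup_generated (affine_sym n) (adj_swap ` level_index a)) = level_group a"
    and "u \<in> level_group a \<Longrightarrow> word_length (affine_sym n) (adj_swap ` level_index a) u = len u"
proof -
  let ?S = "adj_swap ` level_index a"
  have 1: "?S \<subseteq> AS" using level_index_n2 by auto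
  have 2: "s \<otimes>\<^bsub>affine_sym n\<^esub> s = \<one>\<^bsub>affine_sym n\<^esub>" if "s \<in> ?S" for s
    using that level_index_n2 by auto
  have 3: "w \<otimes>\<^bsub>affine_sym n\<^esub> s \<in> level_group a" if "w \<in> level_group a" "s \<in> ?S" for w s
    using that level_group_swap by auto
  have 4: "len (w \<otimes>\<^bsub>affine_sym n\<^esub> s) \<le> len w + 1" if w: "w \<in> level_group a" and s: "s \<in> ?S" for w s
  proof -
    obtain r where r: "r \<in> level_index a" "s = adj_swap r" using s by blast
    have "w \<in> AS" using w level_group_AS by blast
    then show ?thesis using len_swap_le[OF level_index_n2[OF r(1)]] r by simp
  qed
  have 5: "\<exists>s\<in>?S. len (w \<otimes>\<^bsub>affine_sym n\<^esub> s) < len w" if w: "w \<in> level_group a" "w \<noteq> \<one>\<^bsub>affine_sym n\<^esub>" for w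
  proof -
    obtain r where r: "r \<in> level_index a" "w (r + 1) < w r" using level_group_descent[OF mono w(1)] w(2) by auto
    have "len w = len (w \<circ> adj_swap r) + 1"
      using w(1) level_group_AS by (intro len_adj_swap_descent[OF level_index_n2[OF r(1)] _ r(2)]) auto
    then show ?thesis using r by auto
  qed
  note * = word_length_eqI[of "affine_sym n" ?S "level_group a" len, OF group_AS 1 2 level_group_AS _ 3 _ 4 5, simplified]
  show "carrier (subgroup_generated (affine_sym n) ?S) = level_group a" using * by blast
  show "u \<in> level_group a \<Longrightarrow> word_length (affine_sym n) ?S u = len u" using * by blast
qed

lemma affine_word_length:
  assumes "u \<in> AS"
  shows "word_length (affine_sym n) (affine_gens n) u = len u"
proof -
  have gens: "affine_gens n = (if n \<ge> 2 then adj_swap ` int ` {0..<n} else {})"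
    by (auto simp: affine_gens_def affine_gen_eq)
  let ?S = "affine_gens n"
  have sS: "\<exists>c. s = adj_swap c" "n \<ge> 2" if "s \<in> ?S" for s using that unfolding gens by (auto split: if_splits)
  have 1: "?S \<subseteq> AS" using sS by fastforce
  have 2: "s \<otimes>\<^bsub>affine_sym n\<^esub> s = \<one>\<^bsub>affine_sym n\<^esub>" if "s \<in> ?S" for s
    using sS[OF that] by auto
  have 3: "w \<otimes>\<^bsub>affine_sym n\<^esub> s \<in> AS" if "w \<in> AS" "s \<in> ?S" for w s
    using that 1 by auto
  have 4: "len (w \<otimes>\<^bsub>affine_sym n\<^esub> s) \<le> len w + 1" if "w \<in> AS" "s \<in> ?S" for w s
    using len_swap_le[OF sS(2)[OF that(2)] that(1)] sS(1)[OF that(2)] by auto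
  have 5: "\<exists>s\<in>?S. len (w \<otimes>\<^bsub>affine_sym n\<^esub> s) < len w" if w: "w \<in> AS" "w \<noteq> \<one>\<^bsub>affine_sym n\<^esub>" for w
  proof -
    obtain c where r: "n \<ge> 2" "c < n" "w (int c + 1) < w (int c)" using exists_descent[OF w(1)] w(2) by auto
    have "len w = len (w \<circ> adj_swap (int c)) + 1" by (rule len_adj_swap_descent[OF r(1) w(1) r(3)])
    moreover have "adj_swap (int c) \<in> ?S" unfolding gens using r by auto
    ultimately show ?thesis by (intro bexI[of _ "adj_swap (int c)"]) auto
  qed
  show ?thesis
    using word_length_eqI(1)[of "affine_sym n" ?S AS len, OF group_AS 1 2 order_refl _ 3 _ 4 5 assms] by simp
qed

end

subsection \<open>Windows of affine involutions\<close>

context affine begin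

definition unwind :: "(int \<Rightarrow> int) \<Rightarrow> int \<Rightarrow> int" where
  "unwind f j = f (res j) + int n * quo j"

lemma unwind_window [simp]: "i \<in> window \<Longrightarrow> unwind f i = f i"
  by (simp add: unwind_def)

lemma periodic_unwind [simp]: "periodic (unwind f)"
  unfolding periodic_def using res_shift[of _ 1] quo_shift[of _ 1] by (simp add: unwind_def algebra_simps)

lemma unwind_AS:
  assumes b: "bij_betw (\<lambda>i. res (f i)) window window" and q: "(\<Sum>i\<in>window. quo (f i)) = 0"
  shows "unwind f \<in> AS"
  unfolding AS_iff
proof (intro conjI)
  show "bij (unwind f)"
  proof (rule bijI)
    show "inj (unwind f)"
    proof (rule injI)
      fix i j assume e: "unwind f i = unwind f j"
      have "res (f (res i)) = res (unwind f i)" for i by (simp add: unwind_def)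
      then have "res (f (res i)) = res (f (res j))" using e by simp
      then have r: "res i = res j"
        using inj_onD[OF bij_betw_imp_inj_on[OF b], of "res i" "res j"] by simp
      then have "int n * quo i = int n * quo j" using e by (simp add: unwind_def)
      then show "i = j" using r res_quo[of i] res_quo[of j] by linarith
    qed
    show "surj (unwind f)"
      unfolding surj_def
    proof
      fix y
      have "res y \<in> (\<lambda>i. res (f i)) ` window" using bij_betw_imp_surj_on[OF b] by simp
      then obtain r where r: "r \<in> window" "res (f r) = res y" by auto
      have "unwind f (r + int n * k) = f r + int n * k" for k
        using r(1) by (simp add: unwind_def)
      from this[of "quo y - quo (f r)"]
      have "unwind f (r + int n * (quo y - quo (f r))) = f r + int n * quo y - int n * quo (f r)"
        by (simp add: right_diff_distrib)
      then have "y = unwind f (r + int n * (quo y - quo (f r)))"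
        using r(2) res_quo[of y] res_quo[of "f r"] by linarith
      then show "\<exists>x. y = unwind f x" ..
    qed
  qed
  show "(\<Sum>i\<in>window. quo (unwind f i)) = 0" using q by simp
qed simp

lemma level_group_bij:
  "bij_betw (\<lambda>u. restrict u window) (level_group a) (level_maps window a window a)"
proof (rule bij_betw_byWitness[where f' = unwind])
  show "\<forall>u\<in>level_group a. unwind (restrict u window) = u"
  proof
    fix u assume "u \<in> level_group a"
    then have "u \<in> AS" using level_group_AS by blast
    then show "unwind (restrict u window) = u" by (intro periodic_eqI) auto
  qed
  show "\<forall>\<sigma>\<in>level_maps window a window a. restrict (unwind \<sigma>) window = \<sigma>"
    by (auto simp: level_maps_def fun_eq_iff extensional_def)
  show "(\<lambda>u. restrict u window) ` level_group a \<subseteq> level_maps window a window a"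
  proof (rule image_subsetI)
    fix u assume u: "u \<in> level_group a"
    then have uA: "u \<in> AS" using level_group_AS by blast
    have uw: "u i \<in> window" "a (u i) = a i" if "i \<in> window" for i
      using u that by (auto simp: level_group_def)
    have "inj_on u window" using AS_inj[OF uA] by (auto simp: inj_on_def)
    then have "bij_betw u window window"
      unfolding bij_betw_def using endo_inj_surj[OF finite_window, of u] uw(1) by blast
    then have "bij_betw (restrict u window) window window" by simp
    then show "restrict u window \<in> level_maps window a window a" using uw by (simp add: level_maps_def)
  qed
  show "unwind ` level_maps window a window a \<subseteq> level_group a"
  proof (rule image_subsetI)
    fix \<sigma> assume "\<sigma> \<in> level_maps window a window a"
    then have \<sigma>: "bij_betw \<sigma> window window" "\<And>i. i \<in> window \<Longrightarrow> a (\<sigma> i) = a i" by (auto simp: level_maps_def)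
    have w: "\<sigma> i \<in> window" if "i \<in> window" for i using \<sigma>(1) that by (auto simp: bij_betw_def)
    have "bij_betw (\<lambda>i. res (\<sigma> i)) window window"
      using \<sigma>(1) w by (subst bij_betw_cong[of window _ \<sigma>]) auto
    then have "unwind \<sigma> \<in> AS" by (rule unwind_AS) (simp add: w)
    then show "unwind \<sigma> \<in> level_group a" using w \<sigma>(2) unfolding level_group_def by simp
  qed
qed

lemma finite_level_group: "finite (level_group a)"
  using bij_betw_finite[OF level_group_bij[of a]] finite_level_maps[of window window a a] by simp

lemma level_invs_cong:
  "(\<And>i. i \<in> A \<Longrightarrow> \<sigma> i = \<tau> i) \<Longrightarrow> level_invs A f \<sigma> = level_invs A f \<tau>"
  unfolding level_invs_def by (intro arg_cong[of _ _ card]) auto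

text \<open>On permutations of the window the floors are -1 at inversions and 0 elsewhere; for
  sorted levels, every inversion of a level preserving map lies within a level.\<close>

lemma len_level_group:
  assumes mono: "mono_on window a" and u: "u \<in> level_group a"
  shows "len u = level_invs window a u"
proof -
  have uw: "u i \<in> window" "a (u i) = a i" if "i \<in> window" for i
    using u that by (auto simp: level_group_def)
  have "(\<Sum>(i, j)\<in>{(i, j). i \<in> window \<and> j \<in> window \<and> i < j}. \<bar>(u j - u i) div int n\<bar>)
    = (\<Sum>(i, j)\<in>{(i, j). i \<in> window \<and> j \<in> window \<and> i < j}. if u j < u i then 1 else 0)"
    by (rule sum.cong[OF refl]) (use uw window_div in auto)
  also have "\<dots> = (\<Sum>x\<in>{x \<in> {(i, j). i \<in> window \<and> j \<in> window \<and> i < j}. u (snd x) < u (fst x)}. 1)"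
    by (subst sum.inter_filter) (auto simp: split_beta intro!: sum.cong)
  also have "{x \<in> {(i, j). i \<in> window \<and> j \<in> window \<and> i < j}. u (snd x) < u (fst x)}
    = {(i, j). i \<in> window \<and> j \<in> window \<and> i < j \<and> a i = a j \<and> u j < u i}"
  proof -
    have "a i = a j" if "i \<in> window" "j \<in> window" "i < j" "u j < u i" for i j
    proof -
      have "a i \<le> a j" using mono_onD[OF mono that(1,2)] that(3) by simp
      moreover have "a (u j) \<le> a (u i)" using mono_onD[OF mono uw(1)[OF that(2)] uw(1)[OF that(1)]] that(4) by simp
      ultimately show ?thesis using uw(2) that by simp
    qed
    then show ?thesis by auto
  qed
  finally show ?thesis unfolding len_def level_invs_def by simp
qed

text \<open>At an indeterminate \<open>p\<close> this is the Poincare polynomial of the Young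
  subgroup whose blocks are the levels.\<close>

lemma sum_level_group:
  assumes mono: "mono_on window a" and V: "finite V" "a ` window \<subseteq> V"
  shows "(\<Sum>u\<in>level_group a. p ^ len u) = (\<Prod>v\<in>V. q_factorial p (fiber_card window a v))"
proof -
  have "(\<Sum>u\<in>level_group a. p ^ len u) = (\<Sum>u\<in>level_group a. p ^ level_invs window a (restrict u window))"
    by (rule sum.cong[OF refl]) (simp add: len_level_group[OF mono] level_invs_cong[of window "restrict _ window"])
  also have "\<dots> = (\<Sum>\<sigma>\<in>level_maps window a window a. p ^ level_invs window a \<sigma>)"
    by (rule sum.reindex_bij_betw[OF level_group_bij])
  also have "\<dots> = (\<Prod>v\<in>V. q_factorial p (fiber_card window a v))"
    by (rule sum_level_maps) (use V in auto)
  finally show ?thesis .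
qed

section \<open>Involutions encoded by levels and a permutation\<close>

definition wind :: "(int \<Rightarrow> int) \<Rightarrow> int \<Rightarrow> int" where "wind z = restrict (\<lambda>i. quo (z i)) window"

definition perm :: "(int \<Rightarrow> int) \<Rightarrow> int \<Rightarrow> int" where "perm z = restrict (\<lambda>i. res (z i)) window"

definition build :: "(int \<Rightarrow> int) \<Rightarrow> (int \<Rightarrow> int) \<Rightarrow> int \<Rightarrow> int" where
  "build a \<sigma> = unwind (\<lambda>i. \<sigma> i + int n * a i)"

lemma perm_wind: "i \<in> window \<Longrightarrow> z i = perm z i + int n * wind z i"
  using res_quo[of "z i"] by (simp add: perm_def wind_def)

lemma perm_window [simp]: "i \<in> window \<Longrightarrow> perm z i \<in> window"
  by (simp add: perm_def)

lemma perm_wind_unique: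
  assumes "i \<in> window" "z i = r + int n * k" "r \<in> window"
  shows "perm z i = r" "wind z i = k"
  using res_unique[OF assms(3), of k] assms by (simp_all add: perm_def wind_def)

lemma perm_invol_maps:
  assumes z: "z \<in> invols"
  shows "perm z \<in> invol_maps window (wind z)"
proof -
  have "perm z (perm z i) = i \<and> wind z (perm z i) = - wind z i" if i: "i \<in> window" for i
  proof -
    have "z (z i) = z (perm z i) + int n * wind z i"
      using perm_wind[OF i, of z] periodic_mult[of z "perm z i" "wind z i"] z by simp
    then have "z (perm z i) = i + int n * (- wind z i)" using invols_invol[OF z, of i] by simp
    then show ?thesis using perm_wind_unique[of "perm z i" z i "- wind z i"] i by simp
  qed
  then show ?thesis by (auto simp: invol_maps_def perm_def)
qed

lemma build_invols:
  assumes \<sigma>: "\<sigma> \<in> invol_maps window a"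
  shows "build a \<sigma> \<in> invols" and "a \<in> extensional window \<Longrightarrow> wind (build a \<sigma>) = a" and "perm (build a \<sigma>) = \<sigma>"
proof -
  have s: "\<sigma> i \<in> window" "\<sigma> (\<sigma> i) = i" "a (\<sigma> i) = - a i" if "i \<in> window" for i
    using \<sigma> that by (auto simp: invol_maps_def)
  have bi: "build a \<sigma> i = \<sigma> i + int n * a i" if "i \<in> window" for i
    using that by (simp add: build_def)
  have rq: "res (\<sigma> i + int n * a i) = \<sigma> i" "quo (\<sigma> i + int n * a i) = a i" if "i \<in> window" for i
    using res_unique[OF s(1)[OF that]] by simp_all
  have "sum a window = (\<Sum>i\<in>window. a (\<sigma> i))"
    using sum.reindex_bij_betw[OF invol_maps_bij[OF \<sigma>], of a] by simp
  also have "\<dots> = - sum a window" using s(3) by (simp add: sum_negf)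
  finally have "sum a window = 0" by simp
  moreover have "bij_betw (\<lambda>i. res (\<sigma> i + int n * a i)) window window"
    using invol_maps_bij[OF \<sigma>] rq by (subst bij_betw_cong[of window _ \<sigma>]) auto
  ultimately have A: "build a \<sigma> \<in> AS"
    unfolding build_def by (intro unwind_AS) (simp_all add: s(1))
  have P: "build a \<sigma> (build a \<sigma> i) = i" if "i \<in> window" for i
    using bi[OF that] bi[OF s(1)[OF that]] s[OF that] periodic_mult[OF AS_periodic[OF A], of "\<sigma> i" "a i"] by simp
  have "build a \<sigma> \<circ> build a \<sigma> = id"
    by (rule periodic_eqI) (use A P in \<open>auto intro: periodic_comp\<close>)
  then show "build a \<sigma> \<in> invols" using A unfolding invols_def by simp
  show "wind (build a \<sigma>) = a" if "a \<in> extensional window"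
    using that bi rq by (auto simp: wind_def fun_eq_iff extensional_def)
  show "perm (build a \<sigma>) = \<sigma>"
    using \<sigma> bi rq by (auto simp: perm_def fun_eq_iff extensional_def invol_maps_def)
qed

lemma build_perm_wind:
  assumes z: "z \<in> invols"
  shows "build (wind z) (perm z) = z"
proof (rule periodic_eqI)
  show "build (wind z) (perm z) i = z i" if "i \<in> window" for i
    using perm_wind[OF that, of z] that by (simp add: build_def)
qed (use z in \<open>simp_all add: build_def\<close>)

lemma wind_bij:
  assumes "a \<in> extensional window"
  shows "bij_betw perm {z \<in> invols. wind z = a} (invol_maps window a)"
proof (rule bij_betw_byWitness[where f' = "build a"])
  show "\<forall>z\<in>{z \<in> invols. wind z = a}. build a (perm z) = z" using build_perm_wind by auto
  show "\<forall>\<sigma>\<in>invol_maps window a. perm (build a \<sigma>) = \<sigma>" using build_invols(3) by auto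
  show "perm ` {z \<in> invols. wind z = a} \<subseteq> invol_maps window a" using perm_invol_maps by auto
  show "build a ` invol_maps window a \<subseteq> {z \<in> invols. wind z = a}" using build_invols(1,2) assms by auto
qed

lemma wind_extensional [simp]: "wind z \<in> extensional window"
  by (simp add: wind_def)

text \<open>Two elements of the window differ by less than \<open>n\<close>, so the sign of
  \<open>z i - i\<close> is that of the quotient, and \<open>perm\<close> decides only when the
  quotient is 0.\<close>

lemma exc_invol:
  assumes z: "z \<in> invols"
  shows "exc z = two_cycles window (wind z) (perm z)"
proof -
  have "i < z i \<longleftrightarrow> wind z i > 0 \<or> wind z i = 0 \<and> perm z i > i" if i: "i \<in> window" for i
  proof -
    consider "wind z i \<ge> 1" | "wind z i = 0" | "wind z i \<le> -1" by linarith
    then show ?thesis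
    proof cases
      case 1
      then have "int n * wind z i \<ge> int n * 1" by (intro mult_left_mono) auto
      moreover have "perm z i \<ge> 1" "i \<le> int n" using perm_window[OF i, of z] i unfolding window_def by auto
      ultimately show ?thesis using perm_wind[OF i, of z] 1 by simp
    next
      case 2
      then show ?thesis using perm_wind[OF i, of z] by simp
    next
      case 3
      then have "int n * wind z i \<le> int n * (-1)" by (intro mult_left_mono) auto
      moreover have "perm z i \<le> int n" "i \<ge> 1" using perm_window[OF i, of z] i unfolding window_def by auto
      ultimately show ?thesis using perm_wind[OF i, of z] 3 by simp
    qed
  qed
  then show ?thesis unfolding exc_def two_cycles_def by (intro arg_cong[of _ _ card]) auto
qed

text \<open>The term \<open>D(a)\<close>: the sum runs over unordered pairs of distinct values,
  oriented by value, so the order of the positions does not matter.\<close>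

definition spread :: "(int \<Rightarrow> int) \<Rightarrow> nat" where
  "spread a = (\<Sum>(i, j)\<in>{(i, j). i \<in> window \<and> j \<in> window \<and> a i < a j}. nat (a j - a i - 1))"

lemma sum_indicator_card:
  assumes "finite S"
  shows "(\<Sum>x\<in>S. if P x then 1 else 0) = int (card {x \<in> S. P x})"
  using assms by (simp add: sum.inter_filter[symmetric] flip: sum.inter_filter)

text \<open>Orient each pair on distinct levels so that \<open>a\<close> increases. The absolute
  value then opens to \<open>a j - a i\<close>, plus 1 if \<open>j < i\<close>, minus 1 if
  \<open>\<sigma> j < \<sigma> i\<close>. Since \<open>\<sigma>\<close> negates \<open>a\<close>,
  the map \<open>(i, j) \<mapsto> (\<sigma> j, \<sigma> i)\<close> preserves the oriented pairs and
  turns the last count into that of the pairs with \<open>i < j\<close>, which is all pairs minus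
  the inversions. This is why the inversions of \<open>a\<close> count twice.\<close>

lemma len_invol:
  assumes z: "z \<in> invols"
  shows "len z = spread (wind z) + 2 * word_invs window (wind z) + level_invs window (wind z) (perm z)"
proof -
  define a where "a = wind z"
  define \<sigma> where "\<sigma> = perm z"
  have \<sigma>: "\<sigma> \<in> invol_maps window a" unfolding \<sigma>_def a_def by (rule perm_invol_maps[OF z])
  have s: "\<sigma> i \<in> window" "\<sigma> (\<sigma> i) = i" "a (\<sigma> i) = - a i" if "i \<in> window" for i
    using \<sigma> that by (auto simp: invol_maps_def)
  have inj: "\<sigma> i \<noteq> \<sigma> j" if "i \<in> window" "j \<in> window" "i \<noteq> j" for i j
    using s(2) that by metis
  define f where "f x = \<bar>a (snd x) - a (fst x) - (if \<sigma> (snd x) < \<sigma> (fst x) then 1 else 0)\<bar>" for x :: "int \<times> int"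
  define L where "L = {(i, j). i \<in> window \<and> j \<in> window \<and> i < j}"
  define T where "T = {(i, j). i \<in> window \<and> j \<in> window \<and> a i < a j}"
  define E where "E = {(i, j). i \<in> window \<and> j \<in> window \<and> i < j \<and> a i = a j}"
  define U where "U = {(i, j). i \<in> window \<and> j \<in> window \<and> i < j \<and> a i \<noteq> a j}"
  have fin: "finite L" "finite T" "finite E" "finite U" by (simp_all add: L_def T_def E_def U_def)
  have "(\<Sum>(i, j)\<in>L. \<bar>(z j - z i) div int n\<bar>) = sum f L"
  proof (rule sum.cong[OF refl])
    fix x assume "x \<in> L"
    then obtain i j where x: "x = (i, j)" "i \<in> window" "j \<in> window" by (auto simp: L_def)
    have "z j - z i = (\<sigma> j - \<sigma> i) + int n * (a j - a i)"
      using perm_wind[OF x(2), of z] perm_wind[OF x(3), of z] by (simp add: a_def \<sigma>_def algebra_simps)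
    moreover have "((\<sigma> j - \<sigma> i) + int n * (a j - a i)) div int n = (a j - a i) + (\<sigma> j - \<sigma> i) div int n"
      using n_pos by (intro div_mult_self2) simp
    ultimately show "(case x of (i, j) \<Rightarrow> \<bar>(z j - z i) div int n\<bar>) = f x"
      using window_div[OF s(1)[OF x(2)] s(1)[OF x(3)]] by (simp add: x f_def)
  qed
  also have LEU: "L = E \<union> U" by (auto simp: L_def E_def U_def)
  also have "sum f (E \<union> U) = sum f E + sum f U"
    using fin by (intro sum.union_disjoint) (auto simp: E_def U_def)
  also have "sum f E = int (level_invs window a \<sigma>)"
  proof -
    have "sum f E = (\<Sum>x\<in>E. if \<sigma> (snd x) < \<sigma> (fst x) then 1 else 0)"
      by (rule sum.cong[OF refl]) (auto simp: E_def f_def)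
    also have "\<dots> = int (card {x \<in> E. \<sigma> (snd x) < \<sigma> (fst x)})" by (rule sum_indicator_card[OF fin(3)])
    also have "{x \<in> E. \<sigma> (snd x) < \<sigma> (fst x)} = {(i, j). i \<in> window \<and> j \<in> window \<and> i < j \<and> a i = a j \<and> \<sigma> j < \<sigma> i}"
      by (auto simp: E_def)
    finally show ?thesis by (simp add: level_invs_def)
  qed
  also have "sum f U = (\<Sum>x\<in>T. (a (snd x) - a (fst x)) + (if snd x < fst x then 1 else 0) - (if \<sigma> (snd x) < \<sigma> (fst x) then 1 else 0))"
    (is "_ = sum ?g T")
  proof (rule sum.reindex_bij_witness[where j = "\<lambda>x. if a (fst x) < a (snd x) then x else (snd x, fst x)"
        and i = "\<lambda>x. if fst x < snd x then x else (snd x, fst x)"])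
    fix x assume "x \<in> U"
    then obtain i j where x: "x = (i, j)" "i \<in> window" "j \<in> window" "i < j" "a i \<noteq> a j" by (auto simp: U_def)
    show "(\<lambda>x. if fst x < snd x then x else (snd x, fst x)) ((\<lambda>x. if a (fst x) < a (snd x) then x else (snd x, fst x)) x) = x"
      using x by auto
    show "(\<lambda>x. if a (fst x) < a (snd x) then x else (snd x, fst x)) x \<in> T"
      using x by (auto simp: T_def)
    show "?g ((\<lambda>x. if a (fst x) < a (snd x) then x else (snd x, fst x)) x) = f x"
      using x inj[of i j] by (auto simp: f_def)
  next
    fix x assume "x \<in> T"
    then obtain i j where x: "x = (i, j)" "i \<in> window" "j \<in> window" "a i < a j" by (auto simp: T_def)
    then have "i \<noteq> j" by auto
    then show "(\<lambda>x. if a (fst x) < a (snd x) then x else (snd x, fst x)) ((\<lambda>x. if fst x < snd x then x else (snd x, fst x)) x) = x"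
      "(\<lambda>x. if fst x < snd x then x else (snd x, fst x)) x \<in> U"
      using x by (auto simp: U_def)
  qed
  also have "\<dots> = (\<Sum>x\<in>T. a (snd x) - a (fst x)) + (\<Sum>x\<in>T. if snd x < fst x then 1 else 0) - (\<Sum>x\<in>T. if \<sigma> (snd x) < \<sigma> (fst x) then 1 else 0)"
    by (simp only: sum.distrib sum_subtractf)
  also have "(\<Sum>x\<in>T. if \<sigma> (snd x) < \<sigma> (fst x) then 1 else (0::int)) = (\<Sum>x\<in>T. if fst x < snd x then 1 else 0)"
    by (rule sum.reindex_bij_witness[where i = "\<lambda>x. (\<sigma> (snd x), \<sigma> (fst x))" and j = "\<lambda>x. (\<sigma> (snd x), \<sigma> (fst x))"])
      (use s in \<open>auto simp: T_def\<close>)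
  also have "\<dots> = (\<Sum>x\<in>T. 1 - (if snd x < fst x then 1 else 0))"
    by (rule sum.cong[OF refl]) (auto simp: T_def)
  also have "\<dots> = (\<Sum>x\<in>T. 1) - (\<Sum>x\<in>T. if snd x < fst x then 1 else 0)"
    by (rule sum_subtractf)
  also have "(\<Sum>x\<in>T. if snd x < fst x then 1 else 0) = int (word_invs window a)"
  proof -
    have "(\<Sum>x\<in>T. if snd x < fst x then 1 else 0) = int (card {x \<in> T. snd x < fst x})" by (rule sum_indicator_card[OF fin(2)])
    also have "card {x \<in> T. snd x < fst x} = card {(i, j). i \<in> window \<and> j \<in> window \<and> i < j \<and> a j < a i}"
      by (rule bij_betw_same_card[of "\<lambda>x. (snd x, fst x)"], rule bij_betw_byWitness[where f' = "\<lambda>x. (snd x, fst x)"])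
        (auto simp: T_def)
    finally show ?thesis by (simp add: word_invs_def)
  qed
  finally have "(\<Sum>(i, j)\<in>L. \<bar>(z j - z i) div int n\<bar>)
    = int (level_invs window a \<sigma>) + ((\<Sum>x\<in>T. a (snd x) - a (fst x)) + int (word_invs window a) - ((\<Sum>x\<in>T. 1) - int (word_invs window a)))"
    by (simp only: LEU)
  moreover have "int (spread a) = (\<Sum>x\<in>T. a (snd x) - a (fst x)) - (\<Sum>x\<in>T. 1)"
    unfolding spread_def T_def[symmetric] of_nat_sum sum_subtractf[symmetric]
    by (rule sum.cong[OF refl]) (auto simp: T_def)
  ultimately have "(\<Sum>(i, j)\<in>L. \<bar>(z j - z i) div int n\<bar>) = int (spread a + 2 * word_invs window a + level_invs window a \<sigma>)"
    by simp
  then show ?thesis unfolding len_def L_def[symmetric] a_def[symmetric] \<sigma>_def[symmetric] by simp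
qed

end

subsection \<open>Minimal involutions of double cosets\<close>

context affine begin

lemma word_invs_eq_0_iff: "word_invs window a = 0 \<longleftrightarrow> mono_on window a"
proof -
  have "finite {(i, j). i \<in> window \<and> j \<in> window \<and> i < j \<and> a j < a i}" by simp
  then have "word_invs window a = 0 \<longleftrightarrow> (\<forall>i\<in>window. \<forall>j\<in>window. i < j \<longrightarrow> a i \<le> a j)"
    unfolding word_invs_def by (simp add: set_eq_iff) (meson not_less)
  also have "\<dots> \<longleftrightarrow> mono_on window a"
    unfolding mono_on_def by (metis order_le_less order_refl)
  finally show ?thesis .
qed

lemma level_invs_eq_0_iff:
  "level_invs window a \<sigma> = 0 \<longleftrightarrow> (\<forall>i\<in>window. \<forall>j\<in>window. i < j \<longrightarrow> a i = a j \<longrightarrow> \<sigma> i \<le> \<sigma> j)"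
proof -
  have "finite {(i, j). i \<in> window \<and> j \<in> window \<and> i < j \<and> a i = a j \<and> \<sigma> j < \<sigma> i}" by simp
  then show ?thesis
    unfolding level_invs_def by (simp add: set_eq_iff) (meson not_less)
qed

definition sorted_invols :: "(int \<Rightarrow> int) set" where
  "sorted_invols = {w \<in> invols. word_invs window (wind w) = 0 \<and> level_invs window (wind w) (perm w) = 0}"

lemma affine_J_eq: "affine_J n = adj_swap ` {1..<int n}"
proof -
  have "{1..<int n} = int ` {1..<n}" by (simp add: image_int_atLeastLessThan)
  then show ?thesis unfolding affine_J_def image_image[symmetric] by (simp add: affine_gen_eq image_image)
qed

text \<open>Constant levels make \<open>W\<^sub>J\<close> itself a level stabilizer, so both
  Poincare series come from the same lemma.\<close>

lemma affine_J_eq_level: "affine_J n = adj_swap ` level_index (\<lambda>_. 0)"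
  unfolding affine_J_eq level_index_def by (rule arg_cong[of _ _ "image adj_swap"]) auto

lemma step_less_window:
  assumes "\<And>r. r \<in> {1..<int n} \<Longrightarrow> w r < w (r + 1)" and "i \<in> window" "j \<in> window" "i < j"
  shows "(w i :: int) < w j"
proof -
  have "i + 1 \<le> j" using assms(4) by simp
  then have "j \<le> int n \<longrightarrow> w i < w j"
  proof (induction j rule: int_ge_induct)
    case base
    then show ?case using assms(1)[of i] assms(2) by (auto simp: window_def)
  next
    case (step j)
    then show ?case using assms(1)[of j] assms(2) by (auto simp: window_def)
  qed
  then show ?thesis using assms(3) by (simp add: window_def)
qed

lemma perm_inj:
  assumes "z \<in> invols" "i \<in> window" "j \<in> window" "i \<noteq> j"
  shows "perm z i \<noteq> perm z j"
  using perm_invol_maps[OF assms(1)] assms(2-) unfolding invol_maps_def by (metis (mono_tags, lifting) mem_Collect_eq)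

text \<open>Minimality means that \<open>w\<close> increases along the window, and its values
  \<open>perm w i + n * wind w i\<close> are compared by the quotient first and by the residue on
  equal quotients.\<close>

lemma min_coset_reps_iff:
  assumes w: "w \<in> invols"
  shows "w \<in> min_coset_reps (affine_sym n) (affine_gens n) (affine_J n) \<longleftrightarrow> w \<in> sorted_invols"
proof -
  have "w \<in> min_coset_reps (affine_sym n) (affine_gens n) (affine_J n)
     \<longleftrightarrow> (\<forall>r\<in>{1..<int n}. len w < len (w \<circ> adj_swap r))"
  proof -
    have "adj_swap r \<in> AS" if "r \<in> {1..<int n}" for r using that by (intro adj_swap_AS) auto
    then have "word_length (affine_sym n) (affine_gens n) (w \<circ> adj_swap r) = len (w \<circ> adj_swap r)" if "r \<in> {1..<int n}" for r
      using that w by (intro affine_word_length) auto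
    then show ?thesis using affine_word_length[of w] w
      by (auto simp: min_coset_reps_def affine_J_eq)
  qed
  also have "\<dots> \<longleftrightarrow> (\<forall>r\<in>{1..<int n}. w r < w (r + 1))"
  proof (rule ball_cong[OF refl])
    fix r assume "r \<in> {1..<int n}"
    then have "n \<ge> 2" by auto
    then show "len w < len (w \<circ> adj_swap r) \<longleftrightarrow> w r < w (r + 1)" using w by (intro len_adj_swap_iff) auto
  qed
  also have "\<dots> \<longleftrightarrow> w \<in> sorted_invols"
  proof
    assume "\<forall>r\<in>{1..<int n}. w r < w (r + 1)"
    then have less: "w i < w j" if "i \<in> window" "j \<in> window" "i < j" for i j
      using step_less_window[of w i j] that by blast
    have "mono_on window (wind w)"
    proof (rule mono_onI)
      fix i j assume ij: "i \<in> window" "j \<in> window" "i \<le> j"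
      then have "w i \<le> w j" using less[of i j] by (cases "i = j") auto
      then have "quo (w i) \<le> quo (w j)" unfolding quo_def using n_pos by (intro zdiv_mono1) auto
      then show "wind w i \<le> wind w j" using ij by (simp add: wind_def)
    qed
    moreover have "perm w i \<le> perm w j" if "i \<in> window" "j \<in> window" "i < j" "wind w i = wind w j" for i j
      using less[OF that(1-3)] perm_wind[OF that(1), of w] perm_wind[OF that(2), of w] that(4) by simp
    ultimately show "w \<in> sorted_invols"
      unfolding sorted_invols_def mem_Collect_eq word_invs_eq_0_iff level_invs_eq_0_iff using w by blast
  next
    assume "w \<in> sorted_invols"
    then have m: "mono_on window (wind w)"
      and l: "\<And>i j. i \<in> window \<Longrightarrow> j \<in> window \<Longrightarrow> i < j \<Longrightarrow> wind w i = wind w j \<Longrightarrow> perm w i \<le> perm w j"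
      unfolding sorted_invols_def mem_Collect_eq word_invs_eq_0_iff level_invs_eq_0_iff by blast+
    show "\<forall>r\<in>{1..<int n}. w r < w (r + 1)"
    proof
      fix r assume "r \<in> {1..<int n}"
      then have r: "r \<in> window" "r + 1 \<in> window" by (auto simp: window_def)
      have le: "wind w r \<le> wind w (r + 1)" using mono_onD[OF m r] by simp
      have W: "w r = perm w r + int n * wind w r" "w (r + 1) = perm w (r + 1) + int n * wind w (r + 1)"
        using perm_wind r by blast+
      show "w r < w (r + 1)"
      proof (cases "wind w r = wind w (r + 1)")
        case True
        then have "perm w r \<le> perm w (r + 1)" using l[OF r] by simp
        moreover have "perm w r \<noteq> perm w (r + 1)" using perm_inj[OF w r] by simp
        ultimately show ?thesis unfolding W using True by simp
      next
        case False
        then have "wind w r + 1 \<le> wind w (r + 1)" using le by simp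
        then have "int n * (wind w r + 1) \<le> int n * wind w (r + 1)" by (rule mult_left_mono) simp
        then have "int n * wind w r + int n \<le> int n * wind w (r + 1)" by (simp add: distrib_left)
        moreover have "perm w r \<le> int n" "perm w (r + 1) \<ge> 1"
          using perm_window[OF r(1), of w] perm_window[OF r(2), of w] unfolding window_def by auto
        ultimately show ?thesis unfolding W by linarith
      qed
    qed
  qed
  finally show ?thesis .
qed

lemma adj_swap_shift: "adj_swap (c + int n * k) = adj_swap c"
proof -
  have "c + int n * k + 1 = (c + 1) + int n * k" by simp
  then have "res (c + int n * k + 1) = res (c + 1)" by (simp only: res_shift)
  then show ?thesis by (simp add: adj_swap_def fun_eq_iff)
qed

text \<open>\<open>w j\<close> is congruent to \<open>r\<close> exactly when \<open>j\<close> is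
  congruent to \<open>w r\<close>, and the hypothesis lets \<open>w\<close> carry the exchanged
  neighbours to neighbours in the same order.\<close>

lemma conj_adj_swap:
  assumes w: "w \<in> invols" and r: "w (r + 1) = w r + 1"
  shows "w \<circ> adj_swap r \<circ> w = adj_swap (w r)"
proof
  fix j
  have *: "res (w x) = res (w y) \<longleftrightarrow> res x = res y" for x y
    unfolding res_eq_iff_dvd using periodic_dvd_iff[of w y x] w by simp
  have jr: "res (w j) = res r \<longleftrightarrow> res j = res (w r)" for r using *[of "w j" r] invols_invol[OF w, of j] by simp
  have sh: "w (w j + d) = w (e + d) + (j - w e)" if e: "res (w j) = res e" for d e
  proof -
    have "int n dvd (w j - e)" using e res_eq_iff_dvd[of e "w j"] by simp
    then obtain k where "w j - e = int n * k" by (rule dvdE)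
    then have k: "w j = e + int n * k" by simp
    have "w (w j) = w e + int n * k" unfolding k using periodic_mult[of w e k] w by simp
    then have "j - w e = int n * k" using invols_invol[OF w, of j] by simp
    moreover have e2: "w j + d = (e + d) + int n * k" using k by simp
    moreover have "w (w j + d) = w (e + d) + int n * k"
      unfolding e2 by (rule periodic_mult) (use w in simp)
    ultimately show ?thesis by simp
  qed
  consider "res (w j) = res r" | "res (w j) \<noteq> res r" "res (w j) = res (r + 1)" | "res (w j) \<noteq> res r" "res (w j) \<noteq> res (r + 1)" by blast
  then show "(w \<circ> adj_swap r \<circ> w) j = adj_swap (w r) j"
  proof cases
    case 1
    have "w (w j + 1) = j + 1" using sh[OF 1, of 1] r by simp
    then show ?thesis using 1 jr by (simp add: adj_swap_def)
  next
    case 2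
    have "w (w j - 1) = j - 1" using sh[OF 2(2), of "-1"] r by simp
    then show ?thesis using 2 jr[of r] jr[of "r + 1"] r by (simp add: adj_swap_def)
  next
    case 3
    then show ?thesis using jr[of r] jr[of "r + 1"] r invols_invol[OF w, of j] by (simp add: adj_swap_def)
  qed
qed

section \<open>The double coset of a fixed minimal involution\<close>

context
  fixes w :: "int \<Rightarrow> int"
  assumes ws: "w \<in> sorted_invols"
begin

abbreviation "lev \<equiv> wind w"

lemma sw: "w \<in> invols" using ws unfolding sorted_invols_def by blast

lemma sw_mono: "mono_on window lev"
  using ws unfolding sorted_invols_def mem_Collect_eq word_invs_eq_0_iff by blast

lemma sw_perm_less:
  assumes "i \<in> window" "j \<in> window" "i < j" "lev i = lev j"
  shows "perm w i < perm w j"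
proof -
  have "perm w i \<le> perm w j"
    using ws assms unfolding sorted_invols_def mem_Collect_eq level_invs_eq_0_iff by blast
  then show ?thesis using perm_inj[OF sw assms(1,2)] assms(3) by simp
qed

lemma sw_perm: "i \<in> window \<Longrightarrow> perm w (perm w i) = i" "i \<in> window \<Longrightarrow> lev (perm w i) = - lev i"
  using perm_invol_maps[OF sw] unfolding invol_maps_def by blast+

text \<open>The permutation maps a level increasingly onto the opposite one. A position strictly
  between the two images would lie on that opposite level by sortedness, and its preimage would have
  to lie strictly between \<open>r\<close> and \<open>r + 1\<close>.\<close>

lemma sw_perm_Suc:
  assumes r: "r \<in> level_index lev"
  shows "perm w (r + 1) = perm w r + 1"
proof (rule ccontr)
  assume ne: "perm w (r + 1) \<noteq> perm w r + 1"
  have R: "r \<in> window" "r + 1 \<in> window" "lev r = lev (r + 1)" using level_index_window[OF r] by auto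
  have "perm w r < perm w (r + 1)" by (rule sw_perm_less) (use R in auto)
  then have lt: "perm w r < perm w r + 1" "perm w r + 1 < perm w (r + 1)" using ne by auto
  define c where "c = perm w r + 1"
  have P: "perm w r \<in> window" "perm w (r + 1) \<in> window" using R by auto
  then have c: "c \<in> window" using lt by (auto simp: window_def c_def)
  have "lev (perm w r) \<le> lev c" "lev c \<le> lev (perm w (r + 1))"
    using mono_onD[OF sw_mono P(1) c] mono_onD[OF sw_mono c P(2)] lt by (auto simp: c_def)
  then have lc: "lev c = - lev r" using sw_perm(2) R by auto
  define e where "e = perm w c"
  have e: "e \<in> window" "perm w e = c" "lev e = lev r" using sw_perm c lc by (auto simp: e_def)
  consider "e < r" | "e = r" | "e = r + 1" | "e > r + 1" by linarith
  then show False
  proof cases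
    case 1
    then show ?thesis using sw_perm_less[OF e(1) R(1)] e by (simp add: c_def)
  next
    case 2
    then show ?thesis using e by (simp add: c_def)
  next
    case 3
    then show ?thesis using e lt by (simp add: c_def)
  next
    case 4
    then show ?thesis using sw_perm_less[OF R(2) e(1)] e R(3) lt by (simp add: c_def)
  qed
qed

lemma sw_conj:
  assumes r: "r \<in> level_index lev"
  shows "w \<circ> adj_swap r \<circ> w = adj_swap (perm w r)" and "perm w r \<in> level_index lev"
proof -
  have R: "r \<in> window" "r + 1 \<in> window" "lev r = lev (r + 1)" using level_index_window[OF r] by auto
  have "w (r + 1) = w r + 1"
    using perm_wind[OF R(1), of w] perm_wind[OF R(2), of w] sw_perm_Suc[OF r] R(3) by simp
  then have "w \<circ> adj_swap r \<circ> w = adj_swap (w r)" by (rule conj_adj_swap[OF sw])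
  also have "\<dots> = adj_swap (perm w r)" unfolding perm_wind[OF R(1), of w] by (rule adj_swap_shift)
  finally show "w \<circ> adj_swap r \<circ> w = adj_swap (perm w r)" .
  have "perm w r \<in> window" "perm w r + 1 \<in> window" using R(1) perm_window[OF R(2), of w] sw_perm_Suc[OF r] by auto
  moreover have "lev (perm w r) = lev (perm w r + 1)"
    using sw_perm(2)[OF R(1)] sw_perm(2)[OF R(2)] R(3) sw_perm_Suc[OF r] by simp
  ultimately show "perm w r \<in> level_index lev" by (auto simp: level_index_def window_def)
qed

text \<open>Minimality gives \<open>w r < w (r + 1)\<close>, so the reflection at \<open>t\<close>
  raises \<open>w r\<close> by one and \<open>perm w r = t\<close>. As \<open>t < n\<close>, the
  successor \<open>t + 1\<close> is still in the window and the quotient does not change.\<close>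

lemma sw_conj_converse:
  assumes r: "r \<in> {1..<int n}" and t: "t \<in> {1..<int n}" and e: "w \<circ> adj_swap r \<circ> w = adj_swap t"
  shows "r \<in> level_index lev"
proof -
  have n2: "n \<ge> 2" using r by auto
  have R: "r \<in> window" "r + 1 \<in> window" "t \<in> window" "t + 1 \<in> window" using r t by (auto simp: window_def)
  have "w (adj_swap r (w (w r))) = adj_swap t (w r)" using e by (metis comp_apply)
  then have wr: "w (r + 1) = adj_swap t (w r)" using invols_invol[OF sw] swap_at(1)[OF n2] by simp
  have "w \<in> min_coset_reps (affine_sym n) (affine_gens n) (affine_J n)"
    using min_coset_reps_iff[OF sw] ws by simp
  then have "len w < len (w \<circ> adj_swap r)"
  proof -
    assume "w \<in> min_coset_reps (affine_sym n) (affine_gens n) (affine_J n)"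
    then have "word_length (affine_sym n) (affine_gens n) w < word_length (affine_sym n) (affine_gens n) (w \<circ> adj_swap r)"
      using r unfolding min_coset_reps_def affine_J_eq by auto
    then show ?thesis using affine_word_length sw n2 by simp
  qed
  then have "w r < w (r + 1)" using len_adj_swap_iff[OF n2, of w r] sw by simp
  then have "res (w r) = res t" "w (r + 1) = w r + 1"
    unfolding wr by (auto simp: adj_swap_def split: if_splits)
  then have "perm w r = t" using R by (simp add: perm_def)
  then have "w (r + 1) = (t + 1) + int n * lev r"
    using perm_wind[OF R(1), of w] \<open>w (r + 1) = w r + 1\<close> by simp
  then have "lev (r + 1) = lev r" using perm_wind_unique(2)[of "r + 1" w "t + 1" "lev r"] R by simp
  then show ?thesis using r by (simp add: level_index_def)
qed

lemma sw_K: "affine_J n \<inter> (\<lambda>x. w \<circ> x \<circ> w) ` affine_J n = adj_swap ` level_index lev"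
proof (intro equalityI subsetI)
  fix s assume "s \<in> affine_J n \<inter> (\<lambda>x. w \<circ> x \<circ> w) ` affine_J n"
  then obtain r t where rt: "r \<in> {1..<int n}" "s = adj_swap r" "t \<in> {1..<int n}" "s = w \<circ> adj_swap t \<circ> w"
    unfolding affine_J_eq by auto
  have "w \<circ> adj_swap r \<circ> w = adj_swap t"
    unfolding rt(2)[symmetric] rt(4) by (simp add: fun_eq_iff invols_invol[OF sw])
  then show "s \<in> adj_swap ` level_index lev" using sw_conj_converse[OF rt(1,3)] rt(2) by blast
next
  fix s assume "s \<in> adj_swap ` level_index lev"
  then obtain r where r: "r \<in> level_index lev" "s = adj_swap r" by blast
  have J: "adj_swap r \<in> affine_J n" if "r \<in> level_index lev" for r
    using that unfolding affine_J_eq level_index_def by auto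
  have e: "s = w \<circ> adj_swap (perm w r) \<circ> w"
    unfolding r(2) sw_conj(1)[OF r(1), symmetric] by (simp add: fun_eq_iff invols_invol[OF sw])
  then show "s \<in> affine_J n \<inter> (\<lambda>x. w \<circ> x \<circ> w) ` affine_J n"
    using J[OF r(1)] r(2) imageI[OF J[OF sw_conj(2)[OF r(1)]], of "\<lambda>x. w \<circ> x \<circ> w"] unfolding e[symmetric] by simp
qed

lemma sw_comp:
  assumes u: "u \<in> level_group lev"
  shows "i \<in> window \<Longrightarrow> perm (u \<circ> w) i = u (perm w i)" and "wind (u \<circ> w) = lev"
proof -
  have uA: "u \<in> AS" using u level_group_AS by blast
  have e: "perm (u \<circ> w) i = u (perm w i) \<and> wind (u \<circ> w) i = lev i" if i: "i \<in> window" for i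
  proof -
    have "(u \<circ> w) i = u (perm w i) + int n * lev i"
      using perm_wind[OF i, of w] periodic_mult[of u "perm w i" "lev i"] uA by simp
    moreover have "u (perm w i) \<in> window" using u i unfolding level_group_def by auto
    ultimately show ?thesis using perm_wind_unique[OF i] by blast
  qed
  then show "i \<in> window \<Longrightarrow> perm (u \<circ> w) i = u (perm w i)" by blast
  show "wind (u \<circ> w) = lev"
    by (rule extensionalityI[of _ window]) (use e in auto)
qed

lemma sw_len: "len w = spread lev"
  using len_invol[OF sw] ws unfolding sorted_invols_def by simp

text \<open>The levels are unchanged, so only inversions within levels are added to those of
  \<open>w\<close>, which has none. As \<open>perm w\<close> increases on each level, it carries the
  inversions of \<open>u \<circ> perm w\<close> to those of \<open>u\<close>.\<close>

lemma sw_len_comp: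
  assumes u: "u \<in> level_group lev" and z: "u \<circ> w \<in> invols"
  shows "len (u \<circ> w) = len u + len w"
proof -
  have "len (u \<circ> w) = spread lev + level_invs window lev (perm (u \<circ> w))"
    using len_invol[OF z] sw_comp(2)[OF u] ws unfolding sorted_invols_def by simp
  also have "level_invs window lev (perm (u \<circ> w)) = level_invs window lev (\<lambda>i. u (perm w i))"
    by (rule level_invs_cong) (rule sw_comp(1)[OF u])
  also have "\<dots> = level_invs window lev u"
    unfolding level_invs_def
  proof (rule bij_betw_same_card[of "\<lambda>(i, j). (perm w i, perm w j)"], rule bij_betw_byWitness[where f' = "\<lambda>(i, j). (perm w i, perm w j)"])
  qed (use sw_perm sw_perm_less in auto)
  finally show ?thesis unfolding len_level_group[OF sw_mono u] sw_len by (simp only: add.commute)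
qed

text \<open>An increasing involution of level 0 is the identity, so every 2-cycle of
  \<open>w\<close> joins two opposite nonzero levels.\<close>

lemma sw_exc: "exc w = card {i \<in> window. lev i > 0}"
proof -
  have "\<not> i < perm w i" if i: "i \<in> window" "lev i = 0" for i
  proof
    assume a: "i < perm w i"
    have "perm w i < perm w (perm w i)"
      by (rule sw_perm_less[OF i(1) _ a]) (use i sw_perm in auto)
    then show False using a sw_perm(1)[OF i(1)] by simp
  qed
  then show ?thesis unfolding exc_invol[OF sw] two_cycles_def
    by (intro arg_cong[of _ _ card]) auto
qed

lemma sw_exc_le:
  assumes u: "u \<in> level_group lev" and z: "u \<circ> w \<in> invols"
  shows "exc w \<le> exc (u \<circ> w)"
  unfolding sw_exc exc_invol[OF z] two_cycles_def sw_comp(2)[OF u] by (rule card_mono) auto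

text \<open>Right multiplication by \<open>w\<close> is its own inverse. If \<open>z\<close> has the
  levels of \<open>w\<close>, both maps negate them and their translations cancel, so
  \<open>z \<circ> w\<close> preserves the window and the levels.\<close>

lemma sw_bij: "bij_betw (\<lambda>u. u \<circ> w) {u \<in> level_group lev. u \<circ> w \<in> invols} {z \<in> invols. wind z = lev}"
proof (rule bij_betw_byWitness[where f' = "\<lambda>z. z \<circ> w"])
  have ww: "w \<circ> w = id" using invols_invol[OF sw] by (simp add: fun_eq_iff)
  show "\<forall>u\<in>{u \<in> level_group lev. u \<circ> w \<in> invols}. (u \<circ> w) \<circ> w = u" by (simp add: o_assoc[symmetric] ww)
  show "\<forall>z\<in>{z \<in> invols. wind z = lev}. (z \<circ> w) \<circ> w = z" by (simp add: o_assoc[symmetric] ww)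
  show "(\<lambda>u. u \<circ> w) ` {u \<in> level_group lev. u \<circ> w \<in> invols} \<subseteq> {z \<in> invols. wind z = lev}"
    using sw_comp(2) by auto
  show "(\<lambda>z. z \<circ> w) ` {z \<in> invols. wind z = lev} \<subseteq> {u \<in> level_group lev. u \<circ> w \<in> invols}"
  proof (rule image_subsetI)
    fix z assume "z \<in> {z \<in> invols. wind z = lev}"
    then have z: "z \<in> invols" "wind z = lev" by auto
    have zp: "lev (perm z i) = - lev i" if "i \<in> window" for i
      using perm_invol_maps[OF z(1)] that unfolding z(2) invol_maps_def by blast
    have "z (w i) \<in> window \<and> lev (z (w i)) = lev i" if i: "i \<in> window" for i
    proof -
      have "z (w i) = z (perm w i) + int n * lev i"
        using perm_wind[OF i, of w] periodic_mult[of z "perm w i" "lev i"] z(1) by simp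
      also have "z (perm w i) = perm z (perm w i) + int n * lev (perm w i)"
        using perm_wind[of "perm w i" z] i z(2) by simp
      finally have "z (w i) = perm z (perm w i)" using sw_perm(2)[OF i] by simp
      then show ?thesis using zp[of "perm w i"] sw_perm(2)[OF i] i by simp
    qed
    then have "z \<circ> w \<in> level_group lev"
      unfolding level_group_def using z(1) sw by simp
    moreover have "(z \<circ> w) \<circ> w = z" by (simp add: o_assoc[symmetric] ww)
    ultimately show "z \<circ> w \<in> {u \<in> level_group lev. u \<circ> w \<in> invols}" using z(1) by simp
  qed
qed

text \<open>The factor \<open>t ^ exc w\<close> restores the 2-cycles that the twisted absolute
  length subtracts, so the inner series becomes a sum over all involutions with levels
  \<open>lev\<close>.\<close>

lemma sw_L_series:
  fixes t :: "'k::field fps"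
  defines "t \<equiv> (fps_X - 1) / (fps_X + 1)"
  defines "K \<equiv> adj_swap ` level_index lev"
  shows "t ^ exc w * L_series (subgroup_generated (affine_sym n) K) K (\<lambda>x. w \<circ> x \<circ> w)
    = (\<Sum>\<sigma>\<in>invol_maps window lev. fps_X ^ level_invs window lev \<sigma> * t ^ two_cycles window lev \<sigma>)"
proof -
  let ?H = "subgroup_generated (affine_sym n) K"
  let ?T = "{u \<in> level_group lev. u \<circ> w \<in> invols}"
  have H: "carrier ?H = level_group lev" unfolding K_def by (rule level_subgroup(1)[OF sw_mono])
  \<comment> \<open>\<open>word_length\<close> reads only the product and the unit, which the
    generated subgroup shares with the whole group.\<close>
  have wl: "word_length ?H K u = len u" if "u \<in> level_group lev" for u
    using level_subgroup(2)[OF sw_mono that] unfolding K_def by (simp add: word_length_def)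
  note tw = twisted_abs_length_eq[of ?H w "level_index lev" K, unfolded H]
  have grp: "group ?H" by (rule group.group_subgroup_generated[OF group_AS])
  have KH: "K \<subseteq> level_group lev" unfolding K_def using level_group_swap[OF id_level_group] by auto
  have Kw: "w \<circ> s \<circ> w \<in> K" if "s \<in> K" for s
    using that sw_conj unfolding K_def by auto
  have TI: "twisted_involutions ?H (\<lambda>x. w \<circ> x \<circ> w) = ?T"
    by (rule tw(1)) (use grp level_group_AS sw level_index_n2 KH Kw wl sw_len_comp sw_exc_le level_group_descent[OF sw_mono] in \<open>auto simp: K_def\<close>)
  have ab: "twisted_abs_length ?H K (\<lambda>x. w \<circ> x \<circ> w) u = exc (u \<circ> w) - exc w" if "u \<in> ?T" for u
    by (rule tw(2)) (use that grp level_group_AS sw level_index_n2 KH Kw wl sw_len_comp sw_exc_le level_group_descent[OF sw_mono] in \<open>auto simp: K_def\<close>)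
  have fin: "finite ?T" using finite_level_group by simp
  have "t ^ exc w * L_series ?H K (\<lambda>x. w \<circ> x \<circ> w) = (\<Sum>u\<in>?T. t ^ exc w * (fps_X ^ len u * t ^ (exc (u \<circ> w) - exc w)))"
    unfolding L_series_def TI infsum_finite[OF fin] sum_distrib_left t_def[symmetric]
    by (rule sum.cong[OF refl]) (use wl ab in auto)
  also have "\<dots> = (\<Sum>u\<in>?T. fps_X ^ level_invs window lev (perm (u \<circ> w)) * t ^ two_cycles window lev (perm (u \<circ> w)))"
  proof (rule sum.cong[OF refl])
    fix u assume "u \<in> ?T"
    then have u: "u \<in> level_group lev" "u \<circ> w \<in> invols" by auto
    have "exc w + (exc (u \<circ> w) - exc w) = two_cycles window lev (perm (u \<circ> w))"
      using sw_exc_le[OF u] exc_invol[OF u(2)] sw_comp(2)[OF u(1)] by simp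
    moreover have "len u = level_invs window lev (perm (u \<circ> w))"
      using len_invol[OF u(2)] sw_len_comp[OF u] sw_comp(2)[OF u(1)] ws sw_len unfolding sorted_invols_def by simp
    ultimately show "t ^ exc w * (fps_X ^ len u * t ^ (exc (u \<circ> w) - exc w))
      = fps_X ^ level_invs window lev (perm (u \<circ> w)) * t ^ two_cycles window lev (perm (u \<circ> w))"
      by (metis (no_types, lifting) mult.left_commute power_add)
  qed
  also have "\<dots> = (\<Sum>z\<in>{z \<in> invols. wind z = lev}. fps_X ^ level_invs window lev (perm z) * t ^ two_cycles window lev (perm z))"
    by (rule sum.reindex_bij_betw[OF sw_bij])
  also have "\<dots> = (\<Sum>\<sigma>\<in>invol_maps window lev. fps_X ^ level_invs window lev \<sigma> * t ^ two_cycles window lev \<sigma>)"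
    by (rule sum.reindex_bij_betw[OF wind_bij[OF wind_extensional]])
  finally show ?thesis .
qed

end

lemma poincare_series_level:
  fixes a :: "int \<Rightarrow> int"
  assumes mono: "mono_on window a" and V: "finite V" "a ` window \<subseteq> V"
  defines "K \<equiv> adj_swap ` level_index a"
  shows "fps_compose (poincare_series (subgroup_generated (affine_sym n) K) K) (fps_X ^ 2)
    = (\<Prod>v\<in>V. q_factorial (fps_X ^ 2 :: 'k::field fps) (fiber_card window a v))"
proof -
  let ?H = "subgroup_generated (affine_sym n) K"
  have H: "carrier ?H = level_group a" unfolding K_def by (rule level_subgroup(1)[OF mono])
  have wl: "word_length ?H K u = len u" if "u \<in> level_group a" for u
    using level_subgroup(2)[OF mono that] unfolding K_def by (simp add: word_length_def)
  have "poincare_series ?H K = (\<Sum>u\<in>level_group a. fps_X ^ len u :: 'k fps)"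
    unfolding poincare_series_def H infsum_finite[OF finite_level_group] by (rule sum.cong[OF refl]) (simp add: wl)
  then have "fps_compose (poincare_series ?H K) (fps_X ^ 2) = (\<Sum>u\<in>level_group a. (fps_X ^ 2 :: 'k fps) ^ len u)"
    by (simp add: fps_compose_sum_distrib fps_X_power_compose)
  also have "\<dots> = (\<Prod>v\<in>V. q_factorial (fps_X ^ 2) (fiber_card window a v))"
    by (rule sum_level_group[OF mono V])
  finally show ?thesis .
qed

text \<open>The case \<open>w = id\<close> of \<open>twisted_abs_length_eq\<close>; the index set
  \<open>R\<close> is empty for \<open>n = 1\<close>, in agreement with
  \<open>affine_gens\<close>.\<close>

lemma twisted_involutions_affine: "twisted_involutions (affine_sym n) (\<lambda>x. x) = invols"
  and twisted_abs_length_affine: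
    "u \<in> invols \<Longrightarrow> twisted_abs_length (affine_sym n) (affine_gens n) (\<lambda>x. x) u = exc u"
proof -
  define R where "R = (if n \<ge> 2 then {0..<int n} else {})"
  have K: "affine_gens n = adj_swap ` R"
  proof -
    have "{0..<int n} = int ` {0..<n}" by (simp add: image_int_atLeastLessThan)
    then show ?thesis by (auto simp: affine_gens_def affine_gen_eq R_def image_image)
  qed
  have n2: "n \<ge> 2" if "r \<in> R" for r using that by (auto simp: R_def split: if_splits)
  have id: "id \<in> invols" by (rule involsI) auto
  have dd: "(\<lambda>x. id \<circ> x \<circ> id) = (\<lambda>x. x)" by (simp add: fun_eq_iff)
  have e0: "exc id = 0" by (simp add: exc_def)
  have desc: "\<exists>r\<in>R. u (r + 1) < u r" if u: "u \<in> AS" "u \<noteq> id" for u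
  proof -
    obtain c where "n \<ge> 2" "c < n" "u (int c + 1) < u (int c)" using exists_descent[OF u] by blast
    then show ?thesis by (intro bexI[of _ "int c"]) (auto simp: R_def)
  qed
  have KA: "affine_gens n \<subseteq> AS" unfolding K using n2 by auto
  note tw = twisted_abs_length_eq[of "affine_sym n" id R "affine_gens n", unfolded dd]
  have "twisted_involutions (affine_sym n) (\<lambda>x. x) = {u \<in> AS. u \<circ> id \<in> invols}"
    by (rule tw(1)) (use group_AS id K KA n2 affine_word_length desc e0 in auto)
  moreover have "{u \<in> AS. u \<circ> id \<in> invols} = invols" by auto
  ultimately show "twisted_involutions (affine_sym n) (\<lambda>x. x) = invols" by simp
  have "twisted_abs_length (affine_sym n) (affine_gens n) (\<lambda>x. x) u = exc (u \<circ> id) - exc id" if "u \<in> invols"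
    by (rule tw(2)) (use that group_AS id K KA n2 affine_word_length desc e0 in auto)
  then show "u \<in> invols \<Longrightarrow> twisted_abs_length (affine_sym n) (affine_gens n) (\<lambda>x. x) u = exc u"
    by (simp add: e0)
qed

lemma L_series_affine:
  fixes t :: "'k::field fps"
  defines "t \<equiv> (fps_X - 1) / (fps_X + 1)"
  shows "L_series (affine_sym n) (affine_gens n) (\<lambda>x. x) = (\<Sum>\<^sub>\<infinity>z\<in>invols. fps_X ^ len z * t ^ exc z)"
  unfolding L_series_def twisted_involutions_affine t_def
  by (rule infsum_cong) (simp add: affine_word_length twisted_abs_length_affine)

end

subsection \<open>q-identities\<close>

text \<open>Gaussian binomials through Pascal's rule, available without division in any commutative
  ring.\<close>

fun gauss_binomial :: "'r::comm_ring_1 \<Rightarrow> nat \<Rightarrow> nat \<Rightarrow> 'r" where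
  "gauss_binomial p 0 j = (if j = 0 then 1 else 0)"
| "gauss_binomial p (Suc k) 0 = 1"
| "gauss_binomial p (Suc k) (Suc j) = gauss_binomial p k (Suc j) + p ^ (k - j) * gauss_binomial p k j"

lemma gauss_binomial_0 [simp]: "gauss_binomial p k 0 = 1"
  by (cases k) simp_all

lemma gauss_binomial_eq_0: "k < j \<Longrightarrow> gauss_binomial p k j = 0"
  by (induction p k j rule: gauss_binomial.induct) auto

lemma gauss_binomial_diag [simp]: "gauss_binomial p k k = 1"
  by (induction k) (simp_all add: gauss_binomial_eq_0)

lemma gauss_binomial_factorial:
  "j \<le> k \<Longrightarrow> gauss_binomial p k j * (q_factorial p j * q_factorial p (k - j)) = q_factorial p k"
proof (induction p k j rule: gauss_binomial.induct)
  case (3 p k j)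
  show ?case
  proof (cases "j = k")
    case True
    then show ?thesis using 3 by (simp add: gauss_binomial_eq_0 q_factorial_Suc algebra_simps)
  next
    case False
    then obtain d where d: "k = j + Suc d" using 3(3) by (metis Suc_le_mono less_imp_Suc_add order_le_less add_Suc_right)
    have 1: "gauss_binomial p k (Suc j) * (q_factorial p (Suc j) * q_factorial p d) = q_factorial p k"
      using 3(1) d by simp
    have 2: "gauss_binomial p k j * (q_factorial p j * q_factorial p (Suc d)) = q_factorial p k"
      using 3(2) d by simp
    have "gauss_binomial p (Suc k) (Suc j) * (q_factorial p (Suc j) * q_factorial p (Suc d))
      = gauss_binomial p k (Suc j) * (q_factorial p (Suc j) * q_factorial p d) * q_sum p (Suc d)
      + p ^ Suc d * (gauss_binomial p k j * (q_factorial p j * q_factorial p (Suc d))) * q_sum p (Suc j)"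
      using d by (simp add: q_factorial_Suc algebra_simps)
    also have "\<dots> = q_factorial p k * (q_sum p (Suc d) + p ^ Suc d * q_sum p (Suc j))"
      unfolding 1 2 by (simp add: algebra_simps)
    also have "\<dots> = q_factorial p (Suc k)"
      unfolding q_sum_add[symmetric] using d by (simp add: q_factorial_Suc add.commute)
    finally show ?thesis using d by simp
  qed
qed auto

text \<open>A form of the \<open>q\<close>-binomial theorem. Pascal's rule splits the sum for
  \<open>k + 1\<close> in two, and the terms with factor \<open>p ^ (k - j)\<close> are exactly what
  the last factor \<open>1 - y * p ^ (k - j)\<close> of the longer product takes away.\<close>

lemma gauss_binomial_partition:
  "(\<Sum>j\<le>k. gauss_binomial p k j * y ^ j * (\<Prod>l<k-j. 1 - y * p ^ l)) = 1"
proof (induction k)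
  case (Suc k)
  let ?P = "\<lambda>m. \<Prod>l<m. 1 - y * p ^ l"
  have "(\<Sum>j\<le>Suc k. gauss_binomial p (Suc k) j * y ^ j * ?P (Suc k - j))
     = ?P (Suc k) + (\<Sum>j\<le>k. gauss_binomial p (Suc k) (Suc j) * y ^ Suc j * ?P (k - j))"
    by (subst sum.atMost_Suc_shift) simp
  also have "\<dots> = ?P (Suc k) + (\<Sum>j\<le>k. gauss_binomial p k (Suc j) * y ^ Suc j * ?P (k - j))
      + (\<Sum>j\<le>k. p ^ (k - j) * gauss_binomial p k j * y ^ Suc j * ?P (k - j))"
    by (simp add: sum.distrib algebra_simps)
  also have "?P (Suc k) + (\<Sum>j\<le>k. gauss_binomial p k (Suc j) * y ^ Suc j * ?P (k - j))
      = (\<Sum>j\<le>Suc k. gauss_binomial p k j * y ^ j * ?P (Suc k - j))"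
    by (subst sum.atMost_Suc_shift) simp
  also have "\<dots> = (\<Sum>j\<le>k. gauss_binomial p k j * y ^ j * ?P (Suc k - j))"
    by (simp add: gauss_binomial_eq_0)
  also have "\<dots> + (\<Sum>j\<le>k. p ^ (k - j) * gauss_binomial p k j * y ^ Suc j * ?P (k - j))
      = (\<Sum>j\<le>k. gauss_binomial p k j * y ^ j * ?P (k - j))"
    unfolding sum.distrib[symmetric]
  proof (rule sum.cong[OF refl])
    fix j assume "j \<in> {..k}"
    then have "Suc k - j = Suc (k - j)" by auto
    then show "gauss_binomial p k j * y ^ j * ?P (Suc k - j) + p ^ (k - j) * gauss_binomial p k j * y ^ Suc j * ?P (k - j)
        = gauss_binomial p k j * y ^ j * ?P (k - j)"
      by (simp add: algebra_simps)
  qed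
  finally show ?case using Suc by simp
qed simp

definition pi_plus :: "'r::comm_ring_1 \<Rightarrow> nat \<Rightarrow> 'r" where
  "pi_plus x m = (\<Prod>i = 1..m. 1 + x ^ i)"

lemma pi_plus_0 [simp]: "pi_plus x 0 = 1"
  and pi_plus_Suc: "pi_plus x (Suc m) = pi_plus x m * (1 + x ^ Suc m)"
  by (simp_all add: pi_plus_def)

lemma q_sum_mult: "(1 - x) * q_sum x m = 1 - x ^ m"
proof (induction m)
  case (Suc m)
  have "(1 - x) * q_sum x (Suc m) = (1 - x) * q_sum x m + (1 - x) * x ^ m"
    by (simp add: q_sum_Suc distrib_left)
  then show ?case unfolding Suc by (simp add: algebra_simps)
qed simp

lemma q_sum_double: "q_sum x (2 * m) = q_sum x m * (1 + x ^ m)"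
  unfolding mult_2 q_sum_add by (simp add: distrib_left mult.commute)

text \<open>Both sides are the sum of all powers of \<open>x\<close> with exponent below
  \<open>2 * m\<close>. This relates factorials at \<open>x\<^sup>2\<close>, coming from doubled
  inversions, to those at \<open>x\<close>.\<close>

lemma q_sum_square: "q_sum (x\<^sup>2) m * (1 + x) = q_sum x m * (1 + x ^ m)"
proof (induction m)
  case (Suc m)
  have "q_sum (x\<^sup>2) (Suc m) * (1 + x) = q_sum x m * (1 + x ^ m) + (x ^ m * x ^ m) * (1 + x)"
    unfolding Suc[symmetric] by (simp add: q_sum_Suc distrib_right power2_eq_square power_mult_distrib)
  also have "\<dots> = q_sum x (Suc m) * (1 + x ^ Suc m) + x ^ m * ((1 - x) * q_sum x m - (1 - x ^ m))"
    by (simp add: q_sum_Suc algebra_simps)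
  finally show ?case by (simp add: q_sum_mult)
qed simp

lemma q_factorial_square: "q_factorial (x\<^sup>2) m * (1 + x) ^ m = q_factorial x m * pi_plus x m"
proof (induction m)
  case (Suc m)
  have "q_factorial (x\<^sup>2) (Suc m) * (1 + x) ^ Suc m = (q_factorial (x\<^sup>2) m * (1 + x) ^ m) * (q_sum (x\<^sup>2) (Suc m) * (1 + x))"
    by (simp add: q_factorial_Suc algebra_simps)
  also have "\<dots> = q_factorial x (Suc m) * pi_plus x (Suc m)"
    unfolding Suc q_sum_square by (simp add: q_factorial_Suc pi_plus_Suc algebra_simps)
  finally show ?case .
qed simp

section \<open>Rational identities at an element that is not a root of unity\<close>

locale generic_field =
  fixes x :: "'f::field"
  assumes pow_neq_1: "i > 0 \<Longrightarrow> x ^ i \<noteq> 1"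
begin

lemma x_neq_1 [simp]: "x \<noteq> 1" "1 - x \<noteq> 0"
  using pow_neq_1[of 1] by auto

lemma plus_neq_0 [simp]: "1 + x ^ Suc i \<noteq> 0" "1 + x \<noteq> 0"
proof -
  have "1 + x ^ i \<noteq> 0" if "i > 0" for i
  proof
    assume "1 + x ^ i = 0"
    then have "x ^ i = -1" by (simp add: add_eq_0_iff)
    then have "x ^ (2 * i) = 1" by (simp add: mult.commute power_mult)
    then show False using pow_neq_1[of "2 * i"] that by simp
  qed
  from this[of "Suc i"] this[of 1] show "1 + x ^ Suc i \<noteq> 0" "1 + x \<noteq> 0" by auto
qed

lemma q_sum_closed: "q_sum x m = (1 - x ^ m) / (1 - x)"
  using q_sum_mult[of x m] by (simp add: eq_divide_eq mult.commute)

lemma q_sum_neq_0 [simp]: "q_sum x (Suc m) \<noteq> 0"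
  using pow_neq_1[of "Suc m"] by (simp add: q_sum_closed del: power_Suc)

lemma q_factorial_neq_0 [simp]: "q_factorial x m \<noteq> 0"
  by (induction m) (simp_all add: q_factorial_Suc)

lemma pi_plus_neq_0 [simp]: "pi_plus x m \<noteq> 0"
  by (induction m) (simp_all add: pi_plus_Suc del: power_Suc)

lemma q_factorial_square_eq: "q_factorial (x\<^sup>2) m = q_factorial x m * pi_plus x m / (1 + x) ^ m"
  using q_factorial_square[of x m] by (simp add: eq_divide_eq)

text \<open>An opaque name for \<open>1 + x ^ i\<close>, which \<open>field_simps\<close> would
  otherwise multiply out.\<close>

definition opx :: "nat \<Rightarrow> 'f" where "opx i = 1 + x ^ i"

lemma opx_neq_0 [simp]: "opx (Suc i) \<noteq> 0"
  using plus_neq_0 by (simp add: opx_def del: power_Suc)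

lemma pi_plus_opx: "pi_plus x (Suc m) = pi_plus x m * opx (Suc m)"
  by (simp add: pi_plus_Suc opx_def)

lemma q_sum_double_opx: "q_sum x (2 * m) = q_sum x m * opx m"
  by (simp add: q_sum_double opx_def)

text \<open>The coefficient of \<open>s ^ k\<close> in the final formula, after the factor
  \<open>1 + x ^ (n - k)\<close> of the Pochhammer symbol has cancelled against
  \<open>[2n - 2k] = [n - k] (1 + x ^ (n - k))\<close>; see \<open>cheb_eq\<close>.\<close>

definition cheb :: "nat \<Rightarrow> nat \<Rightarrow> 'f" where
  "cheb n k = x ^ (k ^ 2) * q_sum x n * (q_factorial x (n - k - 1) * pi_plus x (n - k - 1))
     / (q_factorial x k * pi_plus x k * q_factorial x (n - 2 * k))"

lemma cheb_0: "n > 0 \<Longrightarrow> cheb n 0 = pi_plus x (n - 1)"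
  by (cases n) (simp_all add: cheb_def q_factorial_Suc)

lemma cheb_half: "k > 0 \<Longrightarrow> cheb (2 * k) k = x ^ (k ^ 2)"
proof -
  assume "k > 0"
  then obtain j where k: "k = Suc j" by (cases k) auto
  have "2 * k - k - 1 = j" using k by simp
  then show ?thesis unfolding cheb_def q_sum_double_opx k
    by (simp add: q_factorial_Suc pi_plus_opx field_simps del: power_Suc)
qed

text \<open>With \<open>k = j + 1\<close> and \<open>n = 2 * k + d + 1\<close>, the three terms
  share the factor \<open>A\<close>; what remains is a rational identity in \<open>x\<close>,
  \<open>x ^ j\<close> and \<open>x ^ d\<close>. The boundary \<open>2 * k = n\<close> is left to
  \<open>cheb_half\<close>, because \<open>cheb (n - 1) k\<close> is then out of range.\<close>

lemma cheb_rec: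
  assumes "k > 0" "2 * k < n"
  shows "cheb n k = (1 + x ^ (n - 1)) * cheb (n - 1) k + x ^ (n - 1) * cheb (n - 2) (k - 1)"
proof -
  obtain j where k: "k = Suc j" using assms(1) by (cases k) auto
  obtain d where n: "n = 2 * k + Suc d" using assms(2) by (metis less_imp_Suc_add add_Suc_right)
  have e: "n - k - 1 = Suc (j + d)" "n - 1 - k - 1 = j + d" "n - 2 - (k - 1) - 1 = j + d"
    "n - 2 * k = Suc d" "n - 1 - 2 * k = d" "n - 2 - 2 * (k - 1) = Suc d"
    using n k by auto
  have e': "n - 1 = 2 * j + d + 2" "n - 2 = 2 * j + d + 1"
    using n k by auto
  define A where "A = q_factorial x (j + d) * pi_plus x (j + d) / (q_factorial x k * pi_plus x k * q_factorial x (Suc d))"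
  have 1: "cheb n k = A * (x ^ (k ^ 2) * q_sum x n * (q_sum x (Suc (j + d)) * opx (Suc (j + d))))"
    unfolding cheb_def e A_def by (simp add: q_factorial_Suc pi_plus_opx field_simps del: power_Suc)
  have 2: "cheb (n - 1) k = A * (x ^ (k ^ 2) * q_sum x (n - 1) * q_sum x (Suc d))"
    unfolding cheb_def e A_def by (simp add: q_factorial_Suc pi_plus_opx field_simps del: power_Suc)
  have 3: "cheb (n - 2) (k - 1) = A * (x ^ (j ^ 2) * q_sum x (n - 2) * (q_sum x k * opx k))"
    unfolding cheb_def e A_def unfolding k by (simp add: q_factorial_Suc pi_plus_opx field_simps del: power_Suc)
  define a b where "a = x ^ j" and "b = x ^ d"
  have pw: "x ^ n = a ^ 2 * b * x ^ 3" "x ^ (n - 1) = a ^ 2 * b * x ^ 2" "x ^ (n - 2) = a ^ 2 * b * x" "x ^ k = a * x"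
    "x ^ Suc (j + d) = a * b * x" "x ^ Suc d = b * x"
    unfolding e' n k a_def b_def by (simp_all add: power_add power_mult power2_eq_square power3_eq_cube algebra_simps)
  have kk: "x ^ (k ^ 2) = x ^ (j ^ 2) * (a ^ 2 * x)"
    unfolding k a_def by (simp add: power2_eq_square power_add algebra_simps)
  have dd: "(1 - x) * (1 - x) \<noteq> 0" by simp
  have "x ^ (k ^ 2) * q_sum x n * (q_sum x (Suc (j + d)) * opx (Suc (j + d)))
     = (1 + x ^ (n - 1)) * (x ^ (k ^ 2) * q_sum x (n - 1) * q_sum x (Suc d))
      + x ^ (n - 1) * (x ^ (j ^ 2) * q_sum x (n - 2) * (q_sum x k * opx k))"
    unfolding q_sum_closed opx_def pw kk using dd by (simp add: divide_simps) algebra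
  then show ?thesis unfolding 1 2 3 by (simp add: algebra_simps)
qed

lemma cheb_alternating_sum:
  assumes "n > 0"
  shows "(\<Sum>k = 0..n div 2. (-1) ^ k * cheb n k) = 1"
proof -
  \<comment> \<open>Cuts \<open>cheb\<close> off where \<open>n - 2 * k\<close> would be
    truncated.\<close>
  define c where "c n k = (if 2 * k \<le> n then cheb n k else 0)" for n k
  define S where "S n = (\<Sum>k\<le>n. (-1) ^ k * c n k)" for n
  \<comment> \<open>The recurrence starts at \<open>n = 3\<close>: at \<open>n = 2\<close> it would
    need the value 1 for \<open>cheb 0 0\<close>, which is 0 because of the factor
    \<open>q_sum x 0\<close>.\<close>
  have rec: "c n k = (1 + x ^ (n - 1)) * c (n - 1) k + (if k = 0 then 0 else x ^ (n - 1) * c (n - 2) (k - 1))"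
    if n: "n \<ge> 3" for n k
  proof -
    consider "k = 0" | "k > 0" "2 * k < n" | "k > 0" "2 * k = n" | "k > 0" "2 * k > n" by linarith
    then show ?thesis
    proof cases
      case 1
      obtain m where m: "n = Suc (Suc m)" "m > 0" using n by (cases n; cases "n - 1") auto
      show ?thesis using 1 m by (simp add: c_def cheb_0 pi_plus_Suc mult.commute)
    next
      case 2
      then show ?thesis using cheb_rec[OF 2] by (auto simp: c_def)
    next
      case 3
      obtain j where k: "k = Suc j" using 3 by (cases k) auto
      have j: "j > 0" using n 3 k by (cases j) auto
      have "x ^ (k ^ 2) = x ^ (n - 1) * x ^ (j ^ 2)"
        unfolding power_add[symmetric] using 3 k by (intro arg_cong[of _ _ "power x"]) (auto simp: power2_eq_square)
      moreover have "c n k = x ^ (k ^ 2)" using 3 cheb_half[of k] by (auto simp: c_def)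
      moreover have "c (n - 1) k = 0" using 3 by (auto simp: c_def)
      moreover have "n - 2 = 2 * j" using 3 k by auto
      then have "c (n - 2) (k - 1) = x ^ (j ^ 2)" using k j cheb_half[of j] by (auto simp: c_def)
      ultimately show ?thesis using k by simp
    next
      case 4
      then have "\<not> 2 * k \<le> n" "\<not> 2 * k \<le> n - 1" "\<not> 2 * (k - 1) \<le> n - 2" using n by linarith+
      then show ?thesis using 4 by (simp add: c_def)
    qed
  qed
  have "S n = 1" if "n > 0" for n
    using that
  proof (induction n rule: less_induct)
    case (less n)
    consider "n = 1" | "n = 2" | "n \<ge> 3" using less.prems by linarith
    then show ?case
    proof cases
      case 1
      then show ?thesis by (simp add: S_def c_def cheb_0)
    next
      case 2
      have "cheb 2 1 = x" using cheb_half[of 1] by simp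
      then show ?thesis using 2 by (simp add: S_def c_def cheb_0 numeral_2_eq_2 pi_plus_Suc)
    next
      case 3
      then obtain m where m: "n = Suc (Suc m)" "m > 0" by (cases n; cases "n - 1") auto
      have "S n = (\<Sum>k\<le>n. (1 + x ^ (n - 1)) * ((-1) ^ k * c (n - 1) k) + (-1) ^ k * (if k = 0 then 0 else x ^ (n - 1) * c (n - 2) (k - 1)))"
        unfolding S_def by (rule sum.cong[OF refl]) (subst rec[OF 3], simp add: algebra_simps)
      also have "\<dots> = (1 + x ^ (n - 1)) * (\<Sum>k\<le>n. (-1) ^ k * c (n - 1) k) + (\<Sum>k\<le>n. (-1) ^ k * (if k = 0 then 0 else x ^ (n - 1) * c (n - 2) (k - 1)))"
        by (simp add: sum.distrib sum_distrib_left)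
      also have "(\<Sum>k\<le>n. (-1) ^ k * c (n - 1) k) = S (n - 1)"
        unfolding S_def m by (simp add: c_def)
      also have "(\<Sum>k\<le>n. (-1) ^ k * (if k = 0 then 0 else x ^ (n - 1) * c (n - 2) (k - 1))) = - (x ^ (n - 1) * S (n - 2))"
      proof -
        have "(\<Sum>k\<le>n. (-1) ^ k * (if k = 0 then 0 else x ^ (n - 1) * c (n - 2) (k - 1)))
          = (\<Sum>k\<le>Suc m. (-1) ^ Suc k * (x ^ (n - 1) * c m k))"
          unfolding m by (subst sum.atMost_Suc_shift) simp
        also have "\<dots> = (\<Sum>k\<le>m. (-1) ^ Suc k * (x ^ (n - 1) * c m k))"
          using m(2) by (simp add: c_def)
        also have "\<dots> = - (x ^ (n - 1) * S m)" by (simp add: S_def sum_distrib_left sum_negf mult.left_commute)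
        finally show ?thesis using m by simp
      qed
      finally show ?thesis using less.IH[of "n - 1"] less.IH[of "n - 2"] m by simp
    qed
  qed
  then have "S n = 1" using assms by blast
  moreover have "S n = (\<Sum>k = 0..n div 2. (-1) ^ k * cheb n k)"
    unfolding S_def by (rule sum.mono_neutral_cong_right) (auto simp: c_def)
  ultimately show ?thesis by simp
qed

lemma cheb_eq:
  assumes "n > 0" "2 * k \<le> n"
  shows "x ^ (k ^ 2) * (q_sum x n / q_sum x (2 * n - 2 * k)) * (q_factorial x (n - k) / (q_factorial x k * q_factorial x (n - 2 * k)))
     * (pi_plus x (n - k) / pi_plus x k) = cheb n k"
proof -
  obtain m where m: "n - k = Suc m" using assms by (cases "n - k") auto
  have "2 * n - 2 * k = 2 * Suc m" using m by simp
  then have "q_sum x (2 * n - 2 * k) = q_sum x (Suc m) * opx (Suc m)"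
    by (simp only: q_sum_double_opx)
  moreover have "n - k - 1 = m" using m by simp
  ultimately show ?thesis unfolding cheb_def m
    by (simp add: q_factorial_Suc pi_plus_opx field_simps del: power_Suc)
qed

text \<open>The factor in front of \<open>cheb\<close> does not depend on \<open>k\<close>, which is
  what lets it cancel in the quotient. The product in the denominator is
  \<open>(1 - x\<^sup>2) ^ k\<close> times a ratio of factorials at \<open>x\<^sup>2\<close>, and
  its powers of \<open>1 - x\<close> cancel against those on the left.\<close>

lemma cheb_eq2:
  assumes "n > 0" "2 * k \<le> n"
  shows "((1 - x) / (1 + x)) ^ k * x ^ k * (q_factorial (x\<^sup>2) n / q_factorial x (n - 2 * k))
      * (x ^ (k * (k - 1)) / (q_factorial (x\<^sup>2) k * (\<Prod>i<k. 1 - (x\<^sup>2) ^ (n - 1 - i))))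
    = q_factorial (x\<^sup>2) n / (q_factorial x n * pi_plus x (n - 1)) * cheb n k"
proof -
  have x2: "1 - x\<^sup>2 = (1 - x) * (1 + x)" by (simp add: power2_eq_square algebra_simps)
  have P: "(\<Prod>i<k. 1 - (x\<^sup>2) ^ (n - 1 - i)) * q_factorial (x\<^sup>2) (n - 1 - k) = (1 - x\<^sup>2) ^ k * q_factorial (x\<^sup>2) (n - 1)"
    if "k \<le> n - 1" for k
    using that
  proof (induction k)
    case (Suc k)
    then obtain m where m: "n - 1 - k = Suc m" by (cases "n - 1 - k") auto
    then have m': "n - 1 - Suc k = m" by simp
    have "(\<Prod>i<Suc k. 1 - (x\<^sup>2) ^ (n - 1 - i)) * q_factorial (x\<^sup>2) (n - 1 - Suc k)
       = (\<Prod>i<k. 1 - (x\<^sup>2) ^ (n - 1 - i)) * (1 - (x\<^sup>2) ^ Suc m) * q_factorial (x\<^sup>2) m"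
      unfolding m' prod.lessThan_Suc m by (rule refl)
    also have "\<dots> = (1 - x\<^sup>2) * ((\<Prod>i<k. 1 - (x\<^sup>2) ^ (n - 1 - i)) * q_factorial (x\<^sup>2) (n - 1 - k))"
      unfolding m q_sum_mult[symmetric] by (simp add: q_factorial_Suc algebra_simps)
    also have "\<dots> = (1 - x\<^sup>2) ^ Suc k * q_factorial (x\<^sup>2) (n - 1)"
      using Suc by simp
    finally show ?case .
  qed simp
  have F0: "q_factorial (x\<^sup>2) m \<noteq> 0" for m unfolding q_factorial_square_eq by simp
  have kn: "k \<le> n - 1" using assms by linarith
  then obtain m where m: "n = k + m + 1" using assms(1) by (metis Suc_pred' add.commute le_add_diff_inverse plus_1_eq_Suc)
  have nk: "n - 1 - k = m" "n - k - 1 = m" "n - 1 = k + m" using m by auto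
  have P': "(\<Prod>i<k. 1 - (x\<^sup>2) ^ (n - 1 - i)) = ((1 - x) * (1 + x)) ^ k * q_factorial (x\<^sup>2) (k + m) / q_factorial (x\<^sup>2) m"
    using P[OF kn] F0[of m] unfolding nk x2 by (simp add: eq_divide_eq)
  have N: "q_factorial x n = q_factorial x (k + m) * q_sum x n"
    using m by (simp add: q_factorial_Suc)
  have N0: "q_sum x n \<noteq> 0" using m by simp
  have kk: "x ^ (k ^ 2) = x ^ k * x ^ (k * (k - 1))"
    unfolding power_add[symmetric] by (cases k) (simp_all add: power2_eq_square)
  \<comment> \<open>The remaining identity is proved with letters in place of its factors:
    \<open>c\<close> treats the left side, \<open>d\<close> the right side, and both arrive at the
    same normal form.\<close>
  have c: "a / b * y * (F / r) * (X / (K * (a * b * KM / M))) = F * (y * X) * M / (r * K * KM * (b * b))"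
    if "a \<noteq> 0" "b \<noteq> 0" "M \<noteq> 0" "r \<noteq> 0" "K \<noteq> 0" "KM \<noteq> 0" for a b y F r X K KM M :: 'f
    using that by (simp add: field_simps)
  have d: "F / (qKM * N * pKM) * (y * X * N * (qM * pM) / (qK * pK * r))
     = F * (y * X) * (qM * pM / u) / (r * (qK * pK / v) * (qKM * pKM / (v * u)) * (v * v))"
    if "u \<noteq> 0" "v \<noteq> 0" "N \<noteq> 0" "qKM \<noteq> 0" "pKM \<noteq> 0" "qK \<noteq> 0" "pK \<noteq> 0" "r \<noteq> 0" for F qKM N pKM y X qM pM qK pK r u v :: 'f
    using that by (simp add: field_simps)
  show ?thesis
    unfolding P'
    unfolding cheb_def kk N nk power_divide power_mult_distrib
    unfolding q_factorial_square_eq[of m] q_factorial_square_eq[of k] q_factorial_square_eq[of "k + m"] power_add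
    by (rule trans[OF c d[symmetric]]) (simp_all add: N0)
qed

text \<open>With \<open>b = x ^ (r + 1)\<close> and the common factors removed this is
  \<open>1 + b * x = (1 + x) - x * (1 - b)\<close>. It is the recursion that
  \<open>sum_invol_maps\<close> demands for level 0.\<close>

lemma pi_plus_rec:
  "pi_plus x (Suc (Suc r)) / (1 + x) ^ Suc (Suc r) = pi_plus x (Suc r) / (1 + x) ^ Suc r
    + (x - 1) / (x + 1) * x * q_sum (x\<^sup>2) (Suc r) * (pi_plus x r / (1 + x) ^ r)"
proof -
  have q: "q_sum (x\<^sup>2) (Suc r) = (1 - x ^ Suc r) / (1 - x) * (1 + x ^ Suc r) / (1 + x)"
    using q_sum_square[of x "Suc r"] unfolding q_sum_closed by (simp add: eq_divide_eq mult_ac)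
  have xx: "x - 1 \<noteq> 0" "x + 1 \<noteq> 0" using x_neq_1 plus_neq_0 by (auto simp: add.commute)
  define b where "b = x ^ Suc r"
  have b2: "x ^ Suc (Suc r) = b * x" by (simp add: b_def)
  have "P * (1 + b) * (1 + b * x) / (u * (1 + x) * (1 + x)) = P * (1 + b) / (u * (1 + x))
     + (x - 1) / (x + 1) * x * ((1 - b) / (1 - x) * (1 + b) / (1 + x)) * (P / u)" if "u \<noteq> 0" for P u
  proof -
    have e1: "(x - 1) / (x + 1) * x * ((1 - b) / (1 - x) * (1 + b) / (1 + x)) * (P / u)
      = - (x * (1 - b) * (1 + b) * P / (u * (1 + x) * (1 + x)))"
      using that xx x_neq_1 plus_neq_0 by (simp add: divide_simps) (simp add: algebra_simps)
    have e2: "P * (1 + b) / (u * (1 + x)) = P * (1 + b) * (1 + x) / (u * (1 + x) * (1 + x))"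
      using plus_neq_0 that by (simp add: divide_simps)
    have e3: "P * (1 + b) * (1 + b * x) = P * (1 + b) * (1 + x) - x * (1 - b) * (1 + b) * P"
      by (simp add: algebra_simps)
    show ?thesis unfolding e1 e2 e3 by (subst diff_divide_distrib) simp
  qed
  note this[of "(1 + x) ^ r" "pi_plus x r"]
  moreover have "(1 + x) ^ r \<noteq> 0" by simp
  ultimately show ?thesis
    unfolding q pi_plus_Suc b2 b_def[symmetric] unfolding power_Suc2[of "1 + x"] by blast
qed

text \<open>The total weight of the chains starting at \<open>k\<close>. The recursion
  \<open>hfix_rec\<close> determines it from its value 1 at \<open>k = 0\<close>, since for
  \<open>0 < k < n\<close> the term \<open>j = k\<close> has the coefficient
  \<open>x ^ (2 * k * (n - k))\<close>, which is not 1.\<close>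

definition hfix :: "nat \<Rightarrow> nat \<Rightarrow> 'f" where
  "hfix n k = x ^ (k * (k - 1)) / (q_factorial (x\<^sup>2) k * (\<Prod>i<k. 1 - (x\<^sup>2) ^ (n - 1 - i)))"

lemma hfix_denominator_neq_0:
  assumes "k < n"
  shows "q_factorial (x\<^sup>2) k * (\<Prod>i<k. 1 - (x\<^sup>2) ^ (n - 1 - i)) \<noteq> 0"
proof -
  have "(x\<^sup>2) ^ (n - 1 - i) \<noteq> 1" if "i < k" for i
  proof -
    have "2 * (n - 1 - i) > 0" using that assms by simp
    then show ?thesis using pow_neq_1[of "2 * (n - 1 - i)"] by (simp add: power_mult)
  qed
  then show ?thesis by (simp add: q_factorial_square_eq)
qed

text \<open>With \<open>p = x\<^sup>2\<close> and \<open>y = p ^ (n - k)\<close>, the product in the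
  denominator at \<open>k\<close> splits into the one at \<open>j\<close> and the Pochhammer product
  of \<open>y\<close> of length \<open>k - j\<close>. Divided by \<open>hfix n k\<close>, the
  summands become those of \<open>gauss_binomial_partition\<close>, whose total is 1.\<close>

lemma hfix_rec:
  assumes k: "k < n"
  shows "hfix n k = (\<Sum>j\<le>k. x ^ ((k - j) * (k - j - 1) + 2 * j * (n - j)) / q_factorial (x\<^sup>2) (k - j) * hfix n j)"
proof -
  define p where "p = x\<^sup>2"
  define P where "P k = (\<Prod>i<k. 1 - p ^ (n - 1 - i))" for k
  define F where "F = q_factorial p"
  have h: "hfix n j = x ^ (j * (j - 1)) / (F j * P j)" for j by (simp add: hfix_def p_def P_def F_def)
  have nz: "F j \<noteq> 0" "P j \<noteq> 0" if "j \<le> k" for j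
    using hfix_denominator_neq_0[of j n] that k by (auto simp: p_def P_def F_def)
  have split: "P k = P j * (\<Prod>l<k-j. 1 - p ^ (n - k) * p ^ l)" if j: "j \<le> k" for j
  proof -
    define g where "g i = 1 - p ^ (n - 1 - i)" for i
    have "{..<k} = {..<j} \<union> {j..<k}" using j by auto
    then have "P k = P j * prod g {j..<k}"
      unfolding P_def g_def by (simp add: prod.union_disjoint ivl_disj_int)
    also have "prod g {j..<k} = (\<Prod>i<k-j. g (j + i))"
      using prod.shift_bounds_nat_ivl[of g 0 j "k - j"] j by (simp add: lessThan_atLeast0 add.commute)
    also have "\<dots> = (\<Prod>l<k-j. g (j + (k - j - Suc l)))"
      by (rule prod.nat_diff_reindex[symmetric])
    also have "\<dots> = (\<Prod>l<k-j. 1 - p ^ (n - k) * p ^ l)"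
    proof (rule prod.cong[OF refl])
      fix l assume "l \<in> {..<k-j}"
      then have "n - 1 - (j + (k - j - Suc l)) = (n - k) + l" using j k by auto
      then show "g (j + (k - j - Suc l)) = 1 - p ^ (n - k) * p ^ l" by (simp only: g_def power_add)
    qed
    finally show ?thesis .
  qed
  have "(\<Sum>j\<le>k. x ^ ((k - j) * (k - j - 1) + 2 * j * (n - j)) / F (k - j) * hfix n j)
    = (\<Sum>j\<le>k. hfix n k * (gauss_binomial p k j * (p ^ (n - k)) ^ j * (\<Prod>l<k-j. 1 - p ^ (n - k) * p ^ l)))"
  proof (rule sum.cong[OF refl])
    fix j assume "j \<in> {..k}"
    then have j: "j \<le> k" by simp
    define Q where "Q = (\<Prod>l<k-j. 1 - p ^ (n - k) * p ^ l)"
    have Q0: "Q \<noteq> 0" using split[OF j] nz(2)[of k] by (auto simp: Q_def)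
    have g: "gauss_binomial p k j = F k / (F j * F (k - j))"
      using gauss_binomial_factorial[OF j, of p] nz(1)[OF j] nz(1)[of "k - j"] by (simp add: F_def eq_divide_eq)
    have "(k - j) * (k - j - 1) + 2 * j * (n - j) + j * (j - 1) = k * (k - 1) + 2 * ((n - k) * j)"
    proof -
      obtain d e where d: "k = j + d" "n = k + e" using j k by (metis le_add_diff_inverse less_imp_le)
      show ?thesis unfolding d by (cases j; cases d) (auto simp: algebra_simps)
    qed
    then have "x ^ ((k - j) * (k - j - 1) + 2 * j * (n - j)) * x ^ (j * (j - 1)) = x ^ (k * (k - 1)) * (p ^ (n - k)) ^ j"
      unfolding p_def by (simp only: power_add[symmetric] power_mult[symmetric] mult.assoc)
    then have "x ^ ((k - j) * (k - j - 1) + 2 * j * (n - j)) / F (k - j) * hfix n j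
       = x ^ (k * (k - 1)) * (p ^ (n - k)) ^ j / (F (k - j) * F j * P j)"
      unfolding h by simp
    also have "\<dots> = hfix n k * (gauss_binomial p k j * (p ^ (n - k)) ^ j * Q)"
      unfolding h g split[OF j, folded Q_def] using nz[OF j] nz(1)[of "k - j"] nz(1)[of k] Q0 by (simp add: field_simps)
    finally show "x ^ ((k - j) * (k - j - 1) + 2 * j * (n - j)) / F (k - j) * hfix n j
      = hfix n k * (gauss_binomial p k j * (p ^ (n - k)) ^ j * (\<Prod>l<k-j. 1 - p ^ (n - k) * p ^ l))"
      unfolding Q_def .
  qed
  also have "\<dots> = hfix n k"
    unfolding sum_distrib_left[symmetric] gauss_binomial_partition by simp
  finally show ?thesis by (simp add: F_def p_def)
qed

end

section \<open>Transfer from Laurent series to power series\<close>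

lemma fls_sum: "fps_to_fls (\<Sum>i\<in>A. f i) = (\<Sum>i\<in>A. fps_to_fls (f i))"
  by (induction A rule: infinite_finite_induct) auto

lemma fls_prod: "fps_to_fls (\<Prod>i\<in>A. f i) = (\<Prod>i\<in>A. fps_to_fls (f i :: 'k::field fps))"
  by (induction A rule: infinite_finite_induct) (auto simp: fls_times_fps_to_fls)

lemma fls_divide: "g $ 0 \<noteq> 0 \<Longrightarrow> fps_to_fls (f / g) = fps_to_fls f / fps_to_fls (g :: 'k::field fps)"
  by (rule fls_divide_fps_to_fls[symmetric]) (simp add: subdegree_eq_0)

lemma fls_power: "fps_to_fls (f ^ m) = fps_to_fls (f :: 'k::field fps) ^ m"
  by (induction m) (auto simp: fls_times_fps_to_fls)

lemma fls_q_sum: "fps_to_fls (q_sum x m) = q_sum (fps_to_fls (x :: 'k::field fps)) m"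
  by (simp add: q_sum_def fls_sum fls_power)

lemma fls_q_factorial: "fps_to_fls (q_factorial x m) = q_factorial (fps_to_fls (x :: 'k::field fps)) m"
  by (simp add: q_factorial_def fls_prod fls_q_sum)

lemma fls_pi_plus: "fps_to_fls (pi_plus x m) = pi_plus (fps_to_fls (x :: 'k::field fps)) m"
  by (simp add: pi_plus_def fls_prod fls_power)

lemma q_sum_nth_0: "x $ 0 = 0 \<Longrightarrow> m > 0 \<Longrightarrow> q_sum (x :: 'k::field fps) m $ 0 = 1"
  by (cases m) (simp_all add: q_sum_def fps_sum_nth fps_power_zeroth sum.lessThan_Suc_shift del: sum.lessThan_Suc)

lemma q_factorial_nth_0 [simp]: "x $ 0 = 0 \<Longrightarrow> q_factorial (x :: 'k::field fps) m $ 0 = 1"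
  by (induction m) (simp_all add: q_factorial_Suc q_sum_nth_0)

lemma pi_plus_nth_0 [simp]: "x $ 0 = 0 \<Longrightarrow> pi_plus (x :: 'k::field fps) m $ 0 = 1"
  by (induction m) (simp_all add: pi_plus_Suc fps_power_zeroth)

text \<open>Identities are proved at \<open>fls_X\<close> and pulled back along the injective
  \<open>fps_to_fls\<close>. It commutes with the quotients that occur, because their denominators
  have nonzero constant term.\<close>

interpretation F: generic_field "fls_X :: 'k::field fls"
proof
  fix i :: nat assume i: "i > 0"
  have "(fps_X ^ i :: 'k fps) $ 0 \<noteq> 1 $ 0" using i by (simp add: fps_power_zeroth power_0_left)
  then have "(fps_X ^ i :: 'k fps) \<noteq> 1" by metis
  then have "fps_to_fls (fps_X ^ i :: 'k fps) \<noteq> fps_to_fls 1"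
    using fps_to_fls_eq_imp_fps_eq by blast
  then show "(fls_X :: 'k fls) ^ i \<noteq> 1"
    by (simp only: fps_to_fls_power fps_X_to_fls fps_one_to_fls not_False_eq_True)
qed

lemma fls_ratio:
  "fps_to_fls ((1 - fps_X) / (1 + fps_X) :: 'k::field fps) = (1 - fls_X) / (1 + fls_X)"
  "fps_to_fls ((fps_X - 1) / (fps_X + 1) :: 'k::field fps) = (fls_X - 1) / (fls_X + 1)"
  by (subst fls_divide; simp)+

lemma fls_factorial_ratio:
  "fps_to_fls (q_factorial (fps_X\<^sup>2) a / q_factorial fps_X b :: 'k::field fps) = q_factorial (fls_X\<^sup>2) a / q_factorial fls_X b"
  by (subst fls_divide) (simp_all add: fls_q_factorial fls_power)

lemma q_int_eq: "q_int m = q_sum fps_X m"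
proof -
  have "(1 - fps_X :: 'a fps) \<noteq> 0"
    by (metis diff_eq_diff_eq diff_zero eq_iff_diff_eq_0 fps_X_neq_one)
  then show ?thesis unfolding q_int_def q_sum_mult[symmetric] by simp
qed

lemma q_fact_eq: "q_fact m = q_factorial fps_X m"
  by (simp add: q_fact_def q_factorial_def q_int_eq)

lemma q_pochhammer_pi_plus: "q_pochhammer (- (fps_X ^ (k + 1))) m * pi_plus fps_X k = pi_plus fps_X (k + m)"
proof (induction m)
  case (Suc m)
  have "q_pochhammer (- (fps_X ^ (k + 1))) (Suc m) = q_pochhammer (- (fps_X ^ (k + 1))) m * (1 + fps_X ^ (Suc (k + m)) :: 'a fps)"
    by (simp add: q_pochhammer_def power_add)
  then show ?case using Suc by (simp add: pi_plus_Suc mult.commute mult.left_commute del: power_Suc)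
qed (simp add: q_pochhammer_def)

definition chebyshev_coeff :: "nat \<Rightarrow> nat \<Rightarrow> 'k::field fps" where
  "chebyshev_coeff n k = fps_X ^ (k ^ 2) * (q_int n / q_int (2 * n - 2 * k))
       * q_binomial (n - k) k * q_pochhammer (- (fps_X ^ (k + 1))) (n - 2 * k)"

lemma chebyshev_coeff_fls:
  assumes "n > 0" "2 * k \<le> n"
  shows "fps_to_fls (chebyshev_coeff n k :: 'k::field fps) = F.cheb n k"
proof -
  have e: "n - k = k + (n - 2 * k)" using assms by simp
  have "q_pochhammer (- (fps_X ^ (k + 1))) (n - 2 * k) * pi_plus fps_X k = pi_plus (fps_X :: 'k fps) (n - k)"
    unfolding e by (rule q_pochhammer_pi_plus)
  from arg_cong[OF this, of fps_to_fls]
  have "fps_to_fls (q_pochhammer (- (fps_X ^ (k + 1))) (n - 2 * k)) * pi_plus (fls_X :: 'k fls) k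
     = pi_plus fls_X (n - k)"
    by (simp only: fls_pi_plus fls_times_fps_to_fls fps_X_to_fls)
  then have "fps_to_fls (q_pochhammer (- (fps_X ^ (k + 1))) (n - 2 * k))
     = pi_plus fls_X (n - k) / pi_plus (fls_X :: 'k fls) k"
    by (simp add: eq_divide_eq)
  moreover have "q_sum (fps_X :: 'k fps) (2 * n - 2 * k) $ 0 \<noteq> 0"
    using assms by (subst q_sum_nth_0) auto
  moreover have "n - k - k = n - 2 * k" by simp
  ultimately show ?thesis
    unfolding chebyshev_coeff_def q_int_eq q_binomial_def q_fact_eq F.cheb_eq[OF assms, symmetric]
    by (simp add: fls_times_fps_to_fls fls_divide fls_power fls_q_sum fls_q_factorial)
qed

definition limit_weight :: "nat \<Rightarrow> nat \<Rightarrow> 'k::field fps" where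
  "limit_weight n k = fps_X ^ (k * (k - 1)) / (q_factorial (fps_X\<^sup>2) k * (\<Prod>i<k. 1 - (fps_X\<^sup>2) ^ (n - 1 - i)))"

lemma limit_weight_denominator:
  assumes "k < n"
  shows "(q_factorial (fps_X\<^sup>2) k * (\<Prod>i<k. 1 - (fps_X\<^sup>2) ^ (n - 1 - i)) :: 'k::field fps) $ 0 = 1"
proof -
  have "(\<Prod>i<m. 1 - (fps_X\<^sup>2) ^ (n - 1 - i) :: 'k fps) $ 0 = 1" if "m \<le> k" for m
    using that assms by (induction m) (auto simp: fps_power_zeroth power_mult[symmetric])
  from this[of k] show ?thesis by (simp add: fps_power_zeroth)
qed

lemma limit_weight_fls:
  assumes "k < n"
  shows "fps_to_fls (limit_weight n k :: 'k::field fps) = F.hfix n k"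
  unfolding limit_weight_def F.hfix_def using limit_weight_denominator[OF assms, where 'k = 'k]
  by (subst fls_divide) (simp_all add: fls_times_fps_to_fls fls_power fls_q_factorial fls_prod)

lemma limit_weight_rec:
  assumes "k < n"
  shows "(limit_weight n k :: 'k::field fps) = (\<Sum>j\<le>k. fps_X ^ ((k - j) * (k - j - 1) + 2 * j * (n - j))
     / q_factorial (fps_X\<^sup>2) (k - j) * limit_weight n j)"
proof (rule fps_to_fls_eq_imp_fps_eq)
  have "fps_to_fls (\<Sum>j\<le>k. fps_X ^ ((k - j) * (k - j - 1) + 2 * j * (n - j))
     / q_factorial (fps_X\<^sup>2) (k - j) * limit_weight n j :: 'k fps)
    = (\<Sum>j\<le>k. fls_X ^ ((k - j) * (k - j - 1) + 2 * j * (n - j))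
     / q_factorial (fls_X\<^sup>2) (k - j) * F.hfix n j)"
    unfolding fls_sum
    by (rule sum.cong[OF refl]) (use assms in \<open>simp add: fls_times_fps_to_fls fls_divide fls_power fls_q_factorial limit_weight_fls fps_power_zeroth\<close>)
  then show "fps_to_fls (limit_weight n k) = fps_to_fls (\<Sum>j\<le>k. fps_X ^ ((k - j) * (k - j - 1) + 2 * j * (n - j))
     / q_factorial (fps_X\<^sup>2) (k - j) * limit_weight n j :: 'k fps)"
    unfolding limit_weight_fls[OF assms] F.hfix_rec[OF assms] by simp
qed

section \<open>Convergence of the recursion\<close>

primrec partial_weight :: "nat \<Rightarrow> nat \<Rightarrow> nat \<Rightarrow> 'k::field fps" where
  "partial_weight n 0 k = (if k = 0 then 1 else 0)"
| "partial_weight n (Suc B) k = (\<Sum>j\<le>k. fps_X ^ ((k - j) * (k - j - 1) + 2 * j * (n - j))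
     / q_factorial (fps_X\<^sup>2) (k - j) * partial_weight n B j)"

lemma partial_weight_0: "partial_weight n B 0 = (1 :: 'k::field fps)"
  by (induction B) simp_all

text \<open>One step multiplies the error at \<open>j\<close> by a power whose exponent is at least
  \<open>2 * j * (n - j)\<close>, positive for \<open>0 < j < n\<close>. At \<open>j = 0\<close>
  both weights are 1 and there is no error, so each step gains a factor
  \<open>fps_X\<close>.\<close>

lemma partial_weight_limit:
  assumes "k < n"
  shows "fps_X ^ B dvd (limit_weight n k - partial_weight n B k :: 'k::field fps)"
  using assms
proof (induction B arbitrary: k)
  case (Suc B)
  have "limit_weight n k - partial_weight n (Suc B) k = (\<Sum>j\<le>k. fps_X ^ ((k - j) * (k - j - 1) + 2 * j * (n - j))
     / q_factorial (fps_X\<^sup>2) (k - j) * (limit_weight n j - partial_weight n B j) :: 'k fps)"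
    by (subst limit_weight_rec[OF Suc.prems]) (simp add: sum_subtractf right_diff_distrib)
  also have "fps_X ^ Suc B dvd \<dots>"
  proof (rule dvd_sum)
    fix j assume "j \<in> {..k}"
    then have j: "j < n" using Suc.prems by simp
    show "fps_X ^ Suc B dvd (fps_X ^ ((k - j) * (k - j - 1) + 2 * j * (n - j))
     / q_factorial (fps_X\<^sup>2) (k - j) * (limit_weight n j - partial_weight n B j) :: 'k fps)"
    proof (cases "j = 0")
      case True
      then show ?thesis by (simp add: partial_weight_0 limit_weight_def)
    next
      case False
      define e where "e = (k - j) * (k - j - 1) + 2 * j * (n - j)"
      have "j * (n - j) > 0" using False j by simp
      then have "e > 0" by (simp add: e_def)
      then have "fps_X dvd (fps_X ^ e :: 'k fps)" by (metis dvd_power)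
      moreover have "fps_X ^ e / q_factorial (fps_X\<^sup>2) (k - j) = (fps_X ^ e * inverse (q_factorial (fps_X\<^sup>2) (k - j)) :: 'k fps)"
        by (rule fps_divide_unit) (simp add: fps_power_zeroth)
      ultimately have "fps_X dvd (fps_X ^ e / q_factorial (fps_X\<^sup>2) (k - j) :: 'k fps)" by simp
      then show ?thesis unfolding power_Suc e_def[symmetric] using Suc.IH[OF j] by (rule mult_dvd_mono)
    qed
  qed
  finally show ?case .
qed simp

text \<open>Closed form of the series \<open>L\<close> of the symmetric group on \<open>r\<close>
  letters; it describes level 0 of size \<open>r\<close>.\<close>

definition sym_L :: "nat \<Rightarrow> 'k::field fps" where
  "sym_L r = pi_plus fps_X r / (1 + fps_X) ^ r"

lemma sym_L_fls: "fps_to_fls (sym_L r :: 'k::field fps) = pi_plus fls_X r / (1 + fls_X) ^ r"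
  unfolding sym_L_def by (subst fls_divide) (simp_all add: fps_power_zeroth fls_pi_plus fls_power)

lemma sym_L_0: "sym_L 0 = 1" and sym_L_1: "sym_L 1 = (1 :: 'k::field fps)"
proof -
  show "sym_L 0 = 1" by (simp add: sym_L_def)
  have "(1 + fps_X :: 'k fps) $ 0 \<noteq> 0 $ 0" by simp
  then have "(1 + fps_X :: 'k fps) \<noteq> 0" by metis
  then show "sym_L 1 = (1 :: 'k fps)" by (simp add: sym_L_def pi_plus_def)
qed

lemma sym_L_rec:
  "sym_L (Suc (Suc r)) = (sym_L (Suc r) + (fps_X - 1) / (fps_X + 1) * fps_X * q_sum (fps_X\<^sup>2) (Suc r) * sym_L r :: 'k::field fps)"
proof (rule fps_to_fls_eq_imp_fps_eq)
  show "fps_to_fls (sym_L (Suc (Suc r))) = fps_to_fls (sym_L (Suc r) + (fps_X - 1) / (fps_X + 1) * fps_X * q_sum (fps_X\<^sup>2) (Suc r) * sym_L r :: 'k fps)"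
    unfolding sym_L_fls F.pi_plus_rec
    by (simp only: fps_to_fls_plus fls_times_fps_to_fls fls_ratio sym_L_fls fls_power fls_q_sum fps_X_to_fls)
qed

text \<open>A consequence of \<open>q_factorial_square\<close>, relating \<open>L(q)\<close>,
  \<open>P(q\<^sup>2)\<close> and \<open>P(q)\<close> of a symmetric group. It reduces the trace of
  level 0 to a single factorial.\<close>

lemma sym_L_quotient: "sym_L r / q_factorial (fps_X\<^sup>2) r = (1 / q_factorial fps_X r :: 'k::field fps)"
proof (rule fps_to_fls_eq_imp_fps_eq)
  show "fps_to_fls (sym_L r / q_factorial (fps_X\<^sup>2) r) = fps_to_fls (1 / q_factorial fps_X r :: 'k fps)"
    by (simp add: fls_divide fps_power_zeroth sym_L_fls fls_q_factorial fls_power F.q_factorial_square_eq)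
qed

text \<open>Here \<open>k\<close> is the number of positive values, hence of 2-cycles between
  nonzero levels. The ratio of factorials is what the rearrangements and level 0 leave
  behind.\<close>

definition involution_gf :: "nat \<Rightarrow> 'k::field \<Rightarrow> 'k fps" where
  "involution_gf n s = (\<Sum>k = 0..n div 2. fps_const (s ^ k) * ((1 - fps_X) / (1 + fps_X)) ^ k * fps_X ^ k
     * (q_factorial (fps_X\<^sup>2) n / q_factorial fps_X (n - 2 * k)) * limit_weight n k)"

text \<open>Each coefficient is the same series \<open>C\<close> times
  \<open>chebyshev_coeff n k\<close>. At \<open>s = -1\<close> these add up to 1 by
  \<open>cheb_alternating_sum\<close>, so the denominator is \<open>C\<close> itself.\<close>

theorem involution_gf_quotient:
  fixes s :: "'k::field"
  assumes n: "n > 0"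
  shows "involution_gf n s / involution_gf n (-1) = (\<Sum>k = 0..n div 2. fps_const (s ^ k) * chebyshev_coeff n k)"
proof -
  define C :: "'k fps" where "C = q_factorial (fps_X\<^sup>2) n / (q_factorial fps_X n * pi_plus fps_X (n - 1))"
  have Cf: "fps_to_fls C = q_factorial (fls_X\<^sup>2) n / (q_factorial fls_X n * pi_plus fls_X (n - 1))"
    unfolding C_def by (simp add: fls_divide fls_times_fps_to_fls fls_q_factorial fls_pi_plus fls_power)
  have C0: "C \<noteq> 0"
  proof
    assume "C = 0"
    then have "fps_to_fls C = 0" by simp
    then show False unfolding Cf by (simp add: F.q_factorial_square_eq)
  qed
  have "((1 - fps_X) / (1 + fps_X)) ^ k * fps_X ^ k * (q_factorial (fps_X\<^sup>2) n / q_factorial fps_X (n - 2 * k)) * limit_weight n k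
     = C * chebyshev_coeff n k" if k: "2 * k \<le> n" for k
  proof (rule fps_to_fls_eq_imp_fps_eq)
    have "k < n" using k n by linarith
    then show "fps_to_fls (((1 - fps_X) / (1 + fps_X)) ^ k * fps_X ^ k * (q_factorial (fps_X\<^sup>2) n / q_factorial fps_X (n - 2 * k)) * limit_weight n k)
      = fps_to_fls (C * chebyshev_coeff n k)"
      unfolding fls_times_fps_to_fls fls_power fls_ratio fls_factorial_ratio fps_X_to_fls
        limit_weight_fls[OF \<open>k < n\<close>] Cf chebyshev_coeff_fls[OF n k] F.hfix_def
      by (intro F.cheb_eq2[OF n k])
  qed
  then have main: "((1 - fps_X) / (1 + fps_X)) ^ k * (fps_X ^ k * ((q_factorial (fps_X\<^sup>2) n / q_factorial fps_X (n - 2 * k)) * limit_weight n k))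
     = C * chebyshev_coeff n k" if k: "2 * k \<le> n" for k
    using k by (simp only: mult.assoc)
  have G: "involution_gf n s = C * (\<Sum>k = 0..n div 2. fps_const (s ^ k) * chebyshev_coeff n k)" for s
    unfolding involution_gf_def sum_distrib_left
  proof (rule sum.cong[OF refl])
    fix k assume "k \<in> {0..n div 2}"
    then have k: "2 * k \<le> n" by auto
    show "fps_const (s ^ k) * ((1 - fps_X) / (1 + fps_X)) ^ k * fps_X ^ k * (q_factorial (fps_X\<^sup>2) n / q_factorial fps_X (n - 2 * k)) * limit_weight n k
      = C * (fps_const (s ^ k) * chebyshev_coeff n k)"
      unfolding mult.assoc main[OF k] by (rule mult.left_commute)
  qed
  have "fps_to_fls (\<Sum>k = 0..n div 2. fps_const ((-1) ^ k) * chebyshev_coeff n k :: 'k fps)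
    = (\<Sum>k = 0..n div 2. (-1) ^ k * F.cheb n k)"
    unfolding fls_sum
  proof (rule sum.cong[OF refl])
    fix k assume "k \<in> {0..n div 2}"
    then have k: "2 * k \<le> n" by auto
    have m1: "fps_const (-1) = (-1 :: 'k fps)"
      by (metis fps_const_1_eq_1 fps_const_neg)
    have "fps_const ((-1) ^ k) = ((-1) ^ k :: 'k fps)"
      unfolding fps_const_power[symmetric] m1 ..
    then show "fps_to_fls (fps_const ((-1) ^ k) * chebyshev_coeff n k :: 'k fps) = (-1) ^ k * F.cheb n k"
      by (simp only: fls_times_fps_to_fls chebyshev_coeff_fls[OF n k] fls_power fps_to_fls_uminus fps_one_to_fls)
  qed
  also have "\<dots> = fps_to_fls 1" using F.cheb_alternating_sum[OF n] by simp
  finally have "(\<Sum>k = 0..n div 2. fps_const ((-1) ^ k) * chebyshev_coeff n k) = (1 :: 'k fps)"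
    by (rule fps_to_fls_eq_imp_fps_eq)
  then have "involution_gf n (-1) = C" using G[of "-1"] by simp
  then show ?thesis using G[of s] C0 by simp
qed

subsection \<open>Summation over multiplicities\<close>

lemma fps_X_power_dvd_nth: "fps_X ^ B dvd (h :: 'k::field fps) \<Longrightarrow> m < B \<Longrightarrow> h $ m = 0"
  by (auto simp: dvd_def fps_X_power_mult_nth)

text \<open>Outside \<open>S B\<close> every term vanishes below degree \<open>B\<close>, so
  coefficient \<open>m\<close> of the infinite sum is already that of the finite sum over
  \<open>S (m + 1)\<close>.\<close>

lemma infsum_fps_limit:
  fixes f :: "'a \<Rightarrow> 'k::field fps"
  assumes fin: "\<And>B. finite (S B)" and sub: "\<And>B. S B \<subseteq> A"
    and far: "\<And>B z. z \<in> A \<Longrightarrow> z \<notin> S B \<Longrightarrow> fps_X ^ B dvd f z"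
    and lim: "\<And>B. fps_X ^ B dvd (g - sum f (S B))"
  shows "infsum f A = g"
proof (rule fps_ext)
  fix m
  have z: "{w \<in> A. f w $ k \<noteq> 0} \<subseteq> S (Suc k)" for k
    using far fps_X_power_dvd_nth[of "Suc k" _ k] by blast
  then have "finite {w \<in> A. f w $ k \<noteq> 0}" for k using fin finite_subset by blast
  then have "infsum f A $ m = (\<Sum>w | w \<in> A \<and> f w $ m \<noteq> 0. f w $ m)"
    by (rule infsum_fps_nth(2))
  also have "\<dots> = (\<Sum>w\<in>S (Suc m). f w $ m)"
    by (rule sum.mono_neutral_left) (use fin z[of m] sub[of "Suc m"] in auto)
  also have "\<dots> = sum f (S (Suc m)) $ m" by (simp add: fps_sum_nth)
  also have "\<dots> = g $ m"
    using fps_X_power_dvd_nth[OF lim[of "Suc m"], of m] by simp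
  finally show "infsum f A $ m = g $ m" .
qed

lemma card_eq_1_unique: "card S = 1 \<Longrightarrow> \<exists>!x. x \<in> S"
  by (metis card_1_singletonE singleton_iff)

lemma q_sum_zero: "m > 0 \<Longrightarrow> q_sum (0 :: int) m = 1"
  by (induction m) (auto simp: q_sum_Suc power_0_left)

lemma q_factorial_zero: "q_factorial (0 :: int) m = 1"
  by (induction m) (simp_all add: q_factorial_Suc q_sum_zero)

lemma sum_zero_power_card:
  assumes "finite S"
  shows "(\<Sum>x\<in>S. (0::int) ^ h x) = int (card {x \<in> S. h x = 0})"
proof -
  have "(\<Sum>x\<in>S. (0::int) ^ h x) = (\<Sum>x\<in>S. if h x = 0 then 1 else 0)"
    by (rule sum.cong) (auto simp: power_0_left)
  then show ?thesis using assms by (simp add: sum.If_cases Int_def)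
qed

section \<open>Multiplicity lists\<close>

primrec tail_exp :: "nat \<Rightarrow> nat list \<Rightarrow> nat" where
  "tail_exp n [] = 0"
| "tail_exp n (m # ms) = m * (m - 1) + 2 * sum_list ms * (n - sum_list ms) + tail_exp n ms"

definition list_weight :: "nat \<Rightarrow> nat list \<Rightarrow> 'k::field fps" where
  "list_weight n ms = fps_X ^ tail_exp n ms * inverse (prod_list (map (q_factorial (fps_X\<^sup>2)) ms))"

definition sum_lists :: "nat \<Rightarrow> nat \<Rightarrow> nat list set" where
  "sum_lists B k = {ms. length ms = B \<and> sum_list ms = k}"

lemma finite_sum_lists: "finite (sum_lists B k)"
proof (rule finite_subset)
  show "sum_lists B k \<subseteq> {ms. set ms \<subseteq> {..k} \<and> length ms = B}"
    by (auto simp: sum_lists_def member_le_sum_list)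
qed (rule finite_lists_length_eq, simp)

text \<open>Unrolls the recursion: the head of a list is the drop \<open>k - j\<close>, the tail
  sums to \<open>j\<close>, and \<open>tail_exp\<close> collects the exponents of the steps. Thus
  \<open>B\<close> steps account for the values up to \<open>B\<close>.\<close>

lemma partial_weight_lists: "(\<Sum>ms\<in>sum_lists B k. list_weight n ms) = (partial_weight n B k :: 'k::field fps)"
proof (induction B arbitrary: k)
  case 0
  have "sum_lists 0 k = (if k = 0 then {[]} else {})" by (auto simp: sum_lists_def)
  then show ?case by (simp add: list_weight_def)
next
  case (Suc B)
  have "(\<Sum>ms\<in>sum_lists (Suc B) k. list_weight n ms)
    = (\<Sum>(j, ms)\<in>Sigma {..k} (sum_lists B). list_weight n ((k - j) # ms) :: 'k fps)"
    by (rule sum.reindex_bij_witness[where i = "\<lambda>(j, ms). (k - j) # ms" and j = "\<lambda>ms. (sum_list (tl ms), tl ms)"])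
      (auto simp: sum_lists_def length_Suc_conv)
  also have "\<dots> = (\<Sum>j\<le>k. \<Sum>ms\<in>sum_lists B j. list_weight n ((k - j) # ms))"
    by (rule sum.Sigma[symmetric]) (auto simp: finite_sum_lists)
  also have "\<dots> = partial_weight n (Suc B) k"
    unfolding partial_weight.simps
  proof (rule sum.cong[OF refl])
    fix j assume "j \<in> {..k}"
    define q where "q = (q_factorial (fps_X\<^sup>2) (k - j) :: 'k fps)"
    have q: "x / q = x * inverse q" for x
      by (rule fps_divide_unit) (simp add: q_def fps_power_zeroth)
    have "(\<Sum>ms\<in>sum_lists B j. list_weight n ((k - j) # ms))
      = (\<Sum>ms\<in>sum_lists B j. fps_X ^ ((k - j) * (k - j - 1) + 2 * j * (n - j)) / q * list_weight n ms)"
      unfolding q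
      by (rule sum.cong[OF refl]) (simp add: list_weight_def sum_lists_def fps_inverse_mult power_add q_def mult_ac)
    then show "(\<Sum>ms\<in>sum_lists B j. list_weight n ((k - j) # ms))
      = fps_X ^ ((k - j) * (k - j - 1) + 2 * j * (n - j)) / q_factorial (fps_X\<^sup>2) (k - j) * (partial_weight n B j :: 'k fps)"
      by (simp add: Suc.IH[symmetric] sum_distrib_left q_def)
  qed
  finally show ?case .
qed

text \<open>Expresses \<open>tail_exp\<close> through the tail sums, which count the values above
  each threshold. The left side adds what \<open>tail_exp\<close> omits: the threshold 0, whose tail
  sum is that of the whole list, and the linear part of the terms
  \<open>m * (m - 1)\<close>.\<close>

lemma tail_exp_thresholds:
  assumes "sum_list ms \<le> n"
  shows "int (tail_exp n ms) + 2 * (int (sum_list ms) * (int n - int (sum_list ms))) + int (sum_list ms)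
    = (\<Sum>i<length ms. int (ms ! i) ^ 2) + 2 * (\<Sum>u<length ms. int (\<Sum>i\<in>{u..<length ms}. ms ! i) * (int n - int (\<Sum>i\<in>{u..<length ms}. ms ! i)))"
  using assms
proof (induction ms)
  case (Cons m ms)
  have sh: "(\<Sum>i\<in>{Suc u..<Suc (length ms)}. (m # ms) ! i) = (\<Sum>i\<in>{u..<length ms}. ms ! i)" for u
    using sum.shift_bounds_Suc_ivl[of "\<lambda>i. (m # ms) ! i" u "length ms"] by simp
  have "(\<Sum>i\<in>{0..<length (m # ms)}. (m # ms) ! i) = sum_list (m # ms)"
    by (rule sum_list_sum_nth[symmetric])
  then have s0: "(\<Sum>i\<in>{0..<Suc (length ms)}. (m # ms) ! i) = m + sum_list ms" by simp
  have mm: "int (m * (m - 1)) = int m ^ 2 - int m" by (cases m) (auto simp: power2_eq_square algebra_simps)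
  have nn: "int (n - sum_list ms) = int n - int (sum_list ms)" using Cons.prems by simp
  have IH: "int (tail_exp n ms) = (\<Sum>i<length ms. int (ms ! i) ^ 2) + 2 * (\<Sum>u<length ms. int (\<Sum>i\<in>{u..<length ms}. ms ! i) * (int n - int (\<Sum>i\<in>{u..<length ms}. ms ! i)))
     - 2 * (int (sum_list ms) * (int n - int (sum_list ms))) - int (sum_list ms)"
    using Cons by simp
  have te: "int (tail_exp n (m # ms)) = int m ^ 2 - int m + 2 * (int (sum_list ms) * (int n - int (sum_list ms))) + int (tail_exp n ms)"
    unfolding tail_exp.simps of_nat_add mm by (simp add: nn)
  show ?case
    unfolding te IH list.size(4) add_Suc_right add_0_right sum.lessThan_Suc_shift s0 sh
    by simp
qed simp

context affine begin

text \<open>Each of the values \<open>i + 1\<close> and \<open>- (i + 1)\<close> occurs \<open>ms ! i\<close> times; the remaining values are 0.\<close>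
definition mult :: "nat list \<Rightarrow> int \<Rightarrow> nat" where
  "mult ms v = (if v = 0 then n - 2 * sum_list ms
     else if \<bar>v\<bar> \<le> int (length ms) then ms ! nat (\<bar>v\<bar> - 1) else 0)"

definition Lists :: "nat \<Rightarrow> nat list set" where
  "Lists B = {ms. length ms = B \<and> 2 * sum_list ms \<le> n}"

lemma mult_uminus: "mult ms (- v) = mult ms v"
  by (simp add: mult_def)

lemma sum_split_sign:
  fixes F :: "int \<Rightarrow> 'b::comm_monoid_add"
  shows "sum F {- int B..int B} = F 0 + (\<Sum>i<B. F (int i + 1)) + (\<Sum>i<B. F (- (int i + 1)))"
proof (induction B)
  case (Suc B)
  have "{- int (Suc B)..int (Suc B)} = insert (int B + 1) (insert (- (int B + 1)) {- int B..int B})" by auto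
  then have "sum F {- int (Suc B)..int (Suc B)} = F (int B + 1) + (F (- (int B + 1)) + sum F {- int B..int B})"
    by (subst \<open>{- int (Suc B)..int (Suc B)} = _\<close>) simp
  then show ?case using Suc by (simp add: ac_simps)
qed simp

lemma prod_split_sign:
  fixes F :: "int \<Rightarrow> 'b::comm_monoid_mult"
  shows "prod F {- int B..int B} = F 0 * (\<Prod>i<B. F (int i + 1)) * (\<Prod>i<B. F (- (int i + 1)))"
proof (induction B)
  case (Suc B)
  have "{- int (Suc B)..int (Suc B)} = insert (int B + 1) (insert (- (int B + 1)) {- int B..int B})" by auto
  then have "prod F {- int (Suc B)..int (Suc B)} = F (int B + 1) * (F (- (int B + 1)) * prod F {- int B..int B})"
    by (subst \<open>{- int (Suc B)..int (Suc B)} = _\<close>) simp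
  then show ?case using Suc by (simp add: ac_simps)
qed simp

context
  fixes ms :: "nat list" and B :: nat
  assumes ms: "ms \<in> Lists B"
begin

lemma len_ms: "length ms = B" and sum_ms: "2 * sum_list ms \<le> n"
  using ms by (auto simp: Lists_def)

lemma mult_0: "mult ms 0 = n - 2 * sum_list ms" by (simp add: mult_def)

lemma mult_pos: "i < B \<Longrightarrow> mult ms (int i + 1) = ms ! i"
  by (simp add: mult_def len_ms)

lemma mult_neg: "i < B \<Longrightarrow> mult ms (- int i - 1) = ms ! i"
proof -
  have "- int i - 1 = - (int i + 1)" by simp
  then show "i < B \<Longrightarrow> mult ms (- int i - 1) = ms ! i" by (simp only: mult_uminus mult_pos)
qed

lemma mult_outside: "v \<notin> {- int B..int B} \<Longrightarrow> mult ms v = 0"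
  by (auto simp: mult_def len_ms)

lemma sum_nth_ms: "(\<Sum>i<B. ms ! i) = sum_list ms"
  unfolding sum_list_sum_nth len_ms by (simp add: lessThan_atLeast0)

lemma sum_mult: "sum (mult ms) {- int B..int B} = n"
  unfolding sum_split_sign mult_0 using sum_ms by (simp add: mult_pos mult_neg sum_nth_ms cong: sum.cong_simp)

lemma prod_mult_ms:
  fixes g :: "nat \<Rightarrow> 'b::comm_monoid_mult"
  shows "(\<Prod>v\<in>{- int B..int B}. g (mult ms v)) = g (n - 2 * sum_list ms) * (prod_list (map g ms) * prod_list (map g ms))"
    and "(\<Prod>v\<in>{1..int B}. g (mult ms v)) = prod_list (map g ms)"
proof -
  have e: "(\<Prod>i<B. g (ms ! i)) = prod_list (map g ms)"
    using prod.list_conv_set_nth[of "map g ms"] len_ms by (simp add: lessThan_atLeast0)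
  show "(\<Prod>v\<in>{- int B..int B}. g (mult ms v)) = g (n - 2 * sum_list ms) * (prod_list (map g ms) * prod_list (map g ms))"
    unfolding prod_split_sign mult_0 e[symmetric] by (simp add: mult_pos mult_neg mult.assoc cong: prod.cong_simp)
  have "(\<Prod>v\<in>{1..int B}. g (mult ms v)) = (\<Prod>i<B. g (mult ms (int i + 1)))"
    by (rule prod.reindex_bij_witness[where i = "\<lambda>i. int i + 1" and j = "\<lambda>v. nat (v - 1)"]) auto
  also have "\<dots> = (\<Prod>i<B. g (ms ! i))" by (simp add: mult_pos cong: prod.cong_simp)
  finally show "(\<Prod>v\<in>{1..int B}. g (mult ms v)) = prod_list (map g ms)" by (simp add: e)
qed

context
  fixes a :: "int \<Rightarrow> int"
  assumes a: "a \<in> words window (mult ms)"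
begin

lemma fiber_a: "fiber_card window a v = mult ms v"
  using a by (simp add: words_def)

lemma range_a: "i \<in> window \<Longrightarrow> a i \<in> {- int B..int B}"
  using words_range[OF finite_window a] mult_outside by fastforce

lemma card_fiber_sum:
  assumes "finite U"
  shows "card {i \<in> window. a i \<in> U} = sum (mult ms) U"
proof -
  have "{i \<in> window. a i \<in> U} = (\<Union>u\<in>U. {i \<in> window. a i = u})" by auto
  then have "card {i \<in> window. a i \<in> U} = (\<Sum>u\<in>U. card {i \<in> window. a i = u})"
    using assms by (simp only:) (rule card_UN_disjoint, auto)
  then show ?thesis using fiber_a by (simp add: fiber_card_def)
qed

lemma card_above:
  assumes u: "u < B"
  shows "card {i \<in> window. a i > int u} = (\<Sum>i\<in>{u..<B}. ms ! i)"
    and "card {i \<in> window. a i < - int u} = (\<Sum>i\<in>{u..<B}. ms ! i)"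
proof -
  have "{i \<in> window. a i > int u} = {i \<in> window. a i \<in> {int u + 1..int B}}" using range_a by auto
  then have "card {i \<in> window. a i > int u} = sum (mult ms) {int u + 1..int B}" by (simp only: card_fiber_sum finite_atLeastAtMost_int)
  also have "\<dots> = (\<Sum>i\<in>{u..<B}. ms ! i)"
    by (rule sum.reindex_bij_witness[where i = "\<lambda>i. int i + 1" and j = "\<lambda>v. nat (v - 1)"]) (auto simp: mult_pos[symmetric])
  finally show "card {i \<in> window. a i > int u} = (\<Sum>i\<in>{u..<B}. ms ! i)" .
  have "{i \<in> window. a i < - int u} = {i \<in> window. a i \<in> {- int B..- int u - 1}}" using range_a by auto
  then have "card {i \<in> window. a i < - int u} = sum (mult ms) {- int B..- int u - 1}" by (simp only: card_fiber_sum finite_atLeastAtMost_int)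
  also have "\<dots> = (\<Sum>i\<in>{u..<B}. ms ! i)"
    by (rule sum.reindex_bij_witness[where i = "\<lambda>i. - (int i + 1)" and j = "\<lambda>v. nat (- v - 1)"]) (auto simp: mult_neg[symmetric])
  finally show "card {i \<in> window. a i < - int u} = (\<Sum>i\<in>{u..<B}. ms ! i)" .
qed

lemma card_positive: "card {i \<in> window. a i > 0} = sum_list ms"
proof -
  have "{i \<in> window. a i > 0} = {i \<in> window. a i \<in> {1..int B}}" using range_a by auto
  then have "card {i \<in> window. a i > 0} = sum (mult ms) {1..int B}" by (simp only: card_fiber_sum finite_atLeastAtMost_int)
  also have "\<dots> = (\<Sum>i<B. ms ! i)"
    by (rule sum.reindex_bij_witness[where i = "\<lambda>i. int i + 1" and j = "\<lambda>v. nat (v - 1)"]) (auto simp: mult_pos[symmetric])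
  finally show ?thesis by (simp add: sum_nth_ms)
qed

lemma card_compl: "card {i \<in> window. \<not> P i} = n - card {i \<in> window. P i}"
proof -
  have "{i \<in> window. \<not> P i} = window - {i \<in> window. P i}" by auto
  then show ?thesis by (simp add: card_Diff_subset)
qed

text \<open>A gap \<open>a j - a i\<close> is the number of integer thresholds between the two
  values, so summing by thresholds gives products of the counts on the two sides. The number of
  pairs, which \<open>spread\<close> subtracts, comes from the squared multiplicities, and
  \<open>tail_exp_thresholds\<close> combines the two.\<close>

lemma spread_words: "spread a = sum_list ms + tail_exp n ms"
proof -
  define T where "T = {(i, j). i \<in> window \<and> j \<in> window \<and> a i < a j}"
  have finT: "finite T" by (simp add: T_def)
  define \<kappa> where "\<kappa> u = int (\<Sum>i\<in>{u..<B}. ms ! i)" for u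
  have \<kappa>le: "(\<Sum>i\<in>{u..<B}. ms ! i) \<le> n" if "u < B" for u
    unfolding card_above(1)[OF that, symmetric] using card_mono[OF finite_window, of "{i \<in> window. a i > int u}"] by auto
  have s1: "int (spread a) = (\<Sum>x\<in>T. a (snd x) - a (fst x)) - int (card T)"
  proof -
    have "int (spread a) = (\<Sum>x\<in>T. (a (snd x) - a (fst x)) - 1)"
      unfolding spread_def T_def[symmetric] of_nat_sum by (rule sum.cong[OF refl]) (auto simp: T_def)
    then show ?thesis by (simp add: sum_subtractf)
  qed
  have "(\<Sum>x\<in>T. a (snd x) - a (fst x)) = (\<Sum>x\<in>T. \<Sum>\<theta>\<in>{- int B..<int B}. if a (fst x) \<le> \<theta> \<and> \<theta> < a (snd x) then 1 else 0)"
  proof (rule sum.cong[OF refl])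
    fix x assume "x \<in> T"
    then have x: "fst x \<in> window" "snd x \<in> window" "a (fst x) < a (snd x)" by (auto simp: T_def)
    have "{\<theta> \<in> {- int B..<int B}. a (fst x) \<le> \<theta> \<and> \<theta> < a (snd x)} = {a (fst x)..<a (snd x)}"
      using range_a[OF x(1)] range_a[OF x(2)] by auto
    then show "a (snd x) - a (fst x) = (\<Sum>\<theta>\<in>{- int B..<int B}. if a (fst x) \<le> \<theta> \<and> \<theta> < a (snd x) then 1 else 0)"
      using x(3) by (simp only: sum_indicator_card finite_atLeastLessThan_int card_atLeastLessThan_int)
  qed
  also have "\<dots> = (\<Sum>\<theta>\<in>{- int B..<int B}. \<Sum>x\<in>T. if a (fst x) \<le> \<theta> \<and> \<theta> < a (snd x) then 1 else 0)"
    by (rule sum.swap)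
  also have "\<dots> = (\<Sum>\<theta>\<in>{- int B..<int B}. int (card {i \<in> window. \<not> a i > \<theta>}) * int (card {j \<in> window. a j > \<theta>}))"
  proof (rule sum.cong[OF refl])
    fix \<theta>
    have "{x \<in> T. a (fst x) \<le> \<theta> \<and> \<theta> < a (snd x)} = {i \<in> window. \<not> a i > \<theta>} \<times> {j \<in> window. a j > \<theta>}"
      by (auto simp: T_def)
    then show "(\<Sum>x\<in>T. if a (fst x) \<le> \<theta> \<and> \<theta> < a (snd x) then 1 else 0) = int (card {i \<in> window. \<not> a i > \<theta>}) * int (card {j \<in> window. a j > \<theta>})"
      by (simp only: sum_indicator_card[OF finT] card_cartesian_product of_nat_mult)
  qed
  \<comment> \<open>The thresholds \<open>u\<close> and \<open>- u - 1\<close> cut off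
    \<open>\<kappa> u\<close> values at the upper and at the lower end respectively, so both
    contribute \<open>\<kappa> u * (n - \<kappa> u)\<close>.\<close>
  also have "{- int B..<int B} = (\<lambda>u. int u) ` {..<B} \<union> (\<lambda>u. - int u - 1) ` {..<B}"
  proof (intro equalityI subsetI)
    fix v assume "v \<in> {- int B..<int B}"
    then show "v \<in> (\<lambda>u. int u) ` {..<B} \<union> (\<lambda>u. - int u - 1) ` {..<B}"
      by (cases "v \<ge> 0") (auto intro: image_eqI[of _ _ "nat v"] image_eqI[of _ _ "nat (- v - 1)"])
  qed auto
  also have "(\<Sum>\<theta>\<in>(\<lambda>u. int u) ` {..<B} \<union> (\<lambda>u. - int u - 1) ` {..<B}. int (card {i \<in> window. \<not> a i > \<theta>}) * int (card {j \<in> window. a j > \<theta>}))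
     = (\<Sum>u<B. (int n - \<kappa> u) * \<kappa> u) + (\<Sum>u<B. \<kappa> u * (int n - \<kappa> u))"
  proof -
    have d: "(\<lambda>u. int u) ` {..<B} \<inter> (\<lambda>u. - int u - 1) ` {..<B} = {}" by auto
    have 1: "int (card {i \<in> window. \<not> a i > int u}) * int (card {j \<in> window. a j > int u}) = (int n - \<kappa> u) * \<kappa> u" if "u < B" for u
      unfolding card_compl card_above(1)[OF that] \<kappa>_def using \<kappa>le[OF that] by (simp add: of_nat_diff)
    have 2: "int (card {i \<in> window. \<not> a i > - int u - 1}) * int (card {j \<in> window. a j > - int u - 1}) = \<kappa> u * (int n - \<kappa> u)" if u: "u < B" for u
    proof -
      have "{i \<in> window. \<not> a i > - int u - 1} = {i \<in> window. a i < - int u}"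
        "{j \<in> window. a j > - int u - 1} = {j \<in> window. \<not> a j < - int u}" by auto
      then show ?thesis unfolding card_compl card_above(2)[OF u] \<kappa>_def using \<kappa>le[OF u]
        by (simp only: card_compl card_above(2)[OF u] of_nat_diff) simp
    qed
    have i: "inj_on (\<lambda>u. int u) {..<B}" "inj_on (\<lambda>u. - int u - 1) {..<B}" by (auto simp: inj_on_def)
    show ?thesis
      by (subst sum.union_disjoint[OF _ _ d]) (simp_all add: sum.reindex[OF i(1)] sum.reindex[OF i(2)] 1 2 o_def cong: sum.cong_simp)
  qed
  finally have s2: "(\<Sum>x\<in>T. a (snd x) - a (fst x)) = 2 * (\<Sum>u<B. \<kappa> u * (int n - \<kappa> u))"
    by (simp add: mult.commute)
  \<comment> \<open>All ordered pairs of positions are increasing, decreasing or on one level, and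
    the first two kinds are equally many.\<close>
  have s3: "2 * int (card T) + (int (n - 2 * sum_list ms) ^ 2 + 2 * (\<Sum>i<B. int (ms ! i) ^ 2)) = int n ^ 2"
  proof -
    define E where "E = {(i, j). i \<in> window \<and> j \<in> window \<and> a i = a j}"
    define T' where "T' = {(i, j). i \<in> window \<and> j \<in> window \<and> a j < a i}"
    have "window \<times> window = T \<union> T' \<union> E" by (auto simp: T_def T'_def E_def)
    moreover have "finite T'" "finite E" by (simp_all add: T'_def E_def)
    moreover have "card (T \<union> T' \<union> E) = card (T \<union> T') + card E"
      by (rule card_Un_disjoint) (use finT calculation in \<open>auto simp: T_def T'_def E_def\<close>)
    moreover have "card (T \<union> T') = card T + card T'"
      by (rule card_Un_disjoint) (use finT calculation in \<open>auto simp: T_def T'_def\<close>)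
    ultimately have "card (window \<times> window) = card T + card T' + card E" by (simp only:)
    moreover have "card T' = card T"
      by (rule bij_betw_same_card[of "\<lambda>x. (snd x, fst x)"], rule bij_betw_byWitness[where f' = "\<lambda>x. (snd x, fst x)"])
        (auto simp: T_def T'_def)
    moreover have "card E = (\<Sum>v\<in>{- int B..int B}. mult ms v ^ 2)"
    proof -
      have "E = (\<Union>v\<in>{- int B..int B}. {i \<in> window. a i = v} \<times> {i \<in> window. a i = v})"
        using range_a by (auto simp: E_def)
      then have "card E = (\<Sum>v\<in>{- int B..int B}. card ({i \<in> window. a i = v} \<times> {i \<in> window. a i = v}))"
        by (simp only:) (rule card_UN_disjoint, auto)
      then show ?thesis using fiber_a by (simp add: fiber_card_def card_cartesian_product power2_eq_square)
    qed
    moreover have "(\<Sum>v\<in>{- int B..int B}. mult ms v ^ 2) = (n - 2 * sum_list ms) ^ 2 + 2 * (\<Sum>i<B. (ms ! i) ^ 2)"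
      unfolding sum_split_sign mult_0 by (simp add: mult_pos mult_neg cong: sum.cong_simp)
    ultimately have "n ^ 2 = 2 * card T + ((n - 2 * sum_list ms) ^ 2 + 2 * (\<Sum>i<B. (ms ! i) ^ 2))"
      by (simp add: card_cartesian_product power2_eq_square)
    then have "int (n ^ 2) = int (2 * card T + ((n - 2 * sum_list ms) ^ 2 + 2 * (\<Sum>i<B. (ms ! i) ^ 2)))" by simp
    then show ?thesis by simp
  qed
  define k where "k = int (sum_list ms)"
  have s4: "int (tail_exp n ms) + 2 * (k * (int n - k)) + k = (\<Sum>i<B. int (ms ! i) ^ 2) + 2 * (\<Sum>u<B. \<kappa> u * (int n - \<kappa> u))"
    using tail_exp_thresholds[of ms n] sum_ms unfolding len_ms \<kappa>_def k_def by simp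
  have e5: "int (n - 2 * sum_list ms) = int n - 2 * k" using sum_ms by (simp add: k_def)
  have s5: "int (n - 2 * sum_list ms) ^ 2 = int n ^ 2 - 4 * (k * (int n - k))"
    unfolding e5 by (simp add: power2_eq_square algebra_simps)
  \<comment> \<open>With letters for the quadratic quantities (\<open>c\<close> for
    \<open>k * (n - k)\<close>) the four relations are linear.\<close>
  have "2 * x = 2 * (k + t)"
    if "x = T2 - C" "T2 = 2 * W" "2 * C + (N - 4 * c + 2 * S) = N" "t + 2 * c + k = S + 2 * W"
    for x k t T2 C W N c S :: int
  proof -
    have "C = 2 * c - S" using that(3) by simp
    moreover have "2 * W = t + 2 * c + k - S" using that(4) by simp
    ultimately have "x = k + t" using that(1,2) by simp
    then show ?thesis by simp
  qed
  from this[OF s1 s2 s3[unfolded s5] s4] have "2 * int (spread a) = 2 * (k + int (tail_exp n ms))" .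
  then show ?thesis by (simp add: k_def)
qed

lemma fiber_symmetric: "fiber_card window a (- v) = fiber_card window a v"
  by (simp add: fiber_a mult_uminus)

lemma sum_invol_maps_words:
  fixes t :: "'k::field fps"
  defines "t \<equiv> (fps_X - 1) / (fps_X + 1)"
  shows "(\<Sum>\<sigma>\<in>invol_maps window a. fps_X ^ level_invs window a \<sigma> * t ^ two_cycles window a \<sigma>)
    = t ^ sum_list ms * (prod_list (map (q_factorial (fps_X\<^sup>2)) ms) * sym_L (n - 2 * sum_list ms))"
proof -
  have "(\<Sum>\<sigma>\<in>invol_maps window a. fps_X ^ level_invs window a \<sigma> * t ^ two_cycles window a \<sigma>)
    = (\<Prod>v\<in>{1..int B}. t ^ fiber_card window a v * q_factorial (fps_X\<^sup>2) (fiber_card window a v)) * sym_L (fiber_card window a 0)"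
  proof (rule sum_invol_maps)
    show "\<forall>i\<in>window. 0 < a i \<longrightarrow> a i \<in> {1..int B}" using range_a by auto
    show "sym_L (Suc (Suc r)) = sym_L (Suc r) + t * fps_X * q_sum (fps_X\<^sup>2) (Suc r) * sym_L r" for r
      unfolding t_def by (rule sym_L_rec)
  qed (use fiber_symmetric sym_L_0 sym_L_1 in auto)
  also have "(\<Prod>v\<in>{1..int B}. t ^ fiber_card window a v * q_factorial (fps_X\<^sup>2) (fiber_card window a v))
     = (\<Prod>v\<in>{1..int B}. t ^ mult ms v) * prod_list (map (q_factorial (fps_X\<^sup>2)) ms)"
    unfolding fiber_a prod.distrib prod_mult_ms(2) by (rule refl)
  also have "(\<Prod>v\<in>{1..int B}. t ^ mult ms v) = t ^ sum_list ms"
  proof -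
    have "prod_list (map (power t) xs) = t ^ sum_list xs" for xs by (induction xs) (simp_all add: power_add)
    then show ?thesis unfolding prod_mult_ms(2) .
  qed
  finally show ?thesis unfolding fiber_a mult_0 by (simp add: mult.assoc)
qed

end

lemma sum_words_ms:
  "(\<Sum>a\<in>words window (mult ms). p ^ word_invs window a) * (q_factorial p (n - 2 * sum_list ms)
     * (prod_list (map (q_factorial p) ms) * prod_list (map (q_factorial p) ms))) = q_factorial p n"
  unfolding prod_mult_ms(1)[symmetric]
  using sum_words[of window "{- int B..int B}" "mult ms" p] mult_outside sum_mult by simp

lemma finite_words_ms: "finite (words window (mult ms))"
  by (rule finite_words[of _ "{- int B..int B}"]) (use mult_outside in auto)

text \<open>At \<open>p = 0\<close> an inversion generating function counts the objects without inversions, so the value 1 means unique existence.\<close>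
lemma unique_sorted_word: "\<exists>!a. a \<in> words window (mult ms) \<and> word_invs window a = 0"
proof -
  have one: "prod_list (map (\<lambda>_. 1::int) xs) = 1" for xs :: "nat list" by (induction xs) auto
  have "int (card {a \<in> words window (mult ms). word_invs window a = 0}) = 1"
    using sum_words_ms[of "0::int"] sum_zero_power_card[OF finite_words_ms, of "word_invs window"]
    by (simp add: q_factorial_zero[abs_def] one)
  then have "card {a \<in> words window (mult ms). word_invs window a = 0} = 1" by linarith
  from card_eq_1_unique[OF this] show ?thesis by simp
qed

text \<open>The multiplicities are symmetric, so each level is as large as its opposite, and there
  is one increasing bijection between them.\<close>

lemma unique_level_map:
  assumes a: "a \<in> words window (mult ms)"
  shows "\<exists>!\<sigma>. \<sigma> \<in> level_maps window a window (\<lambda>i. - a i) \<and> level_invs window a \<sigma> = 0"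
proof -
  have "fiber_card window (\<lambda>i. - a i) v = fiber_card window a (- v)" for v
    unfolding fiber_card_def by (rule arg_cong[of _ _ card]) auto
  then have "(\<Sum>\<sigma>\<in>level_maps window a window (\<lambda>i. - a i). (0::int) ^ level_invs window a \<sigma>)
     = (\<Prod>v\<in>a ` window. q_factorial 0 (fiber_card window a v))"
    by (intro sum_level_maps) (use fiber_symmetric[OF a] in auto)
  then have "int (card {\<sigma> \<in> level_maps window a window (\<lambda>i. - a i). level_invs window a \<sigma> = 0}) = 1"
    using sum_zero_power_card[OF finite_level_maps[OF finite_window finite_window], of "level_invs window a" a "\<lambda>i. - a i"]
    by (simp add: q_factorial_zero)
  then have "card {\<sigma> \<in> level_maps window a window (\<lambda>i. - a i). level_invs window a \<sigma> = 0} = 1" by linarith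
  from card_eq_1_unique[OF this] show ?thesis by simp
qed

lemma invol_maps_level_maps: "invol_maps window a \<subseteq> level_maps window a window (\<lambda>i. - a i)"
proof
  fix \<sigma> assume \<sigma>: "\<sigma> \<in> invol_maps window a"
  then show "\<sigma> \<in> level_maps window a window (\<lambda>i. - a i)"
    using invol_maps_bij[OF \<sigma>] by (auto simp: level_maps_def invol_maps_def)
qed

text \<open>The inverse of \<open>\<sigma>\<close> is again a level negating bijection without
  inversions, so uniqueness forces it to equal \<open>\<sigma>\<close>.\<close>

lemma level_map_invol:
  assumes a: "a \<in> words window (mult ms)"
    and \<sigma>: "\<sigma> \<in> level_maps window a window (\<lambda>i. - a i)" "level_invs window a \<sigma> = 0"
  shows "\<sigma> \<in> invol_maps window a"
proof -
  have b: "bij_betw \<sigma> window window" and e: "\<sigma> \<in> extensional window" and l: "\<And>i. i \<in> window \<Longrightarrow> a (\<sigma> i) = - a i"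
    using \<sigma>(1) by (auto simp: level_maps_def)
  have sw: "\<sigma> i \<in> window" if "i \<in> window" for i using b that by (auto simp: bij_betw_def)
  define \<tau> where "\<tau> = restrict (the_inv_into window \<sigma>) window"
  have bt: "bij_betw \<tau> window window"
    using bij_betw_the_inv_into[OF b] unfolding \<tau>_def by simp
  have tw: "\<tau> i \<in> window" if "i \<in> window" for i using bt that by (auto simp: bij_betw_def)
  have st: "\<sigma> (\<tau> i) = i" if "i \<in> window" for i
    using f_the_inv_into_f_bij_betw[OF b] that by (simp add: \<tau>_def)
  have lt: "- a (\<tau> i) = a i" if "i \<in> window" for i using l[OF tw[OF that]] st[OF that] by simp
  have "\<tau> \<in> level_maps window a window (\<lambda>i. - a i)"
    unfolding level_maps_def using bt lt by (auto simp: \<tau>_def)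
  moreover have "level_invs window a \<tau> = 0"
    unfolding level_invs_eq_0_iff
  proof (intro ballI impI, rule ccontr)
    fix i j assume ij: "i \<in> window" "j \<in> window" "i < j" "a i = a j" "\<not> \<tau> i \<le> \<tau> j"
    then have "\<tau> j < \<tau> i" "a (\<tau> j) = a (\<tau> i)" using lt[OF ij(1)] lt[OF ij(2)] by auto
    then have "\<sigma> (\<tau> j) \<le> \<sigma> (\<tau> i)" using \<sigma>(2) tw[OF ij(1)] tw[OF ij(2)] unfolding level_invs_eq_0_iff by blast
    then show False using st ij by simp
  qed
  ultimately have "\<tau> = \<sigma>" using unique_level_map[OF a] \<sigma> by blast
  then show ?thesis using st e l sw unfolding invol_maps_def by auto
qed

text \<open>Uniqueness of the sorted word and of the permutation turns the outer sum of the
  parabolic series into a sum with one term for each multiplicity list.\<close>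

lemma unique_sorted_invol: "\<exists>!w. w \<in> sorted_invols \<and> wind w \<in> words window (mult ms)"
proof -
  obtain a where a: "a \<in> words window (mult ms)" "word_invs window a = 0" using unique_sorted_word by blast
  obtain \<sigma> where \<sigma>: "\<sigma> \<in> level_maps window a window (\<lambda>i. - a i)" "level_invs window a \<sigma> = 0"
    using unique_level_map[OF a(1)] by blast
  have I: "\<sigma> \<in> invol_maps window a" by (rule level_map_invol[OF a(1) \<sigma>])
  have ae: "a \<in> extensional window" using a(1) by (simp add: words_def)
  note b = build_invols[OF I]
  show ?thesis
  proof (rule ex1I)
    show "build a \<sigma> \<in> sorted_invols \<and> wind (build a \<sigma>) \<in> words window (mult ms)"
      unfolding sorted_invols_def mem_Collect_eq b(2)[OF ae] b(3) using b(1) a \<sigma> by blast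
    fix w assume w: "w \<in> sorted_invols \<and> wind w \<in> words window (mult ms)"
    then have wi: "w \<in> invols" "word_invs window (wind w) = 0" "level_invs window (wind w) (perm w) = 0"
      unfolding sorted_invols_def by auto
    have wa: "wind w = a" using unique_sorted_word a w wi by blast
    have "perm w \<in> level_maps window a window (\<lambda>i. - a i)"
      using perm_invol_maps[OF wi(1)] invol_maps_level_maps unfolding wa by blast
    then have "perm w = \<sigma>" using unique_level_map[OF a(1)] \<sigma> wi(3) unfolding wa by blast
    then show "w = build a \<sigma>" using build_perm_wind[OF wi(1)] wa by simp
  qed
qed

end

end

section \<open>Truncation and comparison of the two series\<close>

context affine begin

lemma sorted_invols_subset: "sorted_invols \<subseteq> invols"
  unfolding sorted_invols_def by blast

definition ms_of :: "nat \<Rightarrow> (int \<Rightarrow> int) \<Rightarrow> nat list" where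
  "ms_of B a = map (\<lambda>i. fiber_card window a (int i + 1)) [0..<B]"

definition near :: "nat \<Rightarrow> (int \<Rightarrow> int) set" where
  "near B = {z \<in> invols. \<forall>i\<in>window. \<bar>wind z i\<bar> \<le> int B}"

lemma finite_near: "finite (near B)"
proof (rule finite_subset)
  show "near B \<subseteq> (\<lambda>(a, \<sigma>). build a \<sigma>) ` ((window \<rightarrow>\<^sub>E {- int B..int B}) \<times> (window \<rightarrow>\<^sub>E window))"
  proof
    fix z assume z: "z \<in> near B"
    then have zi: "z \<in> invols" and b: "\<And>i. i \<in> window \<Longrightarrow> \<bar>wind z i\<bar> \<le> int B" unfolding near_def by blast+
    have "wind z \<in> window \<rightarrow>\<^sub>E {- int B..int B}"
    proof (rule PiE_I)
      fix i assume "i \<in> window"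
      then show "wind z i \<in> {- int B..int B}" using b[of i] by auto
    qed (simp add: wind_def)
    moreover have "perm z \<in> window \<rightarrow>\<^sub>E window" by (auto simp: perm_def)
    ultimately show "z \<in> (\<lambda>(a, \<sigma>). build a \<sigma>) ` ((window \<rightarrow>\<^sub>E {- int B..int B}) \<times> (window \<rightarrow>\<^sub>E window))"
      using build_perm_wind[OF zi] by (intro image_eqI[of _ _ "(wind z, perm z)"]) auto
  qed
qed (intro finite_imageI finite_cartesian_product finite_PiE; simp)

lemma finite_Lists: "finite (Lists B)"
proof (rule finite_subset)
  show "Lists B \<subseteq> {ms. set ms \<subseteq> {..n} \<and> length ms = B}"
  proof
    fix ms assume "ms \<in> Lists B"
    then have "length ms = B" "2 * sum_list ms \<le> n" by (auto simp: Lists_def)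
    moreover have "x \<le> sum_list ms" if "x \<in> set ms" for x using that by (simp add: member_le_sum_list)
    ultimately show "ms \<in> {ms. set ms \<subseteq> {..n} \<and> length ms = B}" by fastforce
  qed
qed (rule finite_lists_length_eq, simp)

lemma invol_fiber:
  assumes z: "z \<in> invols"
  shows "fiber_card window (wind z) (- v) = fiber_card window (wind z) v"
proof -
  have I: "perm z \<in> invol_maps window (wind z)" by (rule perm_invol_maps[OF z])
  have "card {i \<in> window. wind z i = v \<and> True} = card {j \<in> window. - wind z j = v \<and> True}"
    by (rule bij_betw_same_card[OF bij_betw_fiber[OF invol_maps_bij[OF I], of "\<lambda>j. - wind z j" "wind z" v "\<lambda>_. True"]])
      (use I in \<open>auto simp: invol_maps_def\<close>)
  moreover have "{j \<in> window. - wind z j = v \<and> True} = {j \<in> window. wind z j = - v}" by auto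
  ultimately show ?thesis by (simp add: fiber_card_def)
qed

lemma near_words:
  assumes z: "z \<in> near B"
  shows "ms_of B (wind z) \<in> Lists B" and "wind z \<in> words window (mult (ms_of B (wind z)))"
proof -
  define a where "a = wind z"
  define ms where "ms = ms_of B a"
  have zi: "z \<in> invols" and b: "\<And>i. i \<in> window \<Longrightarrow> \<bar>a i\<bar> \<le> int B" using z unfolding near_def a_def by blast+
  have fs: "fiber_card window a (- v) = fiber_card window a v" for v unfolding a_def by (rule invol_fiber[OF zi])
  have lms: "length ms = B" by (simp add: ms_def ms_of_def)
  have nth: "ms ! i = fiber_card window a (int i + 1)" if "i < B" for i using that by (simp add: ms_def ms_of_def)
  have sl: "sum_list ms = (\<Sum>i<B. fiber_card window a (int i + 1))"
    unfolding ms_def ms_of_def by (simp add: interv_sum_list_conv_sum_set_nat lessThan_atLeast0)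
  have "a ` window \<subseteq> {- int B..int B}" using b by fastforce
  then have "(\<Sum>v\<in>{- int B..int B}. fiber_card window a v) = n"
    using sum_fiber_card[of window "{- int B..int B}" a] by simp
  then have n: "fiber_card window a 0 + sum_list ms + sum_list ms = n"
    unfolding sum_split_sign fs sl .
  show "ms_of B (wind z) \<in> Lists B"
    unfolding a_def[symmetric] ms_def[symmetric] Lists_def using lms n by simp
  have "fiber_card window a v = mult ms v" for v
  proof -
    consider "v = 0" | "v \<noteq> 0" "\<bar>v\<bar> \<le> int B" | "\<bar>v\<bar> > int B" by linarith
    then show ?thesis
    proof cases
      case 1
      then show ?thesis using n by (simp add: mult_def)
    next
      case 2
      then have "ms ! nat (\<bar>v\<bar> - 1) = fiber_card window a (int (nat (\<bar>v\<bar> - 1)) + 1)" by (intro nth) auto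
      also have "int (nat (\<bar>v\<bar> - 1)) + 1 = \<bar>v\<bar>" using 2 by simp
      also have "fiber_card window a \<bar>v\<bar> = fiber_card window a v" using fs[of v] by (simp add: abs_if)
      finally show ?thesis using 2 by (simp add: mult_def lms)
    next
      case 3
      then have "{i \<in> window. a i = v} = {}" using b by fastforce
      then have "fiber_card window a v = 0" unfolding fiber_card_def by (simp only: card.empty)
      then show ?thesis using 3 by (simp add: mult_def lms)
    qed
  qed
  then show "wind z \<in> words window (mult (ms_of B (wind z)))"
    unfolding a_def[symmetric] ms_def[symmetric] words_def by (simp add: a_def)
qed

lemma words_near:
  assumes ms: "ms \<in> Lists B" and z: "z \<in> invols" "wind z \<in> words window (mult ms)"
  shows "z \<in> near B" and "ms_of B (wind z) = ms"
proof -
  have "\<bar>wind z i\<bar> \<le> int B" if "i \<in> window" for i using range_a[OF ms z(2) that] by auto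
  then show "z \<in> near B" unfolding near_def using z(1) by blast
  show "ms_of B (wind z) = ms"
    by (rule nth_equalityI) (simp_all add: ms_of_def len_ms[OF ms] fiber_a[OF ms z(2)] mult_pos[OF ms])
qed

text \<open>Lists of length \<open>B\<close> classify the involutions with all
  \<open>\<bar>wind z i\<bar> \<le> B\<close>. The set \<open>Z\<close> is arbitrary so as to serve
  both all involutions and the minimal ones.\<close>

lemma sum_near:
  assumes Z: "Z \<subseteq> invols"
  shows "sum h (Z \<inter> near B) = (\<Sum>ms\<in>Lists B. sum h {z \<in> Z. wind z \<in> words window (mult ms)})"
proof -
  have "sum h (Z \<inter> near B) = (\<Sum>ms\<in>Lists B. sum h {z. z \<in> Z \<inter> near B \<and> ms_of B (wind z) = ms})"
    by (rule sum.group[symmetric]) (use finite_near finite_Lists near_words(1) in auto)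
  also have "\<dots> = (\<Sum>ms\<in>Lists B. sum h {z \<in> Z. wind z \<in> words window (mult ms)})"
  proof (rule sum.cong[OF refl])
    fix ms assume ms: "ms \<in> Lists B"
    have "{z. z \<in> Z \<inter> near B \<and> ms_of B (wind z) = ms} = {z \<in> Z. wind z \<in> words window (mult ms)}"
      using words_near[OF ms] near_words(2)[of _ B] Z by blast
    then show "sum h {z. z \<in> Z \<inter> near B \<and> ms_of B (wind z) = ms} = sum h {z \<in> Z. wind z \<in> words window (mult ms)}"
      by (simp only:)
  qed
  finally show ?thesis .
qed

text \<open>If some value exceeds \<open>B\<close> in absolute value, its negative occurs as well,
  and this single pair already contributes at least \<open>B\<close> to
  \<open>spread\<close>.\<close>

lemma far_len:
  assumes z: "z \<in> invols" "z \<notin> near B"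
  shows "B \<le> len z"
proof -
  obtain i where i: "i \<in> window" "\<bar>wind z i\<bar> > int B" using z unfolding near_def by force
  define a where "a = wind z"
  have I: "perm z i \<in> window" "a (perm z i) = - a i"
    using perm_invol_maps[OF z(1)] i(1) unfolding invol_maps_def a_def by blast+
  obtain j k where jk: "j \<in> window" "k \<in> window" "a j > int B" "a k = - a j"
  proof -
    consider "a i > int B" | "- a i > int B" using i(2) unfolding a_def by linarith
    then show ?thesis
    proof cases
      case 1
      then show ?thesis by (rule that[OF i(1) I(1) _ I(2)])
    next
      case 2
      have "a i = - a (perm z i)" unfolding I(2) by simp
      from that[OF I(1) i(1) _ this] show ?thesis unfolding I(2) using 2 by blast
    qed
  qed
  define T where "T = {(i, j). i \<in> window \<and> j \<in> window \<and> a i < a j}"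
  have finT: "finite T" by (simp add: T_def)
  have mem: "(k, j) \<in> T" using jk by (auto simp: T_def)
  have "(case (k, j) of (i, j) \<Rightarrow> nat (a j - a i - 1)) \<le> spread a"
    unfolding spread_def T_def[symmetric] by (rule member_le_sum[OF mem _ finT]) simp
  then have "B \<le> spread a" using jk by simp
  then show ?thesis using len_invol[OF z(1)] by (simp add: a_def)
qed

lemma q_factorial_list_nth_0:
  "prod_list (map (q_factorial (fps_X\<^sup>2 :: 'k::field fps)) ms) $ 0 = 1"
  by (induction ms) (simp_all add: fps_power_zeroth)

text \<open>The bridge between the two series: \<open>M\<close>, the sum over rearrangements, and
  \<open>F / (Q * (P * P))\<close>, the quotient of Poincare series, are the same multinomial. The
  factor \<open>Q\<close> belongs to level 0, one \<open>P\<close> to the positive and one to the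
  negative levels.\<close>

lemma unit_identity:
  fixes M P Q F G L :: "'k::field fps"
  assumes "M * (Q * (P * P)) = F" "L / Q = 1 / G" "Q $ 0 \<noteq> 0" "P $ 0 \<noteq> 0" "G $ 0 \<noteq> 0"
  shows "M * (P * L) = F / G * inverse P" and "F / (Q * (P * P)) * (P * L) = F / G * inverse P"
proof -
  have iQ: "Q * inverse Q = 1" and iP: "P * inverse P = 1"
    using assms(3,4) by (simp_all add: inverse_mult_eq_1')
  have "L * inverse Q = inverse G" using assms(2,3,5) by (simp add: fps_divide_unit)
  then have L: "L = Q * inverse G" using iQ by (metis mult.assoc mult.commute mult_1_right)
  have F: "F / G = F * inverse G" using assms(5) by (rule fps_divide_unit)
  have "F * inverse P = M * (Q * P) * (P * inverse P)" unfolding assms(1)[symmetric] by (simp only: mult_ac)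
  then have MP: "F * inverse P = M * (Q * P)" using iP by simp
  have "M * (P * L) = (M * (Q * P)) * inverse G" unfolding L by (simp only: mult_ac)
  then show "M * (P * L) = F / G * inverse P" unfolding MP[symmetric] F by (simp only: mult_ac)
  have "F / (Q * (P * P)) = F * inverse (Q * (P * P))" using assms(3,4) by (intro fps_divide_unit) simp
  also have "\<dots> = F * (inverse Q * (inverse P * inverse P))" by (simp only: fps_inverse_mult)
  finally have "F / (Q * (P * P)) * (P * L) = F * inverse G * inverse P * (Q * inverse Q) * (P * inverse P)"
    unfolding L by (simp only: mult_ac)
  then show "F / (Q * (P * P)) * (P * L) = F / G * inverse P" unfolding F iQ iP by simp
qed

text \<open>For fixed multiplicities \<open>spread\<close> is constant, and the sum over the
  permutations is the same for every rearrangement of the levels, so the rearrangements factor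
  out.\<close>

lemma sum_invols_ms:
  fixes t :: "'k::field fps"
  defines "t \<equiv> (fps_X - 1) / (fps_X + 1)"
  assumes ms: "ms \<in> Lists B"
  defines "k \<equiv> sum_list ms"
  shows "(\<Sum>z\<in>{z \<in> invols. wind z \<in> words window (mult ms)}. fps_X ^ len z * t ^ exc z)
    = t ^ k * fps_X ^ k * (q_factorial (fps_X\<^sup>2) n / q_factorial fps_X (n - 2 * k)) * list_weight n ms"
proof -
  let ?W = "words window (mult ms)"
  let ?S = "{z \<in> invols. wind z \<in> ?W}"
  define PP where "PP = (prod_list (map (q_factorial (fps_X\<^sup>2)) ms) :: 'k fps)"
  define Lk where "Lk = (sym_L (n - 2 * k) :: 'k fps)"
  have finS: "finite ?S" by (rule finite_subset[OF _ finite_near[of B]]) (use words_near(1)[OF ms] in blast)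
  have "(\<Sum>z\<in>?S. fps_X ^ len z * t ^ exc z) = (\<Sum>a\<in>?W. \<Sum>z\<in>{z. z \<in> ?S \<and> wind z = a}. fps_X ^ len z * t ^ exc z)"
    by (rule sum.group[symmetric]) (use finS finite_words_ms[OF ms] in auto)
  also have "\<dots> = (\<Sum>a\<in>?W. (fps_X\<^sup>2) ^ word_invs window a * (fps_X ^ (k + tail_exp n ms) * (t ^ k * (PP * Lk))))"
  proof (rule sum.cong[OF refl])
    fix a assume a: "a \<in> ?W"
    have ae: "a \<in> extensional window" using a by (simp add: words_def)
    have "{z. z \<in> ?S \<and> wind z = a} = {z \<in> invols. wind z = a}" using a by blast
    then have "(\<Sum>z\<in>{z. z \<in> ?S \<and> wind z = a}. fps_X ^ len z * t ^ exc z)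
       = (\<Sum>z\<in>{z \<in> invols. wind z = a}. fps_X ^ (spread a + 2 * word_invs window a + level_invs window a (perm z)) * t ^ two_cycles window a (perm z))"
      by (intro sum.cong) (auto simp: len_invol exc_invol)
    also have "\<dots> = (\<Sum>\<sigma>\<in>invol_maps window a. fps_X ^ (spread a + 2 * word_invs window a + level_invs window a \<sigma>) * t ^ two_cycles window a \<sigma>)"
      by (rule sum.reindex_bij_betw[OF wind_bij[OF ae]])
    also have "\<dots> = fps_X ^ (spread a + 2 * word_invs window a) * (\<Sum>\<sigma>\<in>invol_maps window a. fps_X ^ level_invs window a \<sigma> * t ^ two_cycles window a \<sigma>)"
      by (simp add: sum_distrib_left power_add mult.assoc)
    also have "\<dots> = (fps_X\<^sup>2) ^ word_invs window a * (fps_X ^ (k + tail_exp n ms) * (t ^ k * (PP * Lk)))"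
      unfolding t_def sum_invol_maps_words[OF ms a] spread_words[OF ms a] PP_def Lk_def k_def
      by (simp only: power_add power_mult mult_ac)
    finally show "(\<Sum>z\<in>{z. z \<in> ?S \<and> wind z = a}. fps_X ^ len z * t ^ exc z)
       = (fps_X\<^sup>2) ^ word_invs window a * (fps_X ^ (k + tail_exp n ms) * (t ^ k * (PP * Lk)))" .
  qed
  also have "\<dots> = fps_X ^ (k + tail_exp n ms) * t ^ k * ((\<Sum>a\<in>?W. (fps_X\<^sup>2) ^ word_invs window a) * (PP * Lk))"
    unfolding sum_distrib_right[symmetric] by (simp only: mult_ac)
  also have "(\<Sum>a\<in>?W. (fps_X\<^sup>2) ^ word_invs window a) * (PP * Lk)
     = q_factorial (fps_X\<^sup>2) n / q_factorial fps_X (n - 2 * k) * inverse PP"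
  proof (rule unit_identity(1))
    show "(\<Sum>a\<in>?W. (fps_X\<^sup>2) ^ word_invs window a) * (q_factorial (fps_X\<^sup>2) (n - 2 * k) * (PP * PP)) = (q_factorial (fps_X\<^sup>2) n :: 'k fps)"
      unfolding PP_def k_def by (rule sum_words_ms[OF ms])
    show "Lk / q_factorial (fps_X\<^sup>2) (n - 2 * k) = 1 / q_factorial fps_X (n - 2 * k)"
      unfolding Lk_def by (rule sym_L_quotient)
  qed (simp_all add: PP_def q_factorial_list_nth_0 fps_power_zeroth)
  finally show ?thesis unfolding list_weight_def PP_def by (simp only: power_add mult_ac)
qed

definition parabolic_term :: "'k::field \<Rightarrow> (int \<Rightarrow> int) \<Rightarrow> 'k fps" where
  "parabolic_term s w = fps_X ^ word_length (affine_sym n) (affine_gens n) w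
     * (fps_const s * ((1 - fps_X) / (1 + fps_X))) ^ twisted_abs_length (affine_sym n) (affine_gens n) (\<lambda>x. x) w
     * (fps_compose (poincare_series (subgroup_generated (affine_sym n) (affine_J n)) (affine_J n)) (fps_X ^ 2)
        / fps_compose (poincare_series (subgroup_generated (affine_sym n) (affine_J n \<inter> (\<lambda>x. w \<circ> x \<circ> w) ` affine_J n))
            (affine_J n \<inter> (\<lambda>x. w \<circ> x \<circ> w) ` affine_J n)) (fps_X ^ 2))
     * L_series (subgroup_generated (affine_sym n) (affine_J n \<inter> (\<lambda>x. w \<circ> x \<circ> w) ` affine_J n))
         (affine_J n \<inter> (\<lambda>x. w \<circ> x \<circ> w) ` affine_J n) (\<lambda>x. w \<circ> x \<circ> w)"

lemma L_parabolic_affine: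
  "L_parabolic (affine_sym n) (affine_gens n) (affine_J n) s = infsum (parabolic_term s) sorted_invols"
proof -
  have "invols \<inter> min_coset_reps (affine_sym n) (affine_gens n) (affine_J n) = sorted_invols"
    using min_coset_reps_iff sorted_invols_subset by blast
  then show ?thesis
    unfolding L_parabolic_def twisted_involutions_affine parabolic_term_def Let_def mult_eq by (simp only:)
qed

text \<open>This sign turns the weight of the full series into that of the parabolic one at
  \<open>s = -1\<close>.\<close>

lemma neg_ratio: "(fps_X - 1) / (fps_X + 1) = - ((1 - fps_X) / (1 + fps_X) :: 'k::field fps)"
proof (rule fps_to_fls_eq_imp_fps_eq)
  show "fps_to_fls ((fps_X - 1) / (fps_X + 1)) = fps_to_fls (- ((1 - fps_X) / (1 + fps_X)) :: 'k fps)"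
    unfolding fps_to_fls_uminus fls_ratio by (simp only: minus_divide_left minus_diff_eq add.commute)
qed

text \<open>Apart from \<open>s\<close> and the sign, one minimal involution contributes what all
  involutions with these multiplicities contribute to the full series: the quotient of Poincare
  series stands for the sum over rearrangements, the inner series for the sum over
  permutations.\<close>

lemma parabolic_term_ms:
  fixes s :: "'k::field"
  assumes ms: "ms \<in> Lists B" and w: "w \<in> sorted_invols" "wind w \<in> words window (mult ms)"
  defines "k \<equiv> sum_list ms"
  shows "parabolic_term s w = fps_const (s ^ k) * ((1 - fps_X) / (1 + fps_X)) ^ k * fps_X ^ k
     * (q_factorial (fps_X\<^sup>2) n / q_factorial fps_X (n - 2 * k)) * list_weight n ms"
proof -
  define R where "R = ((1 - fps_X) / (1 + fps_X) :: 'k fps)"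
  define PP where "PP = (prod_list (map (q_factorial (fps_X\<^sup>2)) ms) :: 'k fps)"
  define Lk where "Lk = (sym_L (n - 2 * k) :: 'k fps)"
  define K where "K = adj_swap ` level_index (wind w)"
  define LS where "LS = (L_series (subgroup_generated (affine_sym n) K) K (\<lambda>x. w \<circ> x \<circ> w) :: 'k fps)"
  have wi: "w \<in> invols" using w(1) sorted_invols_subset by blast
  have ex: "exc w = k" unfolding sw_exc[OF w(1)] k_def by (rule card_positive[OF ms w(2)])
  have ln: "len w = k + tail_exp n ms" unfolding sw_len[OF w(1)] k_def by (rule spread_words[OF ms w(2)])
  have PJ: "fps_compose (poincare_series (subgroup_generated (affine_sym n) (affine_J n)) (affine_J n)) (fps_X ^ 2)
     = (q_factorial (fps_X\<^sup>2) n :: 'k fps)"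
    unfolding affine_J_eq_level
    by (subst poincare_series_level[of "\<lambda>_. 0" "{0}"]) (auto simp: fiber_card_def mono_on_def)
  have PK: "fps_compose (poincare_series (subgroup_generated (affine_sym n) K) K) (fps_X ^ 2)
     = q_factorial (fps_X\<^sup>2) (n - 2 * k) * (PP * PP)"
    unfolding K_def PP_def k_def prod_mult_ms(1)[OF ms, symmetric] fiber_a[OF ms w(2), symmetric]
    by (rule poincare_series_level[OF sw_mono[OF w(1)]]) (use range_a[OF ms w(2)] in auto)
  \<comment> \<open>The inner series is known only together with the factor
    \<open>(- R) ^ k\<close>. Multiplying by the sign yields it together with \<open>R ^ k\<close>,
    which the summand provides.\<close>
  have "(- R) ^ k * LS = (- R) ^ k * (PP * Lk)"
    using trans[OF sw_L_series[OF w(1), where 'k = 'k] sum_invol_maps_words[OF ms w(2), where 'k = 'k]] unfolding ex neg_ratio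
    unfolding R_def LS_def K_def PP_def Lk_def k_def .
  then have "(-1) ^ k * ((- R) ^ k * LS) = (-1) ^ k * ((- R) ^ k * (PP * Lk))" by simp
  then have RL: "R ^ k * LS = R ^ k * (PP * Lk)"
    unfolding mult.assoc[symmetric] power_mult_distrib[symmetric] by simp
  have sw: "(\<Sum>a\<in>words window (mult ms). (fps_X\<^sup>2) ^ word_invs window a) * (q_factorial (fps_X\<^sup>2) (n - 2 * k) * (PP * PP))
     = (q_factorial (fps_X\<^sup>2) n :: 'k fps)"
    unfolding PP_def k_def by (rule sum_words_ms[OF ms])
  have key: "q_factorial (fps_X\<^sup>2) n / (q_factorial (fps_X\<^sup>2) (n - 2 * k) * (PP * PP)) * (PP * Lk)
     = q_factorial (fps_X\<^sup>2) n / q_factorial fps_X (n - 2 * k) * inverse PP"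
  proof (rule unit_identity(2)[OF sw])
    show "Lk / q_factorial (fps_X\<^sup>2) (n - 2 * k) = 1 / q_factorial fps_X (n - 2 * k)"
      unfolding Lk_def by (rule sym_L_quotient)
  qed (simp_all add: PP_def q_factorial_list_nth_0 fps_power_zeroth)
  have "parabolic_term s w = fps_X ^ (k + tail_exp n ms) * (fps_const s * R) ^ k
     * (q_factorial (fps_X\<^sup>2) n / (q_factorial (fps_X\<^sup>2) (n - 2 * k) * (PP * PP))) * LS"
    unfolding parabolic_term_def sw_K[OF w(1)] K_def[symmetric] PJ PK affine_word_length[OF invols_AS[OF wi]]
      twisted_abs_length_affine[OF wi] ex ln R_def[symmetric] LS_def[symmetric] ..
  also have "(fps_const s * R) ^ k = fps_const (s ^ k) * R ^ k"
    by (simp only: power_mult_distrib fps_const_power)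
  also have "fps_X ^ (k + tail_exp n ms) * (fps_const (s ^ k) * R ^ k)
     * (q_factorial (fps_X\<^sup>2) n / (q_factorial (fps_X\<^sup>2) (n - 2 * k) * (PP * PP))) * LS
    = fps_X ^ (k + tail_exp n ms) * fps_const (s ^ k)
     * (q_factorial (fps_X\<^sup>2) n / (q_factorial (fps_X\<^sup>2) (n - 2 * k) * (PP * PP))) * (R ^ k * LS)"
    by (simp only: mult_ac)
  also have "\<dots> = fps_X ^ (k + tail_exp n ms) * fps_const (s ^ k) * R ^ k
     * (q_factorial (fps_X\<^sup>2) n / (q_factorial (fps_X\<^sup>2) (n - 2 * k) * (PP * PP)) * (PP * Lk))"
    unfolding RL by (simp only: mult_ac)
  finally show ?thesis
    unfolding key unfolding R_def[symmetric] list_weight_def PP_def[symmetric] by (simp only: power_add mult_ac)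
qed

text \<open>Lists of length \<open>B\<close> and sum \<open>k\<close> add up to
  \<open>partial_weight n B k\<close>, which agrees with the limit modulo
  \<open>fps_X ^ B\<close>.\<close>

lemma involution_gf_lists:
  fixes s :: "'k::field"
  shows "fps_X ^ B dvd (involution_gf n s - (\<Sum>ms\<in>Lists B. fps_const (s ^ sum_list ms) * ((1 - fps_X) / (1 + fps_X)) ^ sum_list ms * fps_X ^ sum_list ms
     * (q_factorial (fps_X\<^sup>2) n / q_factorial fps_X (n - 2 * sum_list ms)) * list_weight n ms))"
proof -
  define c where "c k = fps_const (s ^ k) * ((1 - fps_X) / (1 + fps_X)) ^ k * fps_X ^ k
     * (q_factorial (fps_X\<^sup>2) n / q_factorial fps_X (n - 2 * k))" for k
  have "(\<Sum>ms\<in>Lists B. c (sum_list ms) * list_weight n ms)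
    = (\<Sum>k = 0..n div 2. \<Sum>ms\<in>{ms. ms \<in> Lists B \<and> sum_list ms = k}. c (sum_list ms) * list_weight n ms)"
    by (rule sum.group[symmetric]) (use finite_Lists in \<open>auto simp: Lists_def\<close>)
  also have "\<dots> = (\<Sum>k = 0..n div 2. c k * partial_weight n B k)"
  proof (rule sum.cong[OF refl])
    fix k assume "k \<in> {0..n div 2}"
    then have "{ms. ms \<in> Lists B \<and> sum_list ms = k} = sum_lists B k" by (auto simp: Lists_def sum_lists_def)
    then have "(\<Sum>ms\<in>{ms. ms \<in> Lists B \<and> sum_list ms = k}. c (sum_list ms) * list_weight n ms) = (\<Sum>ms\<in>sum_lists B k. c k * list_weight n ms)"
      by (intro sum.cong) (auto simp: sum_lists_def)
    then show "(\<Sum>ms\<in>{ms. ms \<in> Lists B \<and> sum_list ms = k}. c (sum_list ms) * list_weight n ms) = c k * partial_weight n B k"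
      by (simp only: sum_distrib_left[symmetric] partial_weight_lists)
  qed
  finally have L: "(\<Sum>ms\<in>Lists B. c (sum_list ms) * list_weight n ms) = (\<Sum>k = 0..n div 2. c k * partial_weight n B k)" .
  have I: "involution_gf n s = (\<Sum>k = 0..n div 2. c k * limit_weight n k)"
    by (simp only: involution_gf_def c_def)
  have "involution_gf n s - (\<Sum>ms\<in>Lists B. c (sum_list ms) * list_weight n ms)
    = (\<Sum>k = 0..n div 2. c k * (limit_weight n k - partial_weight n B k))"
    unfolding L I by (simp only: sum_subtractf right_diff_distrib)
  moreover have "fps_X ^ B dvd (\<Sum>k = 0..n div 2. c k * (limit_weight n k - partial_weight n B k))"
  proof (intro dvd_sum dvd_mult)
    fix k assume "k \<in> {0..n div 2}"
    then have "k < n" using n_pos by auto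
    then show "fps_X ^ B dvd (limit_weight n k - partial_weight n B k :: 'k fps)" by (rule partial_weight_limit)
  qed
  ultimately show ?thesis unfolding c_def by (simp only:)
qed

lemma L_parabolic_gf:
  "L_parabolic (affine_sym n) (affine_gens n) (affine_J n) s = involution_gf n s"
  unfolding L_parabolic_affine
proof (rule infsum_fps_limit[where S = "\<lambda>B. sorted_invols \<inter> near B"])
  fix B
  show "finite (sorted_invols \<inter> near B)" using finite_near by blast
  show "sorted_invols \<inter> near B \<subseteq> sorted_invols" by blast
  show "fps_X ^ B dvd parabolic_term s z" if z: "z \<in> sorted_invols" "z \<notin> sorted_invols \<inter> near B" for z
  proof -
    have zi: "z \<in> invols" using z sorted_invols_subset by blast
    have "B \<le> len z" by (rule far_len[OF zi]) (use z in blast)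
    then show ?thesis
      unfolding parabolic_term_def affine_word_length[OF invols_AS[OF zi]] mult.assoc
      by (intro dvd_mult2 le_imp_power_dvd)
  qed
  have "sum (parabolic_term s) {z \<in> sorted_invols. wind z \<in> words window (mult ms)}
    = fps_const (s ^ sum_list ms) * ((1 - fps_X) / (1 + fps_X)) ^ sum_list ms * fps_X ^ sum_list ms
     * (q_factorial (fps_X\<^sup>2) n / q_factorial fps_X (n - 2 * sum_list ms)) * list_weight n ms" if ms: "ms \<in> Lists B" for ms
  proof -
    obtain w where w: "w \<in> sorted_invols" "wind w \<in> words window (mult ms)"
      and u: "\<And>v. v \<in> sorted_invols \<Longrightarrow> wind v \<in> words window (mult ms) \<Longrightarrow> v = w"
      using unique_sorted_invol[OF ms] by blast
    then have "{z \<in> sorted_invols. wind z \<in> words window (mult ms)} = {w}" by blast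
    then show ?thesis using parabolic_term_ms[OF ms w] by simp
  qed
  then show "fps_X ^ B dvd (involution_gf n s - sum (parabolic_term s) (sorted_invols \<inter> near B))"
    unfolding sum_near[OF sorted_invols_subset] using involution_gf_lists[of B s] by (simp cong: sum.cong_simp)
qed

lemma L_series_gf:
  "L_series (affine_sym n) (affine_gens n) (\<lambda>x. x) = (involution_gf n (-1) :: 'k::field fps)"
  unfolding L_series_affine
proof (rule infsum_fps_limit[where S = near])
  fix B
  show "finite (near B)" by (rule finite_near)
  show "near B \<subseteq> invols" unfolding near_def by blast
  show "fps_X ^ B dvd (fps_X ^ len z * ((fps_X - 1) / (fps_X + 1)) ^ exc z :: 'k fps)" if "z \<in> invols" "z \<notin> near B" for z
    using far_len[OF that] by (intro dvd_mult2 le_imp_power_dvd)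
  have nb: "invols \<inter> near B = near B" unfolding near_def by blast
  have m1: "fps_const (-1) = (-1 :: 'k fps)" by (metis fps_const_1_eq_1 fps_const_neg)
  have "((fps_X - 1) / (fps_X + 1)) ^ k = (fps_const ((-1) ^ k) * ((1 - fps_X) / (1 + fps_X)) ^ k :: 'k fps)" for k
    unfolding neg_ratio fps_const_power[symmetric] m1 power_mult_distrib[symmetric] by simp
  then have "(\<Sum>z\<in>{z \<in> invols. wind z \<in> words window (mult ms)}. fps_X ^ len z * ((fps_X - 1) / (fps_X + 1)) ^ exc z)
    = (fps_const ((-1) ^ sum_list ms) * ((1 - fps_X) / (1 + fps_X)) ^ sum_list ms * fps_X ^ sum_list ms
     * (q_factorial (fps_X\<^sup>2) n / q_factorial fps_X (n - 2 * sum_list ms)) * list_weight n ms :: 'k fps)" if "ms \<in> Lists B" for ms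
    using sum_invols_ms[OF that, where 'k = 'k] by (simp only:)
  then show "fps_X ^ B dvd (involution_gf n (-1) - (\<Sum>z\<in>near B. fps_X ^ len z * ((fps_X - 1) / (fps_X + 1)) ^ exc z) :: 'k fps)"
    using sum_near[OF order_refl, of "\<lambda>z. fps_X ^ len z * ((fps_X - 1) / (fps_X + 1)) ^ exc z :: 'k fps" B] involution_gf_lists[of B "-1 :: 'k"]
    unfolding nb by (simp only: cong: sum.cong)
qed

end

theorem theorem1p12:
  fixes n :: nat and s :: "'k::field_char_0"
  assumes "n > 0"
  shows "T_affine n s =
    (\<Sum>k = 0..n div 2.
       fps_const (s ^ k) * fps_X ^ (k ^ 2) * (q_int n / q_int (2 * n - 2 * k))
       * q_binomial (n - k) k * q_pochhammer (- (fps_X ^ (k + 1))) (n - 2 * k))"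
proof -
  interpret affine n by unfold_locales (rule assms)
  have "T_affine n s = involution_gf n s / involution_gf n (-1)"
    unfolding T_affine_def L_parabolic_gf L_series_gf ..
  also have "\<dots> = (\<Sum>k = 0..n div 2. fps_const (s ^ k) * chebyshev_coeff n k)"
    by (rule involution_gf_quotient[OF assms])
  finally show ?thesis by (simp only: chebyshev_coeff_def mult.assoc)
qed

end
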